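(* Let $(M_n)$ be a sequence of deterministic complex $n\times n$ matrices satisfying $\sup_n \frac1n\|M_n\|_2^2<\infty$. Let $x$ and $y$ be complex random variables with mean $0$ and variance $1$, and let $\Phi_n$ and $\Psi_n$ be $n\times n$ random matrices whose entries are iid copies of $x/\sqrt n$ and of $y/\sqrt n$, respectively. Let $\gamma>1.5$ be a constant and set $A_n=M_n+n^{-\gamma}\Phi_n$ and $B_n=M_n+n^{-\gamma}\Psi_n$. Assume that for almost every $z\in\mathbb C$ (with respect to Lebesgue measure) there are positive numbers $\epsilon=\epsilon(n,z)$ such that, for each $n$, there is a set $S$ of at least $n-n/\log^{1.1}n$ rows of $M_n+zI$ that is $\epsilon$-stable, and $$\frac{n^{3/4-\gamma/2}\log n}{\epsilon}\to 0\quad\text{as } n\to\infty.$$ Then $\mu_{A_n}-\mu_{B_n}$ converges in probability to zero as $n\to\infty$.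
   Context: For an $n\times n$ complex matrix $A$ with eigenvalues $\lambda_1,\dots,\lambda_n$ (with multiplicity), the empirical spectral distribution is $\mu_A=\frac1n\sum_{j=1}^n\delta_{\lambda_j}$, a probability measure on $\mathbb C$. "$\mu_{A_n}-\mu_{B_n}$ converges in probability to zero" means that for every smooth compactly supported $g:\mathbb C\to\mathbb C$, $\int g\,d\mu_{A_n}-\int g\,d\mu_{B_n}\to0$ in probability. A set of vectors $\{v_1,\dots,v_k\}$ in $\mathbb C^n$ is $\epsilon$-stable if $\mathrm{dist}(v_j,\mathrm{Span}\{v_i:1\le i\le k,\ i\ne j\})\ge\epsilon$ for all $1\le j\le k$ (Euclidean distance; the span of the empty set is $\{0\}$). $\|M\|_2=\mathrm{tr}(M^*M)^{1/2}$ is the Hilbert-Schmidt norm. $I$ is the $n\times n$ identity matrix. Logarithms are natural, and $\log^{a}n=(\log n)^{a}$. The variance of a mean-zero complex random variable $x$ is $\mathbb E|x|^2$. *)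

theory Defs
  imports
    "HOL-Probability.Probability"
    "HOL-Computational_Algebra.Fundamental_Theorem_Algebra"
    "Jordan_Normal_Form.Char_Poly"
    "Jordan_Normal_Form.Schur_Decomposition"
    "Jordan_Normal_Form.VS_Connect"
begin

text \<open>
  The dimension varies inside the statement, so matrices and vectors are those of
  \<open>Jordan_Normal_Form\<close>, with carriers \<open>carrier_mat n n\<close> and \<open>carrier_vec n\<close>.
\<close>

text \<open>
  The law of a uniformly chosen root of the characteristic polynomial; \<open>proots\<close> lists roots
  with multiplicity, so this is \<open>1/n\<close> times the sum of the point masses at the eigenvalues
  (see \<open>integral_esd\<close> below). The push-forward only changes the sigma-algebra, from the discrete
  to the Borel one. For \<open>n = 0\<close> the value is meaningless.
\<close>

definition esd :: "complex mat \<Rightarrow> complex measure" where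
  "esd A = distr (measure_pmf (pmf_of_multiset (proots (char_poly A)))) borel (\<lambda>z. z)"

lemma prob_space_esd: "prob_space (esd A)"
  unfolding esd_def by (rule measure_pmf.prob_space_distr) simp

lemma integral_esd:
  fixes g :: "complex \<Rightarrow> complex"
  assumes A: "A \<in> carrier_mat n n" and n: "0 < n" and g: "g \<in> borel_measurable borel"
  shows "(\<integral>z. g z \<partial>esd A) = (\<Sum>z\<in>#proots (char_poly A). g z) / of_nat n"
proof -
  let ?R = "proots (char_poly A)"
  have size: "size ?R = n"
    using A by (simp add: size_proots_complex degree_monic_char_poly)
  hence ne: "?R \<noteq> {#}" using n by auto
  have "(\<integral>z. g z \<partial>esd A) = (\<integral>z. g z \<partial>measure_pmf (pmf_of_multiset ?R))"
    unfolding esd_def using g by (subst integral_distr) auto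
  also have "\<dots> = (\<Sum>z\<in>set_mset ?R. pmf (pmf_of_multiset ?R) z *\<^sub>R g z)"
    using ne by (subst integral_measure_pmf[where A = "set_mset ?R"]) auto
  also have "\<dots> = (\<Sum>z\<in>set_mset ?R. of_nat (count ?R z) * g z) / of_nat n"
    unfolding sum_divide_distrib
    by (rule sum.cong) (simp_all add: ne pmf_of_multiset size scaleR_conv_of_real)
  also have "(\<Sum>z\<in>set_mset ?R. of_nat (count ?R z) * g z) = (\<Sum>z\<in>#?R. g z)"
  proof -
    have "(\<Sum>z\<in>S. of_nat (count R z) * g z) = (\<Sum>z\<in>#R. g z)"
      if "finite S" "set_mset R \<subseteq> S" for R S
      using that
    proof (induction R)
      case (add r R)
      have "(\<Sum>z\<in>S. of_nat (count (add_mset r R) z) * g z)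
          = (\<Sum>z\<in>S. (if z = r then g z else 0) + of_nat (count R z) * g z)"
        by (rule sum.cong) (auto simp: algebra_simps)
      also have "\<dots> = g r + (\<Sum>z\<in>S. of_nat (count R z) * g z)"
        using add.prems by (simp add: sum.distrib)
      finally show ?case using add by simp
    qed simp
    thus ?thesis by simp
  qed
  finally show ?thesis .
qed

definition hs_norm :: "complex mat \<Rightarrow> real" where
  "hs_norm A = sqrt (Re (\<Sum>i<dim_col A. (mat_adjoint A * A) $$ (i, i)))"

abbreviation cspan :: "nat \<Rightarrow> complex vec set \<Rightarrow> complex vec set" where
  "cspan n \<equiv> LinearCombinations.module.span class_ring (module_vec TYPE(complex) n)"

lemma cspan_empty: "cspan n {} = {0\<^sub>v n}"
proof -
  interpret vec_space "TYPE(complex)" n .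
  show ?thesis by (simp add: span_empty)
qed

definition vec_dist :: "complex vec \<Rightarrow> complex vec \<Rightarrow> real" where
  "vec_dist v w = L2_set (\<lambda>i. dist (vec_index v i) (vec_index w i)) {..<dim_vec v}"

definition vec_infdist :: "complex vec \<Rightarrow> complex vec set \<Rightarrow> real" where
  "vec_infdist v W = (INF w\<in>W. vec_dist v w)"

text \<open>
  The vectors form an indexed family. For \<open>\<epsilon> > 0\<close> a stable family is injective,
  so this agrees with the notion for sets of vectors.
\<close>

definition eps_stable :: "nat \<Rightarrow> real \<Rightarrow> ('i \<Rightarrow> complex vec) \<Rightarrow> 'i set \<Rightarrow> bool" where
  "eps_stable n \<epsilon> v J \<longleftrightarrow> (\<forall>j\<in>J. \<epsilon> \<le> vec_infdist (v j) (cspan n (v ` (J - {j}))))"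

text \<open>
  \<open>C\<^sup>k\<close> in the sense of real differentiability, by iterated directional derivatives;
  \<open>smooth\<close> on \<open>complex\<close> thus means smooth on the real plane, not holomorphic.
\<close>

fun differentiable_upto ::
    "nat \<Rightarrow> ('a::real_normed_vector \<Rightarrow> 'b::real_normed_vector) \<Rightarrow> bool" where
  "differentiable_upto 0 g \<longleftrightarrow> continuous_on UNIV g"
| "differentiable_upto (Suc k) g \<longleftrightarrow>
     (\<forall>x. g differentiable (at x)) \<and>
     (\<forall>v. differentiable_upto k (\<lambda>x. frechet_derivative g (at x) v))"

definition smooth :: "('a::real_normed_vector \<Rightarrow> 'b::real_normed_vector) \<Rightarrow> bool" where
  "smooth g \<longleftrightarrow> (\<forall>k. differentiable_upto k g)"

definition compactly_supported :: "('a::topological_space \<Rightarrow> 'b::zero) \<Rightarrow> bool" where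
  "compactly_supported g \<longleftrightarrow> compact (closure {x. g x \<noteq> 0})"

text \<open>
  The limit is a constant, so the \<open>n\<close>-th variable may live on its own probability space.
  Measurability is demanded because \<open>measure\<close> is \<open>0\<close> on non-measurable sets.
\<close>

definition tendsto_zero_in_prob ::
    "(nat \<Rightarrow> 'w measure) \<Rightarrow> (nat \<Rightarrow> 'w \<Rightarrow> complex) \<Rightarrow> bool" where
  "tendsto_zero_in_prob P X \<longleftrightarrow>
     (\<forall>n. X n \<in> borel_measurable (P n)) \<and>
     (\<forall>\<delta>>0. (\<lambda>n. measure (P n) {\<omega>\<in>space (P n). \<delta> \<le> cmod (X n \<omega>)}) \<longlonglongrightarrow> 0)"

definition measure_diff_tendsto_zero_in_prob ::
    "(nat \<Rightarrow> 'w measure) \<Rightarrow> (nat \<Rightarrow> 'w \<Rightarrow> complex measure) \<Rightarrow>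
     (nat \<Rightarrow> 'w \<Rightarrow> complex measure) \<Rightarrow> bool" where
  "measure_diff_tendsto_zero_in_prob P \<mu> \<nu> \<longleftrightarrow>
     (\<forall>g :: complex \<Rightarrow> complex. smooth g \<and> compactly_supported g \<longrightarrow>
        tendsto_zero_in_prob P (\<lambda>n \<omega>. (\<integral>z. g z \<partial>\<mu> n \<omega>) - (\<integral>z. g z \<partial>\<nu> n \<omega>)))"

definition mean_zero_variance_one :: "'a measure \<Rightarrow> ('a \<Rightarrow> complex) \<Rightarrow> bool" where
  "mean_zero_variance_one Q x \<longleftrightarrow>
     x \<in> borel_measurable Q \<and>
     integrable Q x \<and> (\<integral>\<omega>. x \<omega> \<partial>Q) = 0 \<and>
     integrable Q (\<lambda>\<omega>. (cmod (x \<omega>))\<^sup>2) \<and> (\<integral>\<omega>. (cmod (x \<omega>))\<^sup>2 \<partial>Q) = 1"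

definition iid_entries ::
    "'w measure \<Rightarrow> nat \<Rightarrow> ('w \<Rightarrow> complex mat) \<Rightarrow> complex measure \<Rightarrow> bool" where
  "iid_entries P n X D \<longleftrightarrow>
     (\<forall>\<omega>\<in>space P. X \<omega> \<in> carrier_mat n n) \<and>
     prob_space.indep_vars P (\<lambda>_. borel) (\<lambda>ij \<omega>. X \<omega> $$ ij) ({..<n} \<times> {..<n}) \<and>
     (\<forall>i<n. \<forall>j<n. distr P borel (\<lambda>\<omega>. X \<omega> $$ (i, j)) = D)"

end

theory Submission
  imports Defs "HOL-Complex_Analysis.Complex_Analysis" "HOL-Real_Asymp.Real_Asymp"
begin

text \<open>
  Write \<open>L\<^sub>A(z) = ln \<bar>det (A + z I)\<bar> / n\<close>. Averages of \<open>ln\<close> of the distance over a circle of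
  radius \<open>r\<close> differ from its value at the centre by a compactly supported kernel, so every continuous
  compactly supported test function can be approximated by functions whose integral against
  the spectral distribution is an integral of \<open>L\<^sub>A\<close>. Since the second moments of the
  eigenvalues are bounded by Schur's inequality, it suffices that \<open>L\<^sub>A(z) - L\<^sub>B(z)\<close> tends to \<open>0\<close>
  in probability for almost every \<open>z\<close>.

  For fixed \<open>z\<close> both potentials are compared with one deterministic quantity. Replace the rows
  of \<open>M + z I\<close> outside \<open>S\<close> by unit vectors orthogonal to all other rows; the resulting \<open>N'\<close> has all rows
  \<open>min \<epsilon> 1\<close>-stable, that is, the entries of its inverse are at most \<open>1 / min \<epsilon> 1\<close>. Passing from \<open>N'\<close>
  to \<open>A + z I\<close> in two steps, first perturbing the rows in \<open>S\<close> and then exchanging the others, the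
  Leibniz formula bounds the determinant ratios in both directions: the first step costs
  \<open>2 n T / min \<epsilon> 1\<close>, where \<open>T\<close> is the sum of the absolute values of the entries of the noise and
  has mean at most \<open>n powr (3/2 - \<gamma>)\<close>; the second costs \<open>O(ln n)\<close> for each of the at most
  \<open>n / ln n powr 1.1\<close> exchanged rows, as soon as the smallest singular value of \<open>A + z I\<close> is polynomially
  small at worst.

  The latter holds with probability tending to \<open>1\<close>. Nearly sparse null vectors, with \<open>O(n / ln n)\<close>
  large coordinates, are excluded by a union bound over a grid. A null vector with many large
  coordinates makes a column nearly orthogonal to a normal vector of the other columns, which
  by a Littlewood-Offord estimate is unlikely. That estimate is proved by comparing the
  concentration of a sum on separated windows before and after adding one summand, so that
  only the second moment of the entries is used.
\<close>

section \<open>Concentration of sums of independent variables\<close>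

definition separated :: "real \<Rightarrow> real set \<Rightarrow> bool" where
  "separated L A \<longleftrightarrow> finite A \<and> (\<forall>a\<in>A. \<forall>b\<in>A. a < b \<longrightarrow> a + L \<le> b)"

definition conc_bound :: "real \<Rightarrow> nat \<Rightarrow> real \<Rightarrow> (real \<Rightarrow> real) \<Rightarrow> bool" where
  "conc_bound L R \<kappa> F \<longleftrightarrow>
     (\<forall>A. separated L A \<longrightarrow> sum F A \<le> 1) \<and>
     (\<forall>A. separated L A \<longrightarrow> card A \<le> R \<longrightarrow>
        sum F A \<le> real (card A) / real R + \<kappa> * (real (card A) * (2 * real R - real (card A))))"

lemma separated_image:
  "separated L A \<Longrightarrow> separated L ((\<lambda>a. a - z) ` A)"
  unfolding separated_def by auto

lemma sum_shift: "(\<Sum>a\<in>A. F (a - z)) = sum F ((\<lambda>a. a - z) ` A)" for F :: "real \<Rightarrow> real"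
  by (subst sum.reindex) (auto simp: inj_on_def)

text \<open>
  The translate of the largest element of \<open>A\<close> by \<open>-z\<close> lies beyond the translate of \<open>A\<close> by \<open>-z'\<close>,
  so it can be moved there: two families of \<open>r\<close> windows become families of \<open>r + 1\<close> and \<open>r - 1\<close>,
  and concavity of \<open>r (2 R - r)\<close> yields the gain \<open>-2\<close>.
\<close>

lemma conc_swap:
  fixes F :: "real \<Rightarrow> real"
  assumes cb: "conc_bound L R \<kappa> F" and L: "L > 0" and sep: "separated L A"
    and A: "A \<noteq> {}" "card A < R" and z: "z + L \<le> z'"
  defines "r \<equiv> real (card A)"
  shows "(\<Sum>a\<in>A. F (a - z)) + (\<Sum>a\<in>A. F (a - z'))
           \<le> 2 * (r / R) + \<kappa> * (2 * (r * (2 * real R - r)) - 2)"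
proof -
  have fin: "finite A" using sep by (simp add: separated_def)
  define m where "m = Max A"
  have m: "m \<in> A" "\<And>a. a \<in> A \<Longrightarrow> a \<le> m" unfolding m_def using fin A by auto
  define U where "U = insert (m - z) ((\<lambda>a. a - z') ` A)"
  define V where "V = (\<lambda>a. a - z) ` (A - {m})"
  have nin: "m - z \<notin> (\<lambda>a. a - z') ` A"
    using m z L by fastforce
  have sU: "separated L U"
    unfolding separated_def U_def
  proof (intro conjI ballI impI)
    fix a b assume ab: "a \<in> insert (m - z) ((\<lambda>a. a - z') ` A)" "b \<in> insert (m - z) ((\<lambda>a. a - z') ` A)" "a < b"
    have 1: "x - z' + L \<le> m - z" if "x \<in> A" for x using m(2)[OF that] z by linarith
    show "a + L \<le> b"
      using ab 1 sep L unfolding separated_def by fastforce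
  qed (use fin in auto)
  have sV: "separated L V" unfolding V_def
    by (rule separated_image) (use sep in \<open>auto simp: separated_def\<close>)
  have cU: "card U = card A + 1" unfolding U_def using nin fin
    by (simp add: card_image inj_on_def)
  have cV: "card V = card A - 1" unfolding V_def using m(1) fin
    by (subst card_image) (auto simp: inj_on_def)
  have c1: "card A \<ge> 1" using fin A by (simp add: Suc_leI card_gt_0_iff)
  have "(\<Sum>a\<in>A. F (a - z)) + (\<Sum>a\<in>A. F (a - z')) = sum F U + sum F V"
    unfolding U_def V_def using nin fin m(1)
    by (simp add: sum_shift[symmetric] sum.remove[of A m])
  also have "sum F U \<le> (r + 1) / R + \<kappa> * ((r + 1) * (2 * real R - (r + 1)))"
    using cb sU cU A unfolding conc_bound_def r_def by (auto dest!: spec[of _ U] simp: add.commute)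
  also have "sum F V \<le> (r - 1) / R + \<kappa> * ((r - 1) * (2 * real R - (r - 1)))"
    using cb sV cV A c1 unfolding conc_bound_def r_def by (auto dest!: spec[of _ V] simp: of_nat_diff)
  finally show ?thesis by (simp add: field_simps add_divide_distrib diff_divide_distrib)
qed

lemma conc_bound_convolution:
  fixes F :: "real \<Rightarrow> real" and \<mu> :: "real measure"
  assumes \<mu>: "prob_space \<mu>" and sets[measurable_cong]: "sets \<mu> = sets borel"
    and F[measurable]: "F \<in> borel_measurable borel" and F01: "\<And>x. 0 \<le> F x" "\<And>x. F x \<le> 1"
    and cb: "conc_bound L R \<kappa> F" and L: "L > 0" and R: "R > 0" and \<kappa>: "\<kappa> \<ge> 0" and q0: "q \<ge> 0"
    and q: "q \<le> measure (\<mu> \<Otimes>\<^sub>M \<mu>) {(z, z'). L \<le> \<bar>z - z'\<bar>}"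
  shows "conc_bound L R (\<kappa> * (1 - q / (real R)\<^sup>2)) (\<lambda>a. \<integral>z. F (a - z) \<partial>\<mu>)"
proof -
  interpret prob_space \<mu> by fact
  interpret PP: pair_prob_space \<mu> \<mu> ..
  have int: "integrable \<mu> (\<lambda>z. F (a - z))" for a
    by (rule integrable_const_bound[of _ 1]) (use F01 in auto)
  have sumint: "(\<Sum>a\<in>A. \<integral>z. F (a - z) \<partial>\<mu>) = (\<integral>z. (\<Sum>a\<in>A. F (a - z)) \<partial>\<mu>)" for A
    using int by (simp add: Bochner_Integration.integral_sum)
  have one: "(\<Sum>a\<in>A. \<integral>z. F (a - z) \<partial>\<mu>) \<le> 1" if "separated L A" for A
  proof -
    have "(\<integral>z. (\<Sum>a\<in>A. F (a - z)) \<partial>\<mu>) \<le> (\<integral>z. 1 \<partial>\<mu>)"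
    proof (rule integral_mono)
      show "(\<Sum>a\<in>A. F (a - z)) \<le> 1" for z
        using cb separated_image[OF that, of z] unfolding sum_shift conc_bound_def by blast
    qed (use int in auto)
    thus ?thesis by (simp add: sumint prob_space)
  qed
  moreover have "(\<Sum>a\<in>A. \<integral>z. F (a - z) \<partial>\<mu>) \<le> r / R + \<kappa> * (1 - q / (real R)\<^sup>2) * (r * (2 * real R - r))"
    if sep: "separated L A" and cR: "card A \<le> R" and r: "r = real (card A)" for A r
  proof -
    have fin: "finite A" using sep by (simp add: separated_def)
    have qle: "q \<le> 1" using q PP.prob_le_1 order_trans by blast
    have nonneg: "0 \<le> \<kappa> * (1 - q / (real R)\<^sup>2) * (r * (2 * real R - r))"
    proof -
      have "q \<le> (real R)\<^sup>2" using qle R by (smt (verit) of_nat_1 of_nat_le_iff one_le_power Suc_leI One_nat_def)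
      hence "q / (real R)\<^sup>2 \<le> 1" using R by (simp add: divide_le_eq)
      thus ?thesis using \<kappa> r cR by simp
    qed
    show ?thesis
    proof (cases "A = {} \<or> card A = R")
      case True
      thus ?thesis using one[OF sep] nonneg R r by auto
    next
      case False
      hence cA: "A \<noteq> {}" "card A < R" using cR by auto
      define h where "h = r / R + \<kappa> * (r * (2 * real R - r))"
      define D where "D = {(z, z'). L \<le> \<bar>z - z'\<bar>}"
      have D[measurable]: "D \<in> sets (\<mu> \<Otimes>\<^sub>M \<mu>)"
      proof -
        have "D = {x\<in>space (\<mu> \<Otimes>\<^sub>M \<mu>). L \<le> \<bar>fst x - snd x\<bar>}"
          using sets_eq_imp_space_eq[OF sets] by (auto simp: D_def space_pair_measure)
        thus ?thesis by simp
      qed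
      let ?S = "\<lambda>z. \<Sum>a\<in>A. F (a - z)"
      have S1: "?S z \<le> h" for z
        using cb separated_image[OF sep, of z] cR
        unfolding sum_shift conc_bound_def h_def r
        by (auto dest!: spec[of _ "(\<lambda>a. a - z) ` A"] simp: card_image inj_on_def)
      have S2: "?S z + ?S z' \<le> 2 * h - 2 * \<kappa>" if "L \<le> \<bar>z - z'\<bar>" for z z'
      proof (cases "z + L \<le> z'")
        case True
        show ?thesis using conc_swap[OF cb L sep cA True] by (simp add: h_def r algebra_simps)
      next
        case False
        hence "z' + L \<le> z" using that by linarith
        from conc_swap[OF cb L sep cA this] show ?thesis by (simp add: h_def r algebra_simps)
      qed
      have intS: "integrable \<mu> ?S" using int by auto
      have bS: "norm (?S z) \<le> real (card A)" for z
        using sum_mono[of A "\<lambda>a. F (a - z)" "\<lambda>_. 1"] F01 by (simp add: sum_nonneg)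
      have i1: "integrable (\<mu> \<Otimes>\<^sub>M \<mu>) (\<lambda>x. ?S (fst x))" "integrable (\<mu> \<Otimes>\<^sub>M \<mu>) (\<lambda>x. ?S (snd x))"
        by (rule PP.integrable_const_bound[of _ "real (card A)"]; use bS in simp)+
      have e1: "(\<integral>x. ?S (fst x) \<partial>(\<mu> \<Otimes>\<^sub>M \<mu>)) = (\<integral>z. ?S z \<partial>\<mu>)"
        by (subst PP.integral_fst'[symmetric]) (use i1 in \<open>auto simp: prob_space\<close>)
      have e2: "(\<integral>x. ?S (snd x) \<partial>(\<mu> \<Otimes>\<^sub>M \<mu>)) = (\<integral>z. ?S z \<partial>\<mu>)"
        by (subst PP.integral_fst'[symmetric]) (use i1 in \<open>auto simp: prob_space\<close>)
      have intD: "integrable (\<mu> \<Otimes>\<^sub>M \<mu>) (\<lambda>x. 2 * \<kappa> * indicator D x)"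
        by (intro integrable_mult_right integrable_real_indicator) (auto simp: less_top[symmetric])
      have "2 * (\<integral>z. ?S z \<partial>\<mu>) = (\<integral>x. ?S (fst x) + ?S (snd x) \<partial>(\<mu> \<Otimes>\<^sub>M \<mu>))"
        using i1 e1 e2 by simp
      also have "\<dots> \<le> (\<integral>x. 2 * h - 2 * \<kappa> * indicator D x \<partial>(\<mu> \<Otimes>\<^sub>M \<mu>))"
      proof (rule integral_mono)
        show "?S (fst x) + ?S (snd x) \<le> 2 * h - 2 * \<kappa> * indicator D x" for x
          using S2[of "fst x" "snd x"] S1[of "fst x"] S1[of "snd x"]
          by (cases "x \<in> D") (auto simp: D_def)
      qed (use i1 intD in auto)
      also have "\<dots> = 2 * h - 2 * \<kappa> * measure (\<mu> \<Otimes>\<^sub>M \<mu>) D"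
        using intD by (subst Bochner_Integration.integral_diff) (auto simp: PP.prob_space)
      also have "\<dots> \<le> 2 * h - 2 * \<kappa> * q"
        using q \<kappa> by (simp add: D_def mult_left_mono)
      finally have "(\<integral>z. ?S z \<partial>\<mu>) \<le> h - \<kappa> * q" by simp
      also have "\<dots> \<le> r / R + \<kappa> * (1 - q / (real R)\<^sup>2) * (r * (2 * real R - r))"
      proof -
        have "r * (2 * real R - r) \<le> (real R)\<^sup>2"
          using zero_le_power2[of "real R - r"] by (simp add: power2_eq_square algebra_simps)
        hence "q / (real R)\<^sup>2 * (r * (2 * real R - r)) \<le> q / (real R)\<^sup>2 * (real R)\<^sup>2"
          using q0 by (intro mult_left_mono) auto
        hence "\<kappa> * (q / (real R)\<^sup>2 * (r * (2 * real R - r))) \<le> \<kappa> * q"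
          using \<kappa> R by (intro mult_left_mono) auto
        thus ?thesis unfolding h_def by (simp add: algebra_simps)
      qed
      finally show ?thesis by (simp add: sumint)
    qed
  qed
  ultimately show ?thesis unfolding conc_bound_def by blast
qed

lemma (in pair_prob_space) measure_pair_le:
  assumes E: "E \<in> sets (M1 \<Otimes>\<^sub>M M2)"
    and le: "\<And>x. x \<in> space M1 \<Longrightarrow> measure M2 (Pair x -` E) \<le> \<rho>"
  shows "measure (M1 \<Otimes>\<^sub>M M2) E \<le> \<rho>"
proof -
  have \<rho>: "0 \<le> \<rho>"
  proof -
    obtain x where "x \<in> space M1" using M1.not_empty by blast
    thus ?thesis using order_trans[OF measure_nonneg le[of x]] by simp
  qed
  have "emeasure (M1 \<Otimes>\<^sub>M M2) E = (\<integral>\<^sup>+x. emeasure M2 (Pair x -` E) \<partial>M1)"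
    using E by (rule M2.emeasure_pair_measure_alt)
  also have "\<dots> \<le> (\<integral>\<^sup>+x. ennreal \<rho> \<partial>M1)"
    by (rule nn_integral_mono) (simp add: M2.emeasure_eq_measure le ennreal_leI)
  also have "\<dots> = ennreal \<rho>" by (simp add: M1.emeasure_space_1)
  finally show ?thesis using \<rho> by (simp add: emeasure_eq_measure)
qed

lemma (in prob_space) indep_var_section_le:
  assumes ind: "indep_var S X T Y" and E: "E \<in> sets (S \<Otimes>\<^sub>M T)"
    and le: "\<And>y. y \<in> space T \<Longrightarrow> prob {\<omega>\<in>space M. (X \<omega>, y) \<in> E} \<le> \<rho>"
  shows "prob {\<omega>\<in>space M. (X \<omega>, Y \<omega>) \<in> E} \<le> \<rho>"
proof -
  have rv[measurable]: "X \<in> measurable M S" "Y \<in> measurable M T"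
    using ind by (auto simp: indep_var_distribution_eq)
  have "indep_set A B \<Longrightarrow> indep_set B A" for A B
    unfolding indep_sets2_eq by (metis Int_commute mult.commute)
  hence ind': "indep_var T Y S X"
    using ind unfolding indep_var_eq by simp
  hence eq: "distr M T Y \<Otimes>\<^sub>M distr M S X = distr M (T \<Otimes>\<^sub>M S) (\<lambda>x. (Y x, X x))"
    by (auto simp: indep_var_distribution_eq)
  interpret X: prob_space "distr M S X" by (rule prob_space_distr) simp
  interpret Y: prob_space "distr M T Y" by (rule prob_space_distr) simp
  interpret PP: pair_prob_space "distr M T Y" "distr M S X" ..
  define E' where "E' = {p\<in>space (T \<Otimes>\<^sub>M S). (snd p, fst p) \<in> E}"
  have E'[measurable]: "E' \<in> sets (T \<Otimes>\<^sub>M S)"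
  proof -
    have "(\<lambda>p. (snd p, fst p)) \<in> measurable (T \<Otimes>\<^sub>M S) (S \<Otimes>\<^sub>M T)" by simp
    from measurable_sets[OF this E] show ?thesis
      unfolding E'_def by (simp add: vimage_def Int_def conj_commute)
  qed
  have sect: "Pair y -` E' \<in> sets S" for y using sets_Pair1[OF E'] .
  have "{\<omega>\<in>space M. (X \<omega>, Y \<omega>) \<in> E} = (\<lambda>x. (Y x, X x)) -` E' \<inter> space M"
    using rv[THEN measurable_space] by (auto simp: E'_def space_pair_measure)
  hence "measure M {\<omega>\<in>space M. (X \<omega>, Y \<omega>) \<in> E} = measure (distr M T Y \<Otimes>\<^sub>M distr M S X) E'"
    unfolding eq by (subst measure_distr) auto
  also have "\<dots> \<le> \<rho>"
  proof (rule PP.measure_pair_le)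
    fix y assume "y \<in> space (distr M T Y)"
    hence y: "y \<in> space T" by simp
    have "measure (distr M S X) (Pair y -` E') = measure M (X -` (Pair y -` E') \<inter> space M)"
      by (rule measure_distr) (use sect in auto)
    also have "X -` (Pair y -` E') \<inter> space M = {\<omega>\<in>space M. (X \<omega>, y) \<in> E}"
      using rv(1)[THEN measurable_space] y by (auto simp: E'_def space_pair_measure)
    finally show "measure (distr M S X) (Pair y -` E') \<le> \<rho>" using le[OF y] by simp
  qed (simp cong: sets_pair_measure_cong)
  finally show ?thesis .
qed

definition window_prob :: "'a measure \<Rightarrow> ('a \<Rightarrow> real) \<Rightarrow> real \<Rightarrow> real \<Rightarrow> real" where
  "window_prob M S L a = (\<integral>\<omega>. (if a \<le> S \<omega> \<and> S \<omega> < a + L then 1 else 0) \<partial>M)"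

lemma (in prob_space) conc_bound_sum:
  fixes Z :: "'i \<Rightarrow> 'a \<Rightarrow> real"
  assumes I: "finite I" and ind: "indep_vars (\<lambda>_. borel) Z I"
    and L: "L > 0" and R: "R > 0" and q: "0 \<le> q"
    and J: "J \<subseteq> I" "\<And>i. i \<in> J \<Longrightarrow> q \<le> measure (M \<Otimes>\<^sub>M M) {x\<in>space (M \<Otimes>\<^sub>M M). L \<le> \<bar>Z i (fst x) - Z i (snd x)\<bar>}"
    and q1: "q \<le> 1"
  shows "conc_bound L R ((1 - q / (real R)\<^sup>2) ^ card J) (window_prob M (\<lambda>\<omega>. \<Sum>i\<in>I. Z i \<omega>) L)"
  using I ind J
proof (induction I arbitrary: J rule: finite_induct)
  case empty
  have *: "sum (window_prob M (\<lambda>\<omega>. 0) L) A \<le> (if card A = 0 then 0 else 1)" if A: "separated L A" for A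
  proof -
    have fin: "finite A" using A by (simp add: separated_def)
    have "sum (window_prob M (\<lambda>\<omega>. 0) L) A = (\<Sum>a\<in>A. if a \<le> 0 \<and> 0 < a + L then 1 else 0)"
      unfolding window_prob_def by (intro sum.cong) (auto simp: prob_space)
    also have "\<dots> = real (card {a\<in>A. a \<le> 0 \<and> 0 < a + L})"
      using fin by (simp add: sum.If_cases Int_def)
    also have "card {a\<in>A. a \<le> 0 \<and> 0 < a + L} \<le> 1"
    proof -
      have "a = b" if "a \<in> A" "b \<in> A" "a \<le> 0" "0 < a + L" "b \<le> 0" "0 < b + L" for a b
        using that A unfolding separated_def by (smt (verit))
      thus ?thesis by (simp add: card_le_Suc0_iff_eq fin)
    qed
    finally show ?thesis by (cases "card A = 0") (use fin in auto)
  qed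
  have "1 \<le> real (card A) / real R + (real (card A) * (2 * real R - real (card A)))"
    if "card A \<le> R" "card A \<noteq> 0" for A :: "real set"
  proof -
    have "1 * 1 \<le> (real (card A) * (2 * real R - real (card A)))"
      using that R by (intro mult_mono) auto
    thus ?thesis using R by (smt (verit, best) divide_nonneg_nonneg of_nat_0_le_iff)
  qed
  note ** = this
  show ?case unfolding conc_bound_def using empty.prems
  proof (intro conjI allI impI)
    fix A :: "real set" assume A: "separated L A"
    show "sum (window_prob M (\<lambda>\<omega>. \<Sum>i\<in>{}. Z i \<omega>) L) A \<le> 1" using *[OF A] by (simp split: if_splits)
    assume "card A \<le> R"
    thus "sum (window_prob M (\<lambda>\<omega>. \<Sum>i\<in>{}. Z i \<omega>) L) A
         \<le> real (card A) / real R + (1 - q / (real R)\<^sup>2) ^ card J *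
            (real (card A) * (2 * real R - real (card A)))"
      using *[OF A] **[of A] empty.prems by (cases "card A = 0") auto
  qed
next
  case (insert i I)
  let ?S = "\<lambda>\<omega>. \<Sum>i\<in>I. Z i \<omega>"
  define \<mu> where "\<mu> = distr M borel (Z i)"
  have indI: "indep_vars (\<lambda>_. borel) Z I" by (rule indep_vars_subset[OF insert.prems(1)]) auto
  have rv[measurable]: "\<And>j. j \<in> insert i I \<Longrightarrow> Z j \<in> borel_measurable M"
    using insert.prems(1) by (auto simp: indep_vars_def)
  have rvi[measurable]: "Z i \<in> borel_measurable M" by auto
  have rvS[measurable]: "?S \<in> borel_measurable M" by (rule borel_measurable_sum) auto
  interpret mu: prob_space \<mu> unfolding \<mu>_def by (rule prob_space_distr) simp
  interpret nu: prob_space "distr M borel ?S" by (rule prob_space_distr) simp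
  interpret MN: pair_prob_space \<mu> "distr M borel ?S" ..
  let ?F = "window_prob M ?S L"
  have F_alt: "?F a = (\<integral>s. (if a \<le> s \<and> s < a + L then 1 else 0) \<partial>distr M borel ?S)" for a
    unfolding window_prob_def by (subst integral_distr) auto
  have Fm: "?F \<in> borel_measurable borel"
    unfolding F_alt[abs_def] by measurable
  have F0: "0 \<le> ?F a" for a unfolding window_prob_def by (rule integral_nonneg_AE) auto
  have F1: "?F a \<le> 1" for a
  proof -
    have "?F a \<le> (\<integral>\<omega>. 1 \<partial>M)" unfolding window_prob_def
      by (rule integral_mono) (auto intro!: integrable_const_bound[of _ 1])
    thus ?thesis by (simp add: prob_space)
  qed
  have conv: "window_prob M (\<lambda>\<omega>. \<Sum>i\<in>insert i I. Z i \<omega>) L = (\<lambda>a. \<integral>z. ?F (a - z) \<partial>\<mu>)"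
  proof
    fix a
    have "distr M borel (Z i) \<Otimes>\<^sub>M distr M borel ?S = distr M (borel \<Otimes>\<^sub>M borel) (\<lambda>x. (Z i x, ?S x))"
      using indep_vars_sum[OF insert(1,2) insert.prems(1)] by (simp add: indep_var_distribution_eq)
    hence eq: "\<mu> \<Otimes>\<^sub>M distr M borel ?S = distr M (borel \<Otimes>\<^sub>M borel) (\<lambda>x. (Z i x, ?S x))"
      by (simp add: \<mu>_def)
    let ?h = "\<lambda>p. if a \<le> fst p + snd p \<and> fst p + snd p < a + L then 1 else (0::real)"
    have "window_prob M (\<lambda>\<omega>. \<Sum>i\<in>insert i I. Z i \<omega>) L a = (\<integral>\<omega>. ?h (Z i \<omega>, ?S \<omega>) \<partial>M)"
      unfolding window_prob_def using insert by simp
    also have "\<dots> = (\<integral>p. ?h p \<partial>(\<mu> \<Otimes>\<^sub>M distr M borel ?S))"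
      unfolding eq by (subst integral_distr) auto
    also have "\<dots> = (\<integral>z. (\<integral>s. ?h (z, s) \<partial>distr M borel ?S) \<partial>\<mu>)"
    proof (rule MN.integral_fst'[symmetric])
      show "integrable (\<mu> \<Otimes>\<^sub>M distr M borel ?S) ?h"
        by (rule MN.integrable_const_bound[of _ 1]) (auto simp: \<mu>_def)
    qed
    also have "\<dots> = (\<integral>z. ?F (a - z) \<partial>\<mu>)"
      unfolding F_alt by (intro Bochner_Integration.integral_cong refl) (auto simp: algebra_simps)
    finally show "window_prob M (\<lambda>\<omega>. \<Sum>i\<in>insert i I. Z i \<omega>) L a = (\<integral>z. ?F (a - z) \<partial>\<mu>)" .
  qed
  have k0: "0 \<le> (1 - q / (real R)\<^sup>2) ^ k" for k
  proof -
    have "q \<le> (real R)\<^sup>2" using q1 R one_le_power[of "real R" 2] by linarith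
    thus ?thesis using R by (simp add: divide_le_eq)
  qed
  have IH: "conc_bound L R ((1 - q / (real R)\<^sup>2) ^ card (J - {i})) ?F"
    by (rule insert.IH[OF indI]) (use insert.prems in auto)
  have meas_eq: "measure (\<mu> \<Otimes>\<^sub>M \<mu>) {(z, z'). L \<le> \<bar>z - z'\<bar>} =
      measure (M \<Otimes>\<^sub>M M) {x\<in>space (M \<Otimes>\<^sub>M M). L \<le> \<bar>Z i (fst x) - Z i (snd x)\<bar>}"
  proof -
    have "\<mu> \<Otimes>\<^sub>M \<mu> = distr (M \<Otimes>\<^sub>M M) (borel \<Otimes>\<^sub>M borel) (\<lambda>(x, y). (Z i x, Z i y))"
      unfolding \<mu>_def by (rule pair_measure_distr) (auto intro: prob_space_imp_sigma_finite mu.prob_space_axioms[unfolded \<mu>_def])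
    moreover have "{(z, z'). L \<le> \<bar>z - z'\<bar>} \<in> sets (borel \<Otimes>\<^sub>M (borel :: real measure))"
    proof -
      have "{p\<in>space (borel \<Otimes>\<^sub>M (borel :: real measure)). L \<le> \<bar>fst p - snd p\<bar>} \<in> sets (borel \<Otimes>\<^sub>M borel)"
        by measurable
      thus ?thesis by (simp add: space_pair_measure case_prod_unfold)
    qed
    ultimately show ?thesis
      by (simp add: measure_distr) (rule arg_cong[where f = "measure _"], auto simp: space_pair_measure)
  qed
  show ?case
  proof (cases "i \<in> J")
    case True
    have card: "card J = Suc (card (J - {i}))"
      using True insert.prems(2) insert(1) by (metis card.remove finite_insert finite_subset)
    have "conc_bound L R ((1 - q / (real R)\<^sup>2) ^ card (J - {i}) * (1 - q / (real R)\<^sup>2)) (\<lambda>a. \<integral>z. ?F (a - z) \<partial>\<mu>)"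
      by (rule conc_bound_convolution[OF mu.prob_space_axioms _ Fm F0 F1 IH L R k0 q])
        (use insert.prems True meas_eq in \<open>auto simp: \<mu>_def\<close>)
    thus ?thesis unfolding conv card by (simp add: mult.commute)
  next
    case False
    have "conc_bound L R ((1 - q / (real R)\<^sup>2) ^ card (J - {i}) * (1 - 0 / (real R)\<^sup>2)) (\<lambda>a. \<integral>z. ?F (a - z) \<partial>\<mu>)"
      by (rule conc_bound_convolution[where q = 0, OF mu.prob_space_axioms _ Fm F0 F1 IH L R k0])
        (auto simp: \<mu>_def)
    thus ?thesis unfolding conv using False by simp
  qed
qed

definition anticonc :: "'a measure \<Rightarrow> ('a \<Rightarrow> complex) \<Rightarrow> real \<Rightarrow> real \<Rightarrow> bool" where
  "anticonc M Y c p \<longleftrightarrow> (\<forall>a. measure M {\<omega>\<in>space M. cmod (Y \<omega> - a) < c} \<le> p)"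

lemma (in prob_space) anticonc_pair:
  assumes ac: "anticonc M Y c p" and [measurable]: "Y \<in> borel_measurable M"
  shows "1 - p \<le> measure (M \<Otimes>\<^sub>M M) {x\<in>space (M \<Otimes>\<^sub>M M). c \<le> cmod (Y (fst x) - Y (snd x))}"
proof -
  interpret MM: pair_prob_space M M ..
  let ?E = "{x\<in>space (M \<Otimes>\<^sub>M M). cmod (Y (fst x) - Y (snd x)) < c}"
  have "measure (M \<Otimes>\<^sub>M M) ?E \<le> p"
  proof (rule MM.measure_pair_le)
    fix x assume "x \<in> space M"
    hence "Pair x -` ?E = {\<omega>\<in>space M. cmod (Y \<omega> - Y x) < c}"
      by (auto simp: space_pair_measure norm_minus_commute)
    thus "measure M (Pair x -` ?E) \<le> p" using ac by (simp add: anticonc_def)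
  qed simp
  moreover have "measure (M \<Otimes>\<^sub>M M) (space (M \<Otimes>\<^sub>M M) - ?E) = 1 - measure (M \<Otimes>\<^sub>M M) ?E"
    by (rule MM.prob_compl) simp
  moreover have "space (M \<Otimes>\<^sub>M M) - ?E = {x\<in>space (M \<Otimes>\<^sub>M M). c \<le> cmod (Y (fst x) - Y (snd x))}"
    by auto
  ultimately show ?thesis by simp
qed

lemma (in prob_space) small_ball_sum_real:
  fixes Z :: "'i \<Rightarrow> 'a \<Rightarrow> real"
  assumes I: "finite I" and ind: "indep_vars (\<lambda>_. borel) Z I"
    and L: "L > 0" and R: "R > 0" and q: "0 \<le> q" "q \<le> 1"
    and J: "J \<subseteq> I" "\<And>i. i \<in> J \<Longrightarrow> q \<le> measure (M \<Otimes>\<^sub>M M) {x\<in>space (M \<Otimes>\<^sub>M M). L \<le> \<bar>Z i (fst x) - Z i (snd x)\<bar>}"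
  shows "prob {\<omega>\<in>space M. a \<le> (\<Sum>i\<in>I. Z i \<omega>) \<and> (\<Sum>i\<in>I. Z i \<omega>) < a + L}
           \<le> 1 / real R + 2 * real R * (1 - q / (real R)\<^sup>2) ^ card J"
proof -
  have rv[measurable]: "\<And>j. j \<in> I \<Longrightarrow> Z j \<in> borel_measurable M"
    using ind by (auto simp: indep_vars_def)
  have rvS[measurable]: "(\<lambda>\<omega>. \<Sum>i\<in>I. Z i \<omega>) \<in> borel_measurable M" by (rule borel_measurable_sum) auto
  let ?E = "{\<omega>\<in>space M. a \<le> (\<Sum>i\<in>I. Z i \<omega>) \<and> (\<Sum>i\<in>I. Z i \<omega>) < a + L}"
  have k0: "0 \<le> (1 - q / (real R)\<^sup>2) ^ k" for k
  proof -
    have "q \<le> (real R)\<^sup>2" using q R one_le_power[of "real R" 2] by linarith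
    thus ?thesis using R by (simp add: divide_le_eq)
  qed
  have "prob ?E = (\<integral>\<omega>. indicator ?E \<omega> \<partial>M)"
    by (subst Bochner_Integration.integral_indicator) (auto simp: Int_absorb2)
  also have "\<dots> = window_prob M (\<lambda>\<omega>. \<Sum>i\<in>I. Z i \<omega>) L a"
    unfolding window_prob_def by (intro Bochner_Integration.integral_cong) auto
  also have "\<dots> \<le> 1 / real R + (1 - q / (real R)\<^sup>2) ^ card J * (2 * real R - 1)"
    using conc_bound_sum[OF I ind L R q(1) J q(2)] R
    unfolding conc_bound_def by (auto dest!: spec[of _ "{a}"] simp: separated_def)
  also have "\<dots> \<le> 1 / real R + (1 - q / (real R)\<^sup>2) ^ card J * (2 * real R)"
    using k0 by (intro add_left_mono mult_left_mono) auto
  finally show ?thesis by (simp add: mult.commute)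
qed

lemma (in prob_space) small_ball_sum:
  fixes Y :: "'i \<Rightarrow> 'a \<Rightarrow> complex"
  assumes I: "finite I" and ind: "indep_vars (\<lambda>_. borel) Y I"
    and ac: "\<And>i. i \<in> I \<Longrightarrow> anticonc M (Y i) c p" and c: "c > 0" and p: "0 \<le> p" "p \<le> 1"
    and J: "J \<subseteq> I" "\<And>i. i \<in> J \<Longrightarrow> \<tau> \<le> cmod (u i)"
    and \<tau>: "\<tau> > 0" and \<delta>: "\<delta> > 0" "4 * \<delta> \<le> \<tau> * c" and R: "R > 0"
  shows "prob {\<omega>\<in>space M. cmod ((\<Sum>i\<in>I. u i * Y i \<omega>) - a) < \<delta>}
           \<le> 1 / real R + 2 * real R * (1 - (1 - p) / 2 / (real R)\<^sup>2) ^ (card J div 2)"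
proof -
  interpret MM: pair_prob_space M M ..
  define q where "q = (1 - p) / 2"
  have q: "0 \<le> q" "q \<le> 1" using p by (auto simp: q_def)
  have rv[measurable]: "\<And>j. j \<in> I \<Longrightarrow> Y j \<in> borel_measurable M"
    using ind by (auto simp: indep_vars_def)
  let ?P = "\<lambda>f i. q \<le> measure (M \<Otimes>\<^sub>M M) {x\<in>space (M \<Otimes>\<^sub>M M). 2 * \<delta> \<le> \<bar>f (u i * Y i (fst x)) - f (u i * Y i (snd x))\<bar>}"
  have cases: "?P Re i \<or> ?P Im i" if "i \<in> J" for i
  proof -
    have i: "i \<in> I" using that J by auto
    note [measurable] = rv[OF i]
    let ?E = "\<lambda>f. {x\<in>space (M \<Otimes>\<^sub>M M). 2 * \<delta> \<le> \<bar>f (u i * Y i (fst x)) - f (u i * Y i (snd x))\<bar>}"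
    have "2 * q \<le> measure (M \<Otimes>\<^sub>M M) {x\<in>space (M \<Otimes>\<^sub>M M). c \<le> cmod (Y i (fst x) - Y i (snd x))}"
      using anticonc_pair[OF ac[OF i]] by (simp add: q_def)
    also have "\<dots> \<le> measure (M \<Otimes>\<^sub>M M) (?E Re \<union> ?E Im)"
    proof (rule MM.finite_measure_mono)
      show "{x\<in>space (M \<Otimes>\<^sub>M M). c \<le> cmod (Y i (fst x) - Y i (snd x))} \<subseteq> ?E Re \<union> ?E Im"
      proof
        fix x assume x: "x \<in> {x\<in>space (M \<Otimes>\<^sub>M M). c \<le> cmod (Y i (fst x) - Y i (snd x))}"
        let ?w = "u i * Y i (fst x) - u i * Y i (snd x)"
        have "4 * \<delta> \<le> \<tau> * c" by fact
        also have "\<dots> \<le> cmod (u i) * cmod (Y i (fst x) - Y i (snd x))"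
          using J(2)[OF that] x \<tau> c by (intro mult_mono) auto
        also have "\<dots> = cmod ?w" by (simp add: norm_mult[symmetric] right_diff_distrib)
        also have "\<dots> \<le> \<bar>Re ?w\<bar> + \<bar>Im ?w\<bar>" by (rule cmod_le)
        finally show "x \<in> ?E Re \<union> ?E Im" using x by auto
      qed
    qed measurable
    also have "\<dots> \<le> measure (M \<Otimes>\<^sub>M M) (?E Re) + measure (M \<Otimes>\<^sub>M M) (?E Im)"
      by (rule measure_Un_le) measurable
    finally show ?thesis by linarith
  qed
  define JR where "JR = {i\<in>J. ?P Re i}"
  define JI where "JI = {i\<in>J. ?P Im i}"
  have finJ: "finite J" using J I finite_subset by blast
  have "J = JR \<union> JI" using cases by (auto simp: JR_def JI_def)
  hence "card J \<le> card JR + card JI" using card_Un_le by metis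
  hence two: "card J div 2 \<le> card JR \<or> card J div 2 \<le> card JI" by linarith
  have k01: "0 \<le> 1 - q / (real R)\<^sup>2" "1 - q / (real R)\<^sup>2 \<le> 1"
  proof -
    have "q \<le> (real R)\<^sup>2" using q R one_le_power[of "real R" 2] by linarith
    thus "0 \<le> 1 - q / (real R)\<^sup>2" using R by (simp add: divide_le_eq)
  qed (use q in simp)
  have main: ?thesis if f: "f = Re \<or> f = Im" and J': "J' \<subseteq> J" "\<And>i. i \<in> J' \<Longrightarrow> ?P f i" "card J div 2 \<le> card J'" for f J'
  proof -
    have fm[measurable]: "f \<in> borel_measurable borel" using f by auto
    have fl: "f (\<Sum>i\<in>I. g i) = (\<Sum>i\<in>I. f (g i))" "f (v - w) = f v - f w" "\<bar>f w\<bar> \<le> cmod w" for g v w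
      using f by (auto simp: abs_Re_le_cmod abs_Im_le_cmod)
    have ind': "indep_vars (\<lambda>_. borel) (\<lambda>i \<omega>. f (u i * Y i \<omega>)) I"
      by (rule indep_vars_compose2[OF ind]) simp
    have [measurable]: "(\<lambda>\<omega>. \<Sum>i\<in>I. f (u i * Y i \<omega>)) \<in> borel_measurable M"
      by (rule borel_measurable_sum) measurable
    let ?a = "f a - \<delta>"
    have "prob {\<omega>\<in>space M. cmod ((\<Sum>i\<in>I. u i * Y i \<omega>) - a) < \<delta>}
      \<le> prob {\<omega>\<in>space M. ?a \<le> (\<Sum>i\<in>I. f (u i * Y i \<omega>)) \<and> (\<Sum>i\<in>I. f (u i * Y i \<omega>)) < ?a + 2 * \<delta>}"
    proof (rule finite_measure_mono)
      show "{\<omega>\<in>space M. cmod ((\<Sum>i\<in>I. u i * Y i \<omega>) - a) < \<delta>} \<subseteq>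
        {\<omega>\<in>space M. ?a \<le> (\<Sum>i\<in>I. f (u i * Y i \<omega>)) \<and> (\<Sum>i\<in>I. f (u i * Y i \<omega>)) < ?a + 2 * \<delta>}"
      proof safe
        fix \<omega> assume "cmod ((\<Sum>i\<in>I. u i * Y i \<omega>) - a) < \<delta>"
        hence "\<bar>f ((\<Sum>i\<in>I. u i * Y i \<omega>) - a)\<bar> < \<delta>" using fl(3) order_le_less_trans by blast
        hence "\<bar>(\<Sum>i\<in>I. f (u i * Y i \<omega>)) - f a\<bar> < \<delta>" by (simp add: fl(1,2))
        thus "?a \<le> (\<Sum>i\<in>I. f (u i * Y i \<omega>))" "(\<Sum>i\<in>I. f (u i * Y i \<omega>)) < ?a + 2 * \<delta>" by auto
      qed
    qed simp
    also have "\<dots> \<le> 1 / real R + 2 * real R * (1 - q / (real R)\<^sup>2) ^ card J'"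
      by (rule small_ball_sum_real[OF I ind']) (use \<delta> R q J J' in auto)
    also have "\<dots> \<le> 1 / real R + 2 * real R * (1 - q / (real R)\<^sup>2) ^ (card J div 2)"
      using k01 J'(3) by (intro add_left_mono mult_left_mono power_decreasing) auto
    finally show ?thesis by (simp add: q_def)
  qed
  show ?thesis
    using two main[of Re JR] main[of Im JI] by (auto simp: JR_def JI_def)
qed

section \<open>The smallest singular value\<close>

lemma (in prob_space) single_coefficient_small_ball:
  fixes Y :: "'i \<Rightarrow> 'a \<Rightarrow> complex"
  assumes I: "finite I" and ind: "indep_vars (\<lambda>_. borel) Y I"
    and i: "i \<in> I" and ac: "anticonc M (Y i) c p"
    and u: "b \<le> cmod (u i)" "0 < b"
  shows "prob {\<omega>\<in>space M. cmod ((\<Sum>i\<in>I. u i * Y i \<omega>) - a) < b * c} \<le> p"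
proof -
  let ?I = "I - {i}"
  let ?S = "\<lambda>\<omega>. \<Sum>i\<in>?I. u i * Y i \<omega>"
  have rv[measurable]: "\<And>j. j \<in> I \<Longrightarrow> Y j \<in> borel_measurable M"
    using ind by (auto simp: indep_vars_def)
  have rvi[measurable]: "Y i \<in> borel_measurable M" using i by simp
  have "indep_var borel ((\<lambda>f. f i) \<circ> (\<lambda>\<omega>. restrict (\<lambda>i. Y i \<omega>) {i}))
    borel ((\<lambda>f. \<Sum>i\<in>?I. u i * f i) \<circ> (\<lambda>\<omega>. restrict (\<lambda>i. Y i \<omega>) ?I))"
    using I i by (intro indep_var_compose[OF indep_var_restrict[OF ind]]) auto
  also have "(\<lambda>f. f i) \<circ> (\<lambda>\<omega>. restrict (\<lambda>i. Y i \<omega>) {i}) = Y i" by auto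
  also have "(\<lambda>f. \<Sum>i\<in>?I. u i * f i) \<circ> (\<lambda>\<omega>. restrict (\<lambda>i. Y i \<omega>) ?I) = ?S"
    by (auto simp: fun_eq_iff intro!: sum.cong)
  finally have ivar: "indep_var borel (Y i) borel ?S" .
  let ?E = "{x. cmod (u i * fst x + snd x - a) < b * c}"
  have "{x\<in>space (borel \<Otimes>\<^sub>M borel). cmod (u i * fst x + snd x - a) < b * c} \<in> sets (borel \<Otimes>\<^sub>M borel)"
    by measurable
  hence E: "?E \<in> sets (borel \<Otimes>\<^sub>M borel)" by (simp add: space_pair_measure)
  have "prob {\<omega>\<in>space M. (Y i \<omega>, ?S \<omega>) \<in> ?E} \<le> p"
  proof (rule indep_var_section_le[OF ivar E])
    fix y
    have "prob {\<omega> \<in> space M. (Y i \<omega>, y) \<in> ?E} \<le> prob {\<omega>\<in>space M. cmod (Y i \<omega> - (a - y) / u i) < c}"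
    proof (rule finite_measure_mono)
      show "{\<omega> \<in> space M. (Y i \<omega>, y) \<in> ?E} \<subseteq> {\<omega>\<in>space M. cmod (Y i \<omega> - (a - y) / u i) < c}"
      proof
        fix \<omega> assume \<omega>: "\<omega> \<in> {\<omega> \<in> space M. (Y i \<omega>, y) \<in> ?E}"
        moreover have "u i * Y i \<omega> + y - a = u i * (Y i \<omega> - (a - y) / u i)"
        proof -
          have "u i \<noteq> 0" using u by auto
          hence "u i * ((a - y) / u i) = a - y" by simp
          thus ?thesis by (simp only: right_diff_distrib[of "u i" "Y i \<omega>"]) simp
        qed
        ultimately have *: "cmod (u i) * cmod (Y i \<omega> - (a - y) / u i) < b * c"
          by (simp add: norm_mult)
        have "b * cmod (Y i \<omega> - (a - y) / u i) \<le> cmod (u i) * cmod (Y i \<omega> - (a - y) / u i)"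
          using u by (intro mult_right_mono) auto
        with * have "b * cmod (Y i \<omega> - (a - y) / u i) < b * c" by linarith
        thus "\<omega> \<in> {\<omega>\<in>space M. cmod (Y i \<omega> - (a - y) / u i) < c}" using u \<omega> by simp
      qed
    qed measurable
    also have "\<dots> \<le> p" using ac by (simp add: anticonc_def)
    finally show "prob {\<omega> \<in> space M. (Y i \<omega>, y) \<in> ?E} \<le> p" .
  qed
  thus ?thesis using I i by (simp add: sum.remove[OF I i])
qed

lemma (in prob_space) all_rows_small_ball:
  fixes X :: "'i \<Rightarrow> 'a \<Rightarrow> complex"
  assumes fin: "finite Eq" "finite Uk"
    and ind: "indep_vars (\<lambda>_. borel) X I"
    and idx: "\<And>e k. e \<in> Eq \<Longrightarrow> k \<in> Uk \<Longrightarrow> idx e k \<in> I" "inj_on (\<lambda>(e, k). idx e k) (Eq \<times> Uk)"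
    and ac: "\<And>i. i \<in> I \<Longrightarrow> anticonc M (X i) c p"
    and k: "k \<in> Uk" "b \<le> cmod (u k)" "0 < b"
  shows "prob {\<omega>\<in>space M. \<forall>e\<in>Eq. cmod (\<Sum>k\<in>Uk. u k * X (idx e k) \<omega>) < b * c} \<le> p ^ card Eq"
proof (cases "Eq = {}")
  case True
  thus ?thesis by (simp add: prob_space)
next
  case False
  define K where "K e = idx e ` Uk" for e
  have KI: "K e \<subseteq> I" if "e \<in> Eq" for e using idx(1) that by (auto simp: K_def)
  have disj: "disjoint_family_on K Eq"
    unfolding disjoint_family_on_def K_def using idx(2) by (auto simp: inj_on_def)
  have inje: "inj_on (idx e) Uk" if "e \<in> Eq" for e
    using idx(2) that by (auto simp: inj_on_def)
  have rv[measurable]: "\<And>j. j \<in> I \<Longrightarrow> X j \<in> borel_measurable M"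
    using ind by (auto simp: indep_vars_def)
  have "indep_vars (\<lambda>_. borel) (\<lambda>e \<omega>. \<Sum>k\<in>Uk. u k * restrict (\<lambda>i. X i \<omega>) (K e) (idx e k)) Eq"
  proof (rule indep_vars_compose2[OF indep_vars_restrict[OF ind KI disj]])
    fix e assume e: "e \<in> Eq"
    have "(\<lambda>f. f (idx e k)) \<in> borel_measurable (Pi\<^sub>M (K e) (\<lambda>_. borel))" if "k \<in> Uk" for k
      by (rule measurable_component_singleton) (use that in \<open>auto simp: K_def\<close>)
    thus "(\<lambda>f. \<Sum>k\<in>Uk. u k * f (idx e k)) \<in> borel_measurable (Pi\<^sub>M (K e) (\<lambda>_. borel))"
      by (intro borel_measurable_sum borel_measurable_times) auto
  qed
  also have "?this \<longleftrightarrow> indep_vars (\<lambda>_. borel) (\<lambda>e \<omega>. \<Sum>k\<in>Uk. u k * X (idx e k) \<omega>) Eq"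
    by (intro indep_vars_cong refl) (auto simp: K_def)
  finally have ind': "indep_vars (\<lambda>_. borel) (\<lambda>e \<omega>. \<Sum>k\<in>Uk. u k * X (idx e k) \<omega>) Eq" .
  let ?A = "ball (0::complex) (b * c)"
  have set_eq: "(\<lambda>\<omega>. \<Sum>k\<in>Uk. u k * X (idx e k) \<omega>) -` ?A \<inter> space M
      = {\<omega>\<in>space M. cmod ((\<Sum>k\<in>Uk. u k * X (idx e k) \<omega>) - 0) < b * c}" for e
    by auto
  have "{\<omega>\<in>space M. \<forall>e\<in>Eq. cmod (\<Sum>k\<in>Uk. u k * X (idx e k) \<omega>) < b * c}
    = (\<Inter>e\<in>Eq. (\<lambda>\<omega>. \<Sum>k\<in>Uk. u k * X (idx e k) \<omega>) -` ?A \<inter> space M)"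
    using False by auto
  hence "prob {\<omega>\<in>space M. \<forall>e\<in>Eq. cmod (\<Sum>k\<in>Uk. u k * X (idx e k) \<omega>) < b * c}
    = (\<Prod>e\<in>Eq. prob ((\<lambda>\<omega>. \<Sum>k\<in>Uk. u k * X (idx e k) \<omega>) -` ?A \<inter> space M))"
    using indep_varsD_finite[OF ind' False fin(1), of "\<lambda>_. ?A"] by simp
  also have "\<dots> \<le> (\<Prod>e\<in>Eq. p)"
  proof (intro prod_mono conjI)
    fix e assume e: "e \<in> Eq"
    have indr: "indep_vars (\<lambda>_. borel) X (K e)"
      by (rule indep_vars_subset[OF ind KI[OF e]])
    have sum_eq: "(\<Sum>i\<in>K e. u (the_inv_into Uk (idx e) i) * X i \<omega>) = (\<Sum>k\<in>Uk. u k * X (idx e k) \<omega>)" for \<omega>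
      unfolding K_def using inje[OF e] by (simp add: sum.reindex the_inv_into_f_f cong: sum.cong)
    have "prob {\<omega>\<in>space M. cmod ((\<Sum>i\<in>K e. u (the_inv_into Uk (idx e) i) * X i \<omega>) - 0) < b * c} \<le> p"
      by (rule single_coefficient_small_ball[OF _ indr, of "idx e k"])
        (use fin k inje[OF e] ac idx(1)[OF e] in \<open>auto simp: K_def the_inv_into_f_f\<close>)
    thus "prob ((\<lambda>\<omega>. \<Sum>k\<in>Uk. u k * X (idx e k) \<omega>) -` ?A \<inter> space M) \<le> p"
      unfolding set_eq sum_eq .
  qed auto
  finally show ?thesis by simp
qed

definition grid :: "real \<Rightarrow> complex set" where
  "grid \<tau> = (\<lambda>(a, b). Complex (\<tau> * real_of_int a) (\<tau> * real_of_int b)) `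
     ({-\<lceil>1/\<tau>\<rceil>..\<lceil>1/\<tau>\<rceil>} \<times> {-\<lceil>1/\<tau>\<rceil>..\<lceil>1/\<tau>\<rceil>})"

lemma finite_grid: "finite (grid \<tau>)"
  by (simp add: grid_def)

lemma card_grid:
  assumes "\<tau> > 0"
  shows "real (card (grid \<tau>)) \<le> (2 / \<tau> + 3)\<^sup>2"
proof -
  have "card (grid \<tau>) \<le> card ({-\<lceil>1/\<tau>\<rceil>..\<lceil>1/\<tau>\<rceil>} \<times> {-\<lceil>1/\<tau>\<rceil>..\<lceil>1/\<tau>\<rceil>})"
    unfolding grid_def by (rule card_image_le) simp
  also have "\<dots> = (nat (2 * \<lceil>1/\<tau>\<rceil> + 1))\<^sup>2"
    by (simp add: card_cartesian_product power2_eq_square)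
  finally have "real (card (grid \<tau>)) \<le> (real (nat (2 * \<lceil>1/\<tau>\<rceil> + 1)))\<^sup>2"
    by (metis of_nat_le_iff of_nat_power)
  also have "\<dots> \<le> (2 / \<tau> + 3)\<^sup>2"
  proof (rule power_mono)
    have "0 \<le> \<lceil>1/\<tau>\<rceil>" using assms by (metis ceiling_mono ceiling_zero divide_nonneg_pos zero_le_one)
    hence "real (nat (2 * \<lceil>1/\<tau>\<rceil> + 1)) = 2 * real_of_int \<lceil>1/\<tau>\<rceil> + 1" by simp
    also have "\<dots> \<le> 2 / \<tau> + 3" by linarith
    finally show "real (nat (2 * \<lceil>1/\<tau>\<rceil> + 1)) \<le> 2 / \<tau> + 3" .
  qed simp
  finally show ?thesis .
qed

lemma grid_approx:
  assumes \<tau>: "\<tau> > 0" and v: "cmod v \<le> 1"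
  shows "\<exists>w\<in>grid \<tau>. cmod (w - v) \<le> 2 * \<tau>"
proof -
  have fl: "\<lfloor>x / \<tau>\<rfloor> \<in> {-\<lceil>1/\<tau>\<rceil>..\<lceil>1/\<tau>\<rceil>}" "\<bar>\<tau> * real_of_int \<lfloor>x / \<tau>\<rfloor> - x\<bar> \<le> \<tau>" if x: "\<bar>x\<bar> \<le> 1" for x
  proof -
    have "x / \<tau> \<le> 1 / \<tau>" "- (1 / \<tau>) \<le> x / \<tau>" using x \<tau> by (auto simp: field_simps)
    hence "\<lfloor>x / \<tau>\<rfloor> \<le> \<lceil>1/\<tau>\<rceil>" "-\<lceil>1/\<tau>\<rceil> \<le> \<lfloor>x / \<tau>\<rfloor>" by linarith+
    thus "\<lfloor>x / \<tau>\<rfloor> \<in> {-\<lceil>1/\<tau>\<rceil>..\<lceil>1/\<tau>\<rceil>}" by simp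
    have "\<tau> * real_of_int \<lfloor>x / \<tau>\<rfloor> - x = \<tau> * (real_of_int \<lfloor>x / \<tau>\<rfloor> - x / \<tau>)" using \<tau> by (simp add: field_simps)
    moreover have "\<bar>real_of_int \<lfloor>x / \<tau>\<rfloor> - x / \<tau>\<bar> \<le> 1" by linarith
    ultimately show "\<bar>\<tau> * real_of_int \<lfloor>x / \<tau>\<rfloor> - x\<bar> \<le> \<tau>" using \<tau> by (simp add: abs_mult)
  qed
  have b: "\<bar>Re v\<bar> \<le> 1" "\<bar>Im v\<bar> \<le> 1"
    using v abs_Re_le_cmod[of v] abs_Im_le_cmod[of v] by linarith+
  define w where "w = Complex (\<tau> * real_of_int \<lfloor>Re v / \<tau>\<rfloor>) (\<tau> * real_of_int \<lfloor>Im v / \<tau>\<rfloor>)"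
  have "w \<in> grid \<tau>" unfolding grid_def w_def
    by (rule image_eqI[of _ _ "(\<lfloor>Re v / \<tau>\<rfloor>, \<lfloor>Im v / \<tau>\<rfloor>)"]) (use fl(1) b in auto)
  moreover have "cmod (w - v) \<le> 2 * \<tau>"
    using cmod_le[of "w - v"] fl(2)[OF b(1)] fl(2)[OF b(2)] by (simp add: w_def)
  ultimately show ?thesis by blast
qed

definition sparse_net :: "nat \<Rightarrow> nat \<Rightarrow> complex set \<Rightarrow> (nat \<Rightarrow> complex) set" where
  "sparse_net n k G = {u. (\<exists>xs. length xs = k \<and> set xs \<subseteq> {..<n} \<times> G \<and>
     u = (\<lambda>i. case map_of xs i of None \<Rightarrow> 0 | Some v \<Rightarrow> v)) \<and> (\<exists>i<n. 1 / 2 \<le> cmod (u i))}"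

lemma sparse_net_card:
  assumes "finite G"
  shows "finite (sparse_net n k G)" "card (sparse_net n k G) \<le> (n * card G) ^ k"
proof -
  let ?L = "{xs. set xs \<subseteq> {..<n} \<times> G \<and> length xs = k}"
  let ?f = "\<lambda>xs i. case map_of xs i of None \<Rightarrow> 0 | Some v \<Rightarrow> v"
  have sub: "sparse_net n k G \<subseteq> ?f ` ?L" by (auto simp: sparse_net_def)
  have fin: "finite ?L" using assms by (intro finite_lists_length_eq) auto
  show "finite (sparse_net n k G)" by (rule finite_subset[OF sub]) (use fin in simp)
  have "card (sparse_net n k G) \<le> card (?f ` ?L)" by (rule card_mono[OF _ sub]) (use fin in simp)
  also have "\<dots> \<le> card ?L" by (rule card_image_le[OF fin])
  also have "\<dots> = (n * card G) ^ k"
    using assms by (subst card_lists_length_eq) (auto simp: card_cartesian_product)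
  finally show "card (sparse_net n k G) \<le> (n * card G) ^ k" .
qed

lemma sparse_net_approx:
  assumes \<tau>: "\<tau> > 0" "\<tau> \<le> 1 / 4" and v: "\<And>i. i < n \<Longrightarrow> cmod (v i) \<le> 1" "\<exists>i<n. cmod (v i) = 1"
    and k: "card {i. i < n \<and> \<tau> < cmod (v i)} \<le> k"
  shows "\<exists>u\<in>sparse_net n k (grid \<tau>). \<forall>i<n. cmod (u i - v i) \<le> 2 * \<tau>"
proof -
  define S where "S = {i. i < n \<and> \<tau> < cmod (v i)}"
  have finS: "finite S" by (simp add: S_def)
  obtain i0 where i0: "i0 < n" "cmod (v i0) = 1" using v(2) by blast
  have i0S: "i0 \<in> S" using i0 \<tau> by (simp add: S_def)
  have "\<forall>i. \<exists>w. i < n \<longrightarrow> w \<in> grid \<tau> \<and> cmod (w - v i) \<le> 2 * \<tau>"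
    using grid_approx[OF \<tau>(1)] v(1) by blast
  then obtain w where w: "\<And>i. i < n \<Longrightarrow> w i \<in> grid \<tau>" "\<And>i. i < n \<Longrightarrow> cmod (w i - v i) \<le> 2 * \<tau>"
    by metis
  obtain l where l: "set l = S" "distinct l" using finite_distinct_list[OF finS] by blast
  have len: "length l \<le> k" using l k distinct_card[of l] by (simp add: S_def)
  define xs where "xs = map (\<lambda>i. (i, w i)) (l @ replicate (k - length l) i0)"
  have lx: "length xs = k" using len by (simp add: xs_def)
  have sx: "set xs \<subseteq> {..<n} \<times> grid \<tau>"
    using l w(1) i0 by (auto simp: xs_def S_def)
  define u where "u = (\<lambda>i. case map_of xs i of None \<Rightarrow> 0 | Some v \<Rightarrow> v)"
  have "set (l @ replicate (k - length l) i0) = S" using l i0S by auto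
  hence m: "map_of xs i = (if i \<in> S then Some (w i) else None)" for i
    unfolding xs_def by (simp add: map_of_map_restrict restrict_map_def del: map_append set_append)
  have u: "u i = (if i \<in> S then w i else 0)" for i by (simp add: u_def m)
  have close: "cmod (u i - v i) \<le> 2 * \<tau>" if "i < n" for i
    using w(2)[OF that] that \<tau> by (auto simp: u S_def)
  have "1 / 2 \<le> cmod (u i0)"
    using close[OF i0(1)] i0(2) \<tau> norm_triangle_ineq2[of "v i0" "u i0"] by (simp add: norm_minus_commute)
  hence "u \<in> sparse_net n k (grid \<tau>)"
    unfolding sparse_net_def using lx sx i0(1) u_def by blast
  thus ?thesis using close by blast
qed

lemma exists_kernel_vector:
  fixes f :: "nat \<Rightarrow> nat \<Rightarrow> complex"
  assumes j: "j < n"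
  shows "\<exists>u. (\<forall>i<n. cmod (u i) \<le> 1) \<and> (\<exists>i<n. cmod (u i) = 1) \<and>
    (\<forall>l<n. l \<noteq> j \<longrightarrow> (\<Sum>i<n. f l i * u i) = 0)"
proof -
  define A where "A = mat n n (\<lambda>(l, i). if l = j then 0 else f l i)"
  have A: "A \<in> carrier_mat n n" by (simp add: A_def)
  have "A = mat\<^sub>r n n (\<lambda>l. if l = j then 0\<^sub>v n else Matrix.row A l)"
    by (rule eq_matI) (auto simp: A_def)
  also have "Determinant.det \<dots> = 0"
    by (rule det_row_0[OF j]) (use A in auto)
  finally have "Determinant.det A = 0" .
  then obtain v where v: "v \<in> carrier_vec n" "v \<noteq> 0\<^sub>v n" "A *\<^sub>v v = 0\<^sub>v n"
    using det_0_iff_vec_prod_zero[OF A] by blast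
  define m where "m = Max ((\<lambda>i. cmod (vec_index v i)) ` {..<n})"
  obtain i1 where i1: "i1 < n" "vec_index v i1 \<noteq> 0"
    using v(1,2) by (metis carrier_vecD eq_vecI index_zero_vec(1) index_zero_vec(2))
  have ne: "(\<lambda>i. cmod (vec_index v i)) ` {..<n} \<noteq> {}" using j by auto
  have m_ge: "cmod (vec_index v i) \<le> m" if "i < n" for i using that by (auto simp: m_def)
  have m0: "m > 0" using m_ge[OF i1(1)] i1(2) by (smt (verit) zero_less_norm_iff)
  have "m \<in> (\<lambda>i. cmod (vec_index v i)) ` {..<n}" unfolding m_def using ne by (intro Max_in) auto
  then obtain i0 where i0: "i0 < n" "cmod (vec_index v i0) = m" by auto
  define u where "u i = vec_index v i / of_real m" for i
  have "(\<Sum>i<n. f l i * u i) = 0" if l: "l < n" "l \<noteq> j" for l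
  proof -
    have "0 = vec_index (A *\<^sub>v v) l" using v(3) l by simp
    also have "\<dots> = (\<Sum>i\<in>{0..<n}. f l i * vec_index v i)"
      using l v(1) unfolding A_def by (auto simp: scalar_prod_def intro!: sum.cong)
    finally have "(\<Sum>i<n. f l i * vec_index v i) = 0" by (simp add: lessThan_atLeast0)
    thus ?thesis unfolding u_def by (simp add: sum_divide_distrib[symmetric])
  qed
  moreover have "cmod (u i) \<le> 1" if "i < n" for i
    using m_ge[OF that] m0 by (simp add: u_def norm_divide)
  moreover have "cmod (u i0) = 1" using i0 m0 by (simp add: u_def norm_divide)
  ultimately show ?thesis using i0(1) by blast
qed

definition net_event :: "'a measure \<Rightarrow> nat \<Rightarrow> nat \<Rightarrow> real \<Rightarrow> real \<Rightarrow> nat set \<Rightarrow> (nat \<Rightarrow> nat \<Rightarrow> 'a \<Rightarrow> complex) \<Rightarrow> 'a set" where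
  "net_event M n k \<tau> c Eq V = {\<omega>\<in>space M. \<exists>u\<in>sparse_net n k (grid \<tau>).
     \<forall>e\<in>Eq. cmod (\<Sum>i<n. u i * V e i \<omega>) < 1 / 2 * c}"

lemma (in prob_space) prob_net_event:
  fixes X :: "'i \<Rightarrow> 'a \<Rightarrow> complex"
  assumes fin: "finite Eq"
    and ind: "indep_vars (\<lambda>_. borel) X I"
    and idx: "\<And>e k. e \<in> Eq \<Longrightarrow> k < n \<Longrightarrow> idx e k \<in> I" "inj_on (\<lambda>(e, k). idx e k) (Eq \<times> {..<n})"
    and ac: "\<And>i. i \<in> I \<Longrightarrow> anticonc M (X i) c p" and p: "0 \<le> p"
  shows "net_event M n k \<tau> c Eq (\<lambda>e k. X (idx e k)) \<in> events"
    and "prob (net_event M n k \<tau> c Eq (\<lambda>e k. X (idx e k))) \<le> real ((n * card (grid \<tau>)) ^ k) * p ^ card Eq"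
proof -
  let ?N = "sparse_net n k (grid \<tau>)"
  let ?A = "\<lambda>u. {\<omega>\<in>space M. \<forall>e\<in>Eq. cmod (\<Sum>i<n. u i * X (idx e i) \<omega>) < 1 / 2 * c}"
  have rv[measurable]: "\<And>j. j \<in> I \<Longrightarrow> X j \<in> borel_measurable M"
    using ind by (auto simp: indep_vars_def)
  have A: "?A u \<in> events" for u
  proof (intro sets.sets_Collect_finite_All fin)
    fix e assume e: "e \<in> Eq"
    have "(\<lambda>\<omega>. \<Sum>i<n. u i * X (idx e i) \<omega>) \<in> borel_measurable M"
      by (intro borel_measurable_sum borel_measurable_times rv idx e) auto
    thus "{\<omega> \<in> space M. cmod (\<Sum>i<n. u i * X (idx e i) \<omega>) < 1 / 2 * c} \<in> events" by measurable
  qed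
  have eq: "net_event M n k \<tau> c Eq (\<lambda>e k. X (idx e k)) = (\<Union>u\<in>?N. ?A u)"
    by (auto simp: net_event_def)
  have finN: "finite ?N" by (rule sparse_net_card(1)[OF finite_grid])
  show "net_event M n k \<tau> c Eq (\<lambda>e k. X (idx e k)) \<in> events"
    unfolding eq using finN A by auto
  have pA: "prob (?A u) \<le> p ^ card Eq" if "u \<in> ?N" for u
  proof -
    obtain i where i: "i < n" "1 / 2 \<le> cmod (u i)" using \<open>u \<in> ?N\<close> by (auto simp: sparse_net_def)
    show ?thesis
      by (rule all_rows_small_ball[OF fin finite_lessThan ind _ idx(2) ac, of i])
        (use i idx(1) in auto)
  qed
  have "prob (\<Union>u\<in>?N. ?A u) \<le> (\<Sum>u\<in>?N. prob (?A u))"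
    by (rule finite_measure_subadditive_finite) (use finN A in auto)
  also have "\<dots> \<le> (\<Sum>u\<in>?N. p ^ card Eq)" by (intro sum_mono pA)
  also have "\<dots> = real (card ?N) * p ^ card Eq" by simp
  also have "\<dots> \<le> real ((n * card (grid \<tau>)) ^ k) * p ^ card Eq"
    using sparse_net_card(2)[OF finite_grid, of n k \<tau>] p
    by (intro mult_right_mono zero_le_power) (simp_all only: of_nat_le_iff)
  finally show "prob (net_event M n k \<tau> c Eq (\<lambda>e k. X (idx e k))) \<le> real ((n * card (grid \<tau>)) ^ k) * p ^ card Eq"
    unfolding eq .
qed

lemma net_eventI:
  assumes \<omega>: "\<omega> \<in> space M" and \<tau>: "\<tau> > 0" "\<tau> \<le> 1 / 4"
    and v: "\<And>i. i < n \<Longrightarrow> cmod (v i) \<le> 1" "\<exists>i<n. cmod (v i) = 1"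
    and k: "card {i. i < n \<and> \<tau> < cmod (v i)} \<le> k"
    and small: "\<And>e. e \<in> Eq \<Longrightarrow> cmod (\<Sum>i<n. v i * V e i \<omega>) \<le> t0"
    and H: "\<And>e. e \<in> Eq \<Longrightarrow> (\<Sum>i<n. cmod (V e i \<omega>)) \<le> H"
    and c: "t0 + 2 * \<tau> * H < 1 / 2 * c"
  shows "\<omega> \<in> net_event M n k \<tau> c Eq V"
proof -
  obtain u where u: "u \<in> sparse_net n k (grid \<tau>)" "\<And>i. i < n \<Longrightarrow> cmod (u i - v i) \<le> 2 * \<tau>"
    using sparse_net_approx[OF \<tau> v k] by blast
  have "cmod (\<Sum>i<n. u i * V e i \<omega>) < 1 / 2 * c" if e: "e \<in> Eq" for e
  proof -
    have "(\<Sum>i<n. u i * V e i \<omega>) = (\<Sum>i<n. v i * V e i \<omega>) + (\<Sum>i<n. (u i - v i) * V e i \<omega>)"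
      by (simp add: sum.distrib[symmetric] algebra_simps)
    hence "cmod (\<Sum>i<n. u i * V e i \<omega>) \<le> cmod (\<Sum>i<n. v i * V e i \<omega>) + cmod (\<Sum>i<n. (u i - v i) * V e i \<omega>)"
      by (simp only: norm_triangle_ineq)
    also have "cmod (\<Sum>i<n. v i * V e i \<omega>) \<le> t0" by (rule small[OF e])
    also have "cmod (\<Sum>i<n. (u i - v i) * V e i \<omega>) \<le> (\<Sum>i<n. 2 * \<tau> * cmod (V e i \<omega>))"
      by (rule sum_norm_le) (use u(2) in \<open>auto simp: norm_mult intro!: mult_right_mono\<close>)
    also have "\<dots> = 2 * \<tau> * (\<Sum>i<n. cmod (V e i \<omega>))" by (simp add: sum_distrib_left)
    also have "\<dots> \<le> 2 * \<tau> * H" using H[OF e] \<tau> by (intro mult_left_mono) auto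
    finally show ?thesis using c by linarith
  qed
  thus ?thesis using u(1) \<omega> by (auto simp: net_event_def)
qed

text \<open>Averaging over the columns, as in Rudelson and Vershynin's treatment of incompressible vectors.\<close>

lemma (in prob_space) smallest_singular_value:
  fixes W :: "nat \<Rightarrow> nat \<Rightarrow> 'a \<Rightarrow> complex" and c p H \<tau> m t0 t :: real
  assumes ind: "indep_vars (\<lambda>_. borel) (\<lambda>(i, j). W i j) ({..<n} \<times> {..<n})"
    and ac: "\<And>i j. i < n \<Longrightarrow> j < n \<Longrightarrow> anticonc M (W i j) c p" and c: "c > 0" and p: "0 \<le> p" "p \<le> 1"
    and n: "n > 0" and H: "H \<ge> 0" and \<tau>: "\<tau> > 0" "\<tau> \<le> 1 / 4" and m: "m > 0" "4 * m \<le> \<tau>" and t0: "t0 \<ge> 0"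
    and k: "k > 0" and R: "R > 0"
    and c1: "t0 + 2 * \<tau> * H < 1 / 2 * c" and c2: "t0 + 2 * m * H < t" and c3: "16 * real n * t \<le> \<tau>\<^sup>2 * c"
  defines "\<rho> \<equiv> 1 / real R + 2 * real R * (1 - (1 - p) / 2 / (real R)\<^sup>2) ^ (k div 2)"
  shows "\<exists>Bad\<in>events. prob Bad \<le> prob {\<omega>\<in>space M. H < (\<Sum>i<n. \<Sum>j<n. cmod (W i j \<omega>))}
       + real (n + 1) * (real ((n * card (grid \<tau>)) ^ k) * p ^ (n - 1)) + real n * \<rho> / real k \<and>
     (\<forall>\<omega>\<in>space M - Bad. \<forall>v. (\<forall>i<n. cmod (v i) \<le> 1) \<longrightarrow> (\<exists>i<n. cmod (v i) = 1) \<longrightarrow>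
        (\<exists>i<n. t0 < cmod (\<Sum>j<n. v j * W i j \<omega>)))"
proof -
  have rv[measurable]: "W i j \<in> borel_measurable M" if "i < n" "j < n" for i j
    using ind that by (auto simp: indep_vars_def)
  let ?X = "\<lambda>(i, j). W i j"
  let ?I = "{..<n} \<times> {..<n}"
  have ac': "\<And>i. i \<in> ?I \<Longrightarrow> anticonc M (?X i) c p" using ac by auto
  define q where "q = real ((n * card (grid \<tau>)) ^ k)"
  have q0: "q \<ge> 0" by (simp add: q_def)
  have "0 \<le> 2 * m * H" using m H by simp
  hence t: "t > 0" using c2 t0 by linarith
  have \<rho>0: "0 \<le> \<rho>"
  proof -
    have "(1 - p) / 2 \<le> 1" using p by simp
    also have "1 \<le> (real R)\<^sup>2" using R by simp
    finally show ?thesis unfolding \<rho>_def using R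
      by (intro add_nonneg_nonneg mult_nonneg_nonneg zero_le_power) (auto simp: divide_le_eq)
  qed
  define Hb where "Hb = {\<omega>\<in>space M. H < (\<Sum>i<n. \<Sum>j<n. cmod (W i j \<omega>))}"
  have Hb[measurable]: "Hb \<in> events"
  proof -
    have "(\<lambda>\<omega>. \<Sum>i<n. \<Sum>j<n. cmod (W i j \<omega>)) \<in> borel_measurable M"
      by (intro borel_measurable_sum measurable_compose[OF _ borel_measurable_norm] rv) auto
    thus ?thesis unfolding Hb_def by measurable
  qed
  define E1 where "E1 = net_event M n k \<tau> c {..<n} (\<lambda>e i. W e i)"
  have E1: "E1 \<in> events" "prob E1 \<le> q * p ^ n"
    using prob_net_event[where idx = "\<lambda>e k. (e, k)" and Eq = "{..<n}", OF _ ind _ _ ac' p(1), of n k \<tau>]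
    by (auto simp: E1_def q_def inj_on_def)
  define C where "C j = net_event M n k \<tau> c ({..<n} - {j}) (\<lambda>l i. W i l)" for j
  have C: "C j \<in> events" "prob (C j) \<le> q * p ^ (n - 1)" if "j < n" for j
    using prob_net_event[where idx = "\<lambda>e k. (k, e)" and Eq = "{..<n} - {j}", OF _ ind _ _ ac' p(1), of n k \<tau>] that
    by (auto simp: C_def q_def inj_on_def)
  define V where "V j = {v \<in> PiE {..<n} (\<lambda>_. grid m). \<tau> / 2 \<le> cmod (v j)}" for j :: nat
  have finV: "finite (V j)" for j unfolding V_def by (simp add: finite_PiE finite_grid)
  define D where "D j = {\<omega>\<in>space M. (\<exists>v\<in>V j. \<forall>i<n. cmod (\<Sum>l<n. v l * W i l \<omega>) < t) \<and>
     (\<Sum>i<n. \<Sum>l\<in>{..<n}-{j}. cmod (W i l \<omega>)) \<le> H \<and> \<omega> \<notin> C j}" for j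
  have D: "D j \<in> events" "prob (D j) \<le> \<rho>" if j: "j < n" for j
  proof -
    define K1 where "K1 = {..<n} \<times> {j}"
    define K2 where "K2 = {..<n} \<times> ({..<n} - {j})"
    let ?P1 = "PiM K1 (\<lambda>_. borel :: complex measure)"
    let ?P2 = "PiM K2 (\<lambda>_. borel :: complex measure)"
    let ?x1 = "\<lambda>\<omega>. restrict (\<lambda>i. ?X i \<omega>) K1"
    let ?x2 = "\<lambda>\<omega>. restrict (\<lambda>i. ?X i \<omega>) K2"
    have iv: "indep_var ?P1 ?x1 ?P2 ?x2"
      by (rule indep_var_restrict[OF ind]) (use j in \<open>auto simp: K1_def K2_def\<close>)
    define Bp where "Bp z = (\<exists>v\<in>V j. \<forall>i\<in>{..<n}. cmod (v j * fst z (i, j) + (\<Sum>l\<in>{..<n}-{j}. v l * snd z (i, l))) < t)" for z :: "(nat \<times> nat \<Rightarrow> complex) \<times> (nat \<times> nat \<Rightarrow> complex)"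
    define Hp where "Hp y \<longleftrightarrow> (\<Sum>i<n. \<Sum>l\<in>{..<n}-{j}. cmod (y (i, l))) \<le> H" for y :: "nat \<times> nat \<Rightarrow> complex"
    define Cp where "Cp y \<longleftrightarrow> (\<exists>u\<in>sparse_net n k (grid \<tau>). \<forall>e\<in>{..<n}-{j}. cmod (\<Sum>i<n. u i * y (i, e)) < 1 / 2 * c)" for y :: "nat \<times> nat \<Rightarrow> complex"
    have c1m: "(\<lambda>z. fst z (i, j)) \<in> borel_measurable (?P1 \<Otimes>\<^sub>M ?P2)" if "i < n" for i
      by (rule measurable_compose[OF measurable_fst measurable_component_singleton]) (use that in \<open>auto simp: K1_def\<close>)
    have c2m: "(\<lambda>z. snd z (i, l)) \<in> borel_measurable (?P1 \<Otimes>\<^sub>M ?P2)" if "i < n" "l \<in> {..<n} - {j}" for i l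
      by (rule measurable_compose[OF measurable_snd measurable_component_singleton]) (use that in \<open>auto simp: K2_def\<close>)
    have finN: "finite (sparse_net n k (grid \<tau>))" by (rule sparse_net_card(1)[OF finite_grid])
    define E where "E = {z\<in>space (?P1 \<Otimes>\<^sub>M ?P2). Bp z \<and> Hp (snd z) \<and> \<not> Cp (snd z)}"
    have E: "E \<in> sets (?P1 \<Otimes>\<^sub>M ?P2)"
      unfolding E_def
    proof (intro sets.sets_Collect_conj sets.sets_Collect_neg)
      have "{z \<in> space (?P1 \<Otimes>\<^sub>M ?P2). cmod (v j * fst z (i, j) + (\<Sum>l\<in>{..<n}-{j}. v l * snd z (i, l))) < t} \<in> sets (?P1 \<Otimes>\<^sub>M ?P2)"
        if "i \<in> {..<n}" for i v
      proof -
        have "(\<lambda>z. v j * fst z (i, j) + (\<Sum>l\<in>{..<n}-{j}. v l * snd z (i, l))) \<in> borel_measurable (?P1 \<Otimes>\<^sub>M ?P2)"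
          using that by (intro borel_measurable_add borel_measurable_sum borel_measurable_times c1m c2m) auto
        thus ?thesis by measurable
      qed
      thus "{z \<in> space (?P1 \<Otimes>\<^sub>M ?P2). Bp z} \<in> sets (?P1 \<Otimes>\<^sub>M ?P2)"
        unfolding Bp_def by (intro sets.sets_Collect_finite_Ex sets.sets_Collect_finite_All finV) auto
      have "(\<lambda>z. \<Sum>i<n. \<Sum>l\<in>{..<n}-{j}. cmod (snd z (i, l))) \<in> borel_measurable (?P1 \<Otimes>\<^sub>M ?P2)"
        by (intro borel_measurable_sum measurable_compose[OF _ borel_measurable_norm] c2m) auto
      thus "{z \<in> space (?P1 \<Otimes>\<^sub>M ?P2). Hp (snd z)} \<in> sets (?P1 \<Otimes>\<^sub>M ?P2)"
        unfolding Hp_def by measurable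
      have *: "{z \<in> space (?P1 \<Otimes>\<^sub>M ?P2). cmod (\<Sum>i<n. u i * snd z (i, e)) < 1 / 2 * c} \<in> sets (?P1 \<Otimes>\<^sub>M ?P2)"
        if "e \<in> {..<n} - {j}" for e u
      proof -
        have "(\<lambda>z. \<Sum>i<n. u i * snd z (i, e)) \<in> borel_measurable (?P1 \<Otimes>\<^sub>M ?P2)"
          using that by (intro borel_measurable_sum borel_measurable_times c2m) auto
        thus ?thesis by measurable
      qed
      show "{z \<in> space (?P1 \<Otimes>\<^sub>M ?P2). Cp (snd z)} \<in> sets (?P1 \<Otimes>\<^sub>M ?P2)"
        unfolding Cp_def
      proof (intro sets.sets_Collect_finite_Ex finN)
        fix u
        show "{z \<in> space (?P1 \<Otimes>\<^sub>M ?P2). \<forall>e\<in>{..<n} - {j}. cmod (\<Sum>i<n. u i * snd z (i, e)) < 1 / 2 * c} \<in> sets (?P1 \<Otimes>\<^sub>M ?P2)"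
          by (intro sets.sets_Collect_finite_All *) auto
      qed
    qed
    have x1: "?x1 \<omega> (i, j) = W i j \<omega>" if "i < n" for i \<omega> using that by (simp add: K1_def)
    have x2: "?x2 \<omega> (i, l) = W i l \<omega>" if "i < n" "l < n" "l \<noteq> j" for i l \<omega> using that by (simp add: K2_def)
    have sp: "(?x1 \<omega>, ?x2 \<omega>) \<in> space (?P1 \<Otimes>\<^sub>M ?P2)" for \<omega>
      by (auto simp: space_pair_measure space_PiM)
    have D_eq: "D j = {\<omega>\<in>space M. (?x1 \<omega>, ?x2 \<omega>) \<in> E}"
    proof -
      have "(\<exists>v\<in>V j. \<forall>i<n. cmod (\<Sum>l<n. v l * W i l \<omega>) < t) \<longleftrightarrow> Bp (?x1 \<omega>, ?x2 \<omega>)" for \<omega>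
      proof -
        have "(\<Sum>l<n. v l * W i l \<omega>) = v j * fst (?x1 \<omega>, ?x2 \<omega>) (i, j) + (\<Sum>l\<in>{..<n}-{j}. v l * snd (?x1 \<omega>, ?x2 \<omega>) (i, l))"
          if "i < n" for i v
          using that j x1 x2 by (subst sum.remove[of _ j]) (auto intro!: sum.cong)
        thus ?thesis unfolding Bp_def Ball_def lessThan_iff
          by (intro bex_cong refl all_cong1 imp_cong arg_cong2[where f = "(<)"] arg_cong[where f = cmod])
      qed
      moreover have "(\<Sum>i<n. \<Sum>l\<in>{..<n}-{j}. cmod (W i l \<omega>)) \<le> H \<longleftrightarrow> Hp (?x2 \<omega>)" for \<omega>
        unfolding Hp_def using x2 by (intro arg_cong2[where f = "(\<le>)"] sum.cong) auto
      moreover have "\<omega> \<in> C j \<longleftrightarrow> Cp (?x2 \<omega>)" if "\<omega> \<in> space M" for \<omega>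
      proof -
        have "(\<Sum>i<n. u i * W i e \<omega>) = (\<Sum>i<n. u i * ?x2 \<omega> (i, e))" if "e \<in> {..<n} - {j}" for e u
          using that x2 by (intro sum.cong) auto
        thus ?thesis using that unfolding C_def net_event_def Cp_def mem_Collect_eq
          by (simp only: simp_thms bex_simps cong: ball_cong)
      qed
      ultimately show ?thesis unfolding D_def E_def using sp by auto
    qed
    have "(\<lambda>\<omega>. (?x1 \<omega>, ?x2 \<omega>)) \<in> measurable M (?P1 \<Otimes>\<^sub>M ?P2)"
      using iv by (intro measurable_Pair) (auto simp: indep_var_distribution_eq)
    from measurable_sets[OF this E] show "D j \<in> events" unfolding D_eq
      by (simp add: vimage_def Int_def conj_commute)
    show "prob (D j) \<le> \<rho>" unfolding D_eq
    proof (rule indep_var_section_le[OF iv E])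
      fix y assume y: "y \<in> space ?P2"
      show "prob {\<omega> \<in> space M. (?x1 \<omega>, y) \<in> E} \<le> \<rho>"
      proof (cases "Hp y \<and> \<not> Cp y")
        case False
        hence "{\<omega> \<in> space M. (?x1 \<omega>, y) \<in> E} = {}" by (auto simp: E_def)
        thus ?thesis using \<rho>0 by (simp only: measure_empty)
      next
        case True
        obtain u where u: "\<And>i. i < n \<Longrightarrow> cmod (u i) \<le> 1" "\<exists>i<n. cmod (u i) = 1"
          "\<And>l. l < n \<Longrightarrow> l \<noteq> j \<Longrightarrow> (\<Sum>i<n. y (i, l) * u i) = 0"
          using exists_kernel_vector[OF j, of "\<lambda>l i. y (i, l)"] by blast
        have card: "k < card {i. i < n \<and> \<tau> < cmod (u i)}"
        proof (rule ccontr)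
          assume "\<not> k < card {i. i < n \<and> \<tau> < cmod (u i)}"
          hence kc: "card {i. i < n \<and> \<tau> < cmod (u i)} \<le> k" by simp
          obtain \<omega>0 where \<omega>0: "\<omega>0 \<in> space M" using not_empty by blast
          have "\<omega>0 \<in> net_event M n k \<tau> c ({..<n} - {j}) (\<lambda>e i \<omega>. y (i, e))"
          proof (rule net_eventI[OF \<omega>0 \<tau> u(1,2) kc _ _ c1])
            fix e assume e: "e \<in> {..<n} - {j}"
            show "cmod (\<Sum>i<n. u i * y (i, e)) \<le> t0"
              using u(3)[of e] e t0 by (simp add: mult.commute)
            have "(\<Sum>i<n. cmod (y (i, e))) \<le> (\<Sum>i<n. \<Sum>l\<in>{..<n}-{j}. cmod (y (i, l)))"
              by (intro sum_mono member_le_sum) (use e in auto)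
            thus "(\<Sum>i<n. cmod (y (i, e))) \<le> H" using True by (simp add: Hp_def)
          qed
          thus False using True by (auto simp: net_event_def Cp_def)
        qed
        define J where "J = (\<lambda>i. (i, j)) ` {i. i < n \<and> \<tau> < cmod (u i)}"
        have cJ: "k \<le> card J" using card by (simp add: J_def card_image inj_on_def)
        define \<delta> where "\<delta> = 4 * real n * t / \<tau>"
        have \<delta>: "\<delta> > 0" "4 * \<delta> \<le> \<tau> * c"
          using n t \<tau> c3 by (auto simp: \<delta>_def field_simps power2_eq_square)
        have indK: "indep_vars (\<lambda>_. borel) ?X K1"
          by (rule indep_vars_subset[OF ind]) (use j in \<open>auto simp: K1_def\<close>)
        have "prob {\<omega> \<in> space M. (?x1 \<omega>, y) \<in> E} \<le> prob {\<omega>\<in>space M. cmod ((\<Sum>i\<in>K1. u (fst i) * ?X i \<omega>) - 0) < \<delta>}"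
        proof (rule finite_measure_mono)
          show "{\<omega> \<in> space M. (?x1 \<omega>, y) \<in> E} \<subseteq> {\<omega>\<in>space M. cmod ((\<Sum>i\<in>K1. u (fst i) * ?X i \<omega>) - 0) < \<delta>}"
          proof
            fix \<omega> assume \<omega>: "\<omega> \<in> {\<omega> \<in> space M. (?x1 \<omega>, y) \<in> E}"
            then obtain v where v: "v \<in> V j" "\<And>i. i < n \<Longrightarrow> cmod (v j * W i j \<omega> + (\<Sum>l\<in>{..<n}-{j}. v l * y (i, l))) < t"
              using x1 by (auto simp: E_def Bp_def)
            have vj: "\<tau> / 2 \<le> cmod (v j)" using v(1) by (simp add: V_def)
            have "(\<Sum>i<n. u i * (v j * W i j \<omega> + (\<Sum>l\<in>{..<n}-{j}. v l * y (i, l))))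
              = v j * (\<Sum>i<n. u i * W i j \<omega>) + (\<Sum>i<n. \<Sum>l\<in>{..<n}-{j}. v l * (y (i, l) * u i))"
              by (simp add: algebra_simps sum.distrib sum_distrib_left sum_distrib_right)
            also have "(\<Sum>i<n. \<Sum>l\<in>{..<n}-{j}. v l * (y (i, l) * u i)) = (\<Sum>l\<in>{..<n}-{j}. v l * (\<Sum>i<n. y (i, l) * u i))"
              by (subst sum.swap) (simp add: sum_distrib_left)
            also have "\<dots> = 0" using u(3) by (intro sum.neutral) auto
            finally have "cmod (v j) * cmod (\<Sum>i<n. u i * W i j \<omega>)
              = cmod (\<Sum>i<n. u i * (v j * W i j \<omega> + (\<Sum>l\<in>{..<n}-{j}. v l * y (i, l))))"
              by (simp add: norm_mult)
            also have "\<dots> \<le> (\<Sum>i<n. 1 * t)"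
            proof (rule sum_norm_le)
              fix i assume "i \<in> {..<n}"
              thus "cmod (u i * (v j * W i j \<omega> + (\<Sum>l\<in>{..<n}-{j}. v l * y (i, l)))) \<le> 1 * t"
                unfolding norm_mult using u(1)[of i] v(2)[of i] by (intro mult_mono) auto
            qed
            finally have A: "cmod (v j) * cmod (\<Sum>i<n. u i * W i j \<omega>) \<le> real n * t" by simp
            have "\<tau> / 2 * cmod (\<Sum>i<n. u i * W i j \<omega>) \<le> cmod (v j) * cmod (\<Sum>i<n. u i * W i j \<omega>)"
              using vj by (intro mult_right_mono) auto
            hence "\<tau> / 2 * cmod (\<Sum>i<n. u i * W i j \<omega>) \<le> real n * t" using A by linarith
            also have "real n * t < \<tau> / 2 * \<delta>" using n t \<tau> by (simp add: \<delta>_def)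
            finally have "cmod (\<Sum>i<n. u i * W i j \<omega>) < \<delta>" using \<tau> by simp
            moreover have "(\<Sum>i\<in>K1. u (fst i) * ?X i \<omega>) = (\<Sum>i<n. u i * W i j \<omega>)"
              unfolding K1_def
              by (rule sum.reindex_bij_witness[of _ "\<lambda>i. (i, j)" fst]) auto
            ultimately show "\<omega> \<in> {\<omega>\<in>space M. cmod ((\<Sum>i\<in>K1. u (fst i) * ?X i \<omega>) - 0) < \<delta>}" using \<omega> by simp
          qed
          have "(\<lambda>\<omega>. \<Sum>i\<in>K1. u (fst i) * ?X i \<omega>) \<in> borel_measurable M"
            by (intro borel_measurable_sum borel_measurable_times) (use j in \<open>auto simp: K1_def intro!: rv\<close>)
          thus "{\<omega>\<in>space M. cmod ((\<Sum>i\<in>K1. u (fst i) * ?X i \<omega>) - 0) < \<delta>} \<in> events" by measurable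
        qed
        also have "\<dots> \<le> 1 / real R + 2 * real R * (1 - (1 - p) / 2 / (real R)\<^sup>2) ^ (card J div 2)"
          by (rule small_ball_sum[OF _ indK _ c p _ _ \<tau>(1) \<delta> R]) (use j ac in \<open>auto simp: K1_def J_def\<close>)
        also have "\<dots> \<le> \<rho>" unfolding \<rho>_def
        proof (intro add_left_mono mult_left_mono power_decreasing)
          have "(1 - p) / 2 \<le> 1" using p by simp
          also have "1 \<le> (real R)\<^sup>2" using R by simp
          finally show "0 \<le> 1 - (1 - p) / 2 / (real R)\<^sup>2" using R by (simp add: divide_le_eq)
        qed (use cJ p in \<open>auto intro: div_le_mono\<close>)
        finally show ?thesis .
      qed
    qed
  qed
  define f where "f \<omega> = (\<Sum>j<n. indicator (D j) \<omega> :: real)" for \<omega>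
  have f[measurable]: "f \<in> borel_measurable M"
    unfolding f_def by (intro borel_measurable_sum borel_measurable_indicator D) auto
  have intf: "integrable M f" unfolding f_def
    by (intro Bochner_Integration.integrable_sum integrable_real_indicator D) (auto simp: less_top[symmetric])
  define F where "F = {\<omega>\<in>space M. real k \<le> f \<omega>}"
  have F[measurable]: "F \<in> events" unfolding F_def by measurable
  have "real k * prob F = (\<integral>\<omega>. real k * indicator F \<omega> \<partial>M)" by simp
  also have "\<dots> \<le> (\<integral>\<omega>. f \<omega> \<partial>M)"
  proof (rule integral_mono[OF _ intf])
    show "integrable M (\<lambda>\<omega>. real k * indicator F \<omega>)"
      by (intro integrable_mult_right integrable_real_indicator) (auto simp: less_top[symmetric])
    show "real k * indicator F \<omega> \<le> f \<omega>" for \<omega>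
      by (cases "\<omega> \<in> F") (auto simp: F_def f_def intro!: sum_nonneg)
  qed
  also have "\<dots> = (\<Sum>j<n. prob (D j))" unfolding f_def
    using D by (subst Bochner_Integration.integral_sum) (auto intro!: integrable_real_indicator sum.cong simp: less_top[symmetric] dest: sets.sets_into_space)
  also have "\<dots> \<le> (\<Sum>j<n. \<rho>)" by (intro sum_mono D) auto
  finally have pF: "prob F \<le> real n * \<rho> / real k" using k by (simp add: field_simps)
  define Bad where "Bad = Hb \<union> (E1 \<union> (\<Union>j<n. C j)) \<union> F"
  have UC: "(\<Union>j<n. C j) \<in> events" using C by auto
  have Bad: "Bad \<in> events" unfolding Bad_def using E1 UC by auto
  have "prob (\<Union>j<n. C j) \<le> (\<Sum>j<n. prob (C j))"
    by (rule finite_measure_subadditive_finite) (use C in auto)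
  also have "\<dots> \<le> (\<Sum>j<n. q * p ^ (n - 1))" by (intro sum_mono C) auto
  finally have pC: "prob (\<Union>j<n. C j) \<le> real n * (q * p ^ (n - 1))" by simp
  have "prob E1 \<le> q * p ^ (n - 1)"
  proof -
    have "p ^ n \<le> p ^ (n - 1)" using p by (intro power_decreasing) auto
    thus ?thesis using E1(2) mult_left_mono[OF _ q0] by (meson order_trans)
  qed
  hence "prob (E1 \<union> (\<Union>j<n. C j)) \<le> real (n + 1) * (q * p ^ (n - 1))"
    using measure_Un_le[OF E1(1) UC] pC by (simp add: algebra_simps)
  moreover have "prob Bad \<le> prob Hb + prob (E1 \<union> (\<Union>j<n. C j)) + prob F"
    unfolding Bad_def using E1 UC
    by (intro order_trans[OF measure_Un_le] add_mono measure_Un_le) auto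
  ultimately have pB: "prob Bad \<le> prob Hb + real (n + 1) * (q * p ^ (n - 1)) + real n * \<rho> / real k"
    using pF by linarith
  show ?thesis
  proof (intro bexI[OF _ Bad] conjI ballI allI impI)
    show "prob Bad \<le> prob {\<omega>\<in>space M. H < (\<Sum>i<n. \<Sum>j<n. cmod (W i j \<omega>))}
       + real (n + 1) * (real ((n * card (grid \<tau>)) ^ k) * p ^ (n - 1)) + real n * \<rho> / real k"
      using pB unfolding q_def Hb_def .
    fix \<omega> v assume \<omega>: "\<omega> \<in> space M - Bad" and v1: "\<forall>i<n. cmod (v i) \<le> 1" and v2: "\<exists>i<n. cmod (v i) = 1"
    have \<omega>M: "\<omega> \<in> space M" using \<omega> by simp
    have sumH: "(\<Sum>i<n. \<Sum>j<n. cmod (W i j \<omega>)) \<le> H" using \<omega> by (auto simp: Bad_def Hb_def)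
    have rowH: "(\<Sum>j<n. cmod (W i j \<omega>)) \<le> H" if "i < n" for i
      using that by (intro order_trans[OF member_le_sum sumH]) (auto intro: sum_nonneg)
    show "\<exists>i<n. t0 < cmod (\<Sum>j<n. v j * W i j \<omega>)"
    proof (rule ccontr)
      assume "\<not> ?thesis"
      hence small: "\<And>i. i < n \<Longrightarrow> cmod (\<Sum>j<n. v j * W i j \<omega>) \<le> t0" by force
      define J where "J = {i. i < n \<and> \<tau> < cmod (v i)}"
      have kJ: "k < card J"
      proof (rule ccontr)
        assume "\<not> k < card J"
        hence kc: "card {i. i < n \<and> \<tau> < cmod (v i)} \<le> k" by (simp add: J_def)
        have "\<omega> \<in> E1" unfolding E1_def
          by (rule net_eventI[OF \<omega>M \<tau> _ v2 kc _ _ c1]) (use v1 small rowH in auto)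
        thus False using \<omega> by (simp add: Bad_def)
      qed
      have "\<forall>i. \<exists>w. i < n \<longrightarrow> w \<in> grid m \<and> cmod (w - v i) \<le> 2 * m"
        using grid_approx[OF m(1)] v1 by blast
      then obtain w0 where w0: "\<And>i. i < n \<Longrightarrow> w0 i \<in> grid m" "\<And>i. i < n \<Longrightarrow> cmod (w0 i - v i) \<le> 2 * m"
        by metis
      define w where "w = restrict w0 {..<n}"
      have w: "w \<in> PiE {..<n} (\<lambda>_. grid m)" "\<And>i. i < n \<Longrightarrow> cmod (w i - v i) \<le> 2 * m"
        using w0 by (auto simp: w_def)
      have wt: "cmod (\<Sum>l<n. w l * W i l \<omega>) < t" if i: "i < n" for i
      proof -
        have "(\<Sum>l<n. w l * W i l \<omega>) = (\<Sum>l<n. v l * W i l \<omega>) + (\<Sum>l<n. (w l - v l) * W i l \<omega>)"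
          by (simp add: sum.distrib[symmetric] algebra_simps)
        hence "cmod (\<Sum>l<n. w l * W i l \<omega>) \<le> cmod (\<Sum>l<n. v l * W i l \<omega>) + cmod (\<Sum>l<n. (w l - v l) * W i l \<omega>)"
          by (simp only: norm_triangle_ineq)
        also have "cmod (\<Sum>l<n. v l * W i l \<omega>) \<le> t0" by (rule small[OF i])
        also have "cmod (\<Sum>l<n. (w l - v l) * W i l \<omega>) \<le> (\<Sum>l<n. 2 * m * cmod (W i l \<omega>))"
          by (rule sum_norm_le) (use w(2) in \<open>auto simp: norm_mult intro!: mult_right_mono\<close>)
        also have "\<dots> = 2 * m * (\<Sum>l<n. cmod (W i l \<omega>))" by (simp add: sum_distrib_left)
        also have "\<dots> \<le> 2 * m * H" using rowH[OF i] m by (intro mult_left_mono) auto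
        finally show ?thesis using c2 by linarith
      qed
      have inD: "\<omega> \<in> D j" if j: "j \<in> J" for j
      proof -
        have jn: "j < n" "\<tau> < cmod (v j)" using j by (auto simp: J_def)
        have "cmod (v j) \<le> cmod (w j) + cmod (w j - v j)"
          using norm_triangle_ineq2[of "v j" "w j"] by (simp add: norm_minus_commute)
        hence "\<tau> / 2 \<le> cmod (w j)" using w(2)[OF jn(1)] jn(2) m by linarith
        hence "w \<in> V j" using w(1) by (simp add: V_def)
        moreover have "(\<Sum>i<n. \<Sum>l\<in>{..<n}-{j}. cmod (W i l \<omega>)) \<le> (\<Sum>i<n. \<Sum>l<n. cmod (W i l \<omega>))"
          by (intro sum_mono sum_mono2) auto
        moreover have "\<omega> \<notin> C j" using \<omega> jn by (auto simp: Bad_def)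
        ultimately show ?thesis unfolding D_def using \<omega>M wt sumH by auto
      qed
      have "real k \<le> real (card J)" using kJ by simp
      also have "\<dots> = (\<Sum>j\<in>J. indicator (D j) \<omega>)" using inD by simp
      also have "\<dots> \<le> f \<omega>" unfolding f_def by (rule sum_mono2) (auto simp: J_def)
      finally have "\<omega> \<in> F" using \<omega>M by (simp add: F_def)
      thus False using \<omega> by (simp add: Bad_def)
    qed
  qed
qed

section \<open>Determinants of matrices with stable rows\<close>

lemma det_le_prod_row_sums:
  fixes A :: "complex mat"
  assumes A: "A \<in> carrier_mat n n"
  shows "cmod (Determinant.det A) \<le> (\<Prod>i<n. \<Sum>j<n. cmod (A $$ (i, j)))"
proof -
  let ?P = "{p. p permutes {0..<n}}"
  let ?F = "\<lambda>f. \<Prod>i\<in>{0..<n}. cmod (A $$ (i, f i))"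
  have sg: "\<bar>real_of_int (sign p)\<bar> = 1" for p :: "nat \<Rightarrow> nat" by (simp add: sign_def)
  have "cmod (Determinant.det A) \<le> (\<Sum>p\<in>?P. ?F p)"
    unfolding det_def'[OF A]
    by (rule order_trans[OF norm_sum]) (simp add: norm_mult sg prod_norm)
  also have "\<dots> = (\<Sum>p\<in>?P. ?F (restrict p {0..<n}))" by (intro sum.cong prod.cong) auto
  also have "\<dots> = (\<Sum>f\<in>(\<lambda>p. restrict p {0..<n}) ` ?P. ?F f)"
  proof (subst sum.reindex)
    show "inj_on (\<lambda>p. restrict p {0..<n}) ?P"
    proof (rule inj_onI, rule ext)
      fix p q i assume p: "p \<in> ?P" and q: "q \<in> ?P" and eq: "restrict p {0..<n} = restrict q {0..<n}"
      show "p i = q i"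
      proof (cases "i \<in> {0..<n}")
        case True
        thus ?thesis using fun_cong[OF eq, of i] by simp
      next
        case False
        thus ?thesis using p q by (simp add: permutes_not_in)
      qed
    qed
  qed (simp add: o_def)
  also have "\<dots> \<le> (\<Sum>f\<in>PiE {0..<n} (\<lambda>_. {0..<n}). ?F f)"
  proof (rule sum_mono2)
    show "(\<lambda>p. restrict p {0..<n}) ` ?P \<subseteq> PiE {0..<n} (\<lambda>_. {0..<n})"
    proof
      fix f assume "f \<in> (\<lambda>p. restrict p {0..<n}) ` ?P"
      then obtain p where p: "p permutes {0..<n}" "f = restrict p {0..<n}" by blast
      show "f \<in> PiE {0..<n} (\<lambda>_. {0..<n})"
        unfolding p(2) using permutes_in_image[OF p(1)] by (intro restrict_PiE_iff[THEN iffD2]) blast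
    qed
  qed (auto intro!: finite_PiE prod_nonneg)
  also have "\<dots> = (\<Prod>i\<in>{0..<n}. \<Sum>j\<in>{0..<n}. cmod (A $$ (i, j)))"
    by (rule prod_sum_PiE[symmetric]) auto
  finally show ?thesis by (simp add: lessThan_atLeast0)
qed

abbreviation l2 :: "nat \<Rightarrow> (nat \<Rightarrow> complex) \<Rightarrow> real" where
  "l2 n x \<equiv> L2_set (\<lambda>k. cmod (x k)) {..<n}"

definition rows_stable :: "nat \<Rightarrow> real \<Rightarrow> (nat \<Rightarrow> nat \<Rightarrow> complex) \<Rightarrow> nat set \<Rightarrow> bool" where
  "rows_stable n \<kappa> b J \<longleftrightarrow> (\<forall>c. \<forall>j\<in>J. \<kappa> * cmod (c j) \<le> l2 n (\<lambda>k. \<Sum>i\<in>J. c i * b i k))"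

lemma l2_triangle: "l2 n (\<lambda>k. x k + y k) \<le> l2 n x + l2 n y"
  by (rule order_trans[OF L2_set_mono L2_set_triangle_ineq]) (auto intro: norm_triangle_ineq)

lemma l2_mult: "l2 n (\<lambda>k. c * x k) = cmod c * l2 n x"
  by (simp add: norm_mult L2_set_right_distrib)

lemma l2_sum: "finite I \<Longrightarrow> l2 n (\<lambda>k. \<Sum>i\<in>I. x i k) \<le> (\<Sum>i\<in>I. l2 n (x i))"
proof (induction I rule: finite_induct)
  case empty
  thus ?case by (simp add: L2_set_def)
next
  case (insert i I)
  thus ?case using l2_triangle[where n = n and x = "x i" and y = "\<lambda>k. \<Sum>i\<in>I. x i k"] by simp
qed

lemma rows_stable_det:
  assumes st: "rows_stable n \<kappa> (\<lambda>i k. B $$ (i, k)) {..<n}" and \<kappa>: "\<kappa> > 0" and B: "B \<in> carrier_mat n n"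
  shows "Determinant.det B \<noteq> 0"
proof
  assume "Determinant.det B = 0"
  hence "Determinant.det (B\<^sup>T) = 0" using det_transpose[OF B] by simp
  then obtain v where v: "v \<in> carrier_vec n" "v \<noteq> 0\<^sub>v n" "B\<^sup>T *\<^sub>v v = 0\<^sub>v n"
    using det_0_iff_vec_prod_zero[of "B\<^sup>T" n] B by auto
  have "(\<Sum>i<n. vec_index v i * B $$ (i, k)) = 0" if k: "k < n" for k
  proof -
    have "0 = vec_index (B\<^sup>T *\<^sub>v v) k" using v(3) k by simp
    also have "\<dots> = (\<Sum>i\<in>{0..<n}. vec_index v i * B $$ (i, k))"
      using k v(1) B by (auto simp: scalar_prod_def mult.commute intro!: sum.cong)
    finally show ?thesis by (simp add: lessThan_atLeast0)
  qed
  hence "l2 n (\<lambda>k. \<Sum>i<n. vec_index v i * B $$ (i, k)) = 0" by (simp add: L2_set_def)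
  hence "vec_index v j = 0" if "j < n" for j
    using st[unfolded rows_stable_def, rule_format, of j "\<lambda>i. vec_index v i"] that \<kappa>
    by (simp add: mult_le_0_iff)
  hence "v = 0\<^sub>v n" using v(1) by (intro eq_vecI) auto
  thus False using v(2) by simp
qed

lemma det_compare_stable:
  fixes A B :: "complex mat"
  assumes st: "rows_stable n \<kappa> (\<lambda>i k. B $$ (i, k)) {..<n}" and \<kappa>: "\<kappa> > 0"
    and B: "B \<in> carrier_mat n n" and A: "A \<in> carrier_mat n n" and S: "S \<subseteq> {..<n}"
    and near: "\<And>i. i \<in> S \<Longrightarrow> l2 n (\<lambda>k. A $$ (i, k) - B $$ (i, k)) \<le> \<eta> i"
    and far: "\<And>i. i \<in> {..<n} - S \<Longrightarrow> l2 n (\<lambda>k. A $$ (i, k)) \<le> H"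
  shows "cmod (Determinant.det A) \<le> cmod (Determinant.det B) *
     ((\<Prod>i\<in>S. 1 + real n * \<eta> i / \<kappa>) * (real n * H / \<kappa>) ^ (n - card S))"
proof -
  have det0: "Determinant.det B \<noteq> 0" by (rule rows_stable_det[OF st \<kappa> B])
  define X where "X = inverse (Determinant.det B) \<cdot>\<^sub>m (A * adj_mat B)"
  have X: "X \<in> carrier_mat n n" using A adj_mat(1)[OF B] by (simp add: X_def)
  have "X * B = inverse (Determinant.det B) \<cdot>\<^sub>m (A * (adj_mat B * B))"
    unfolding X_def using A B adj_mat(1)[OF B] by (subst mult_smult_assoc_mat[of _ n n]) (auto simp: assoc_mult_mat[of A n n _ n B n])
  also have "\<dots> = inverse (Determinant.det B) \<cdot>\<^sub>m (Determinant.det B \<cdot>\<^sub>m A)"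
    unfolding adj_mat(3)[OF B] using A by (simp add: mult_smult_distrib[of A n n "1\<^sub>m n" n])
  also have "\<dots> = A" using det0 by (intro eq_matI) auto
  finally have XB: "X * B = A" .
  have detA: "Determinant.det A = Determinant.det X * Determinant.det B"
    unfolding XB[symmetric] by (rule det_mult[OF X B])
  have row: "(\<Sum>j<n. X $$ (i, j) * B $$ (j, k)) = A $$ (i, k)" if "i < n" "k < n" for i k
  proof -
    have "A $$ (i, k) = (X * B) $$ (i, k)" by (simp add: XB)
    also have "\<dots> = (\<Sum>j\<in>{0..<n}. X $$ (i, j) * B $$ (j, k))"
      using that X B by (auto simp: scalar_prod_def intro!: sum.cong)
    finally show ?thesis by (simp add: lessThan_atLeast0)
  qed
  have stab: "cmod (c j) \<le> l2 n (\<lambda>k. \<Sum>i<n. c i * B $$ (i, k)) / \<kappa>" if "j < n" for c j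
    using st[unfolded rows_stable_def, rule_format, of j c] that \<kappa> by (simp add: field_simps)
  have S1: "(\<Sum>j<n. cmod (X $$ (i, j))) \<le> 1 + n * \<eta> i / \<kappa>" if i: "i \<in> S" for i
  proof -
    have inn: "i < n" using i S by auto
    let ?c = "\<lambda>j. X $$ (i, j) - (if j = i then 1 else 0)"
    have "(\<Sum>j<n. ?c j * B $$ (j, k)) = A $$ (i, k) - B $$ (i, k)" if k: "k < n" for k
      using row[OF inn k] inn by (simp add: left_diff_distrib sum_subtractf if_distrib[of "\<lambda>x. x * _"] cong: if_cong)
    hence "l2 n (\<lambda>k. \<Sum>j<n. ?c j * B $$ (j, k)) = l2 n (\<lambda>k. A $$ (i, k) - B $$ (i, k))"
      by (intro L2_set_cong) auto
    hence c: "cmod (?c j) \<le> \<eta> i / \<kappa>" if "j < n" for j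
      using stab[OF that, of ?c] near[OF i] \<kappa> by (smt (verit) divide_right_mono)
    have "(\<Sum>j<n. cmod (X $$ (i, j))) \<le> (\<Sum>j<n. (if j = i then 1 else 0) + \<eta> i / \<kappa>)"
    proof (rule sum_mono)
      fix j assume "j \<in> {..<n}"
      hence "cmod (?c j) \<le> \<eta> i / \<kappa>" using c by simp
      moreover have "cmod (X $$ (i, j)) \<le> cmod (if j = i then 1 else (0::complex)) + cmod (?c j)"
        by (metis add.commute diff_add_cancel norm_triangle_ineq)
      ultimately show "cmod (X $$ (i, j)) \<le> (if j = i then 1 else 0) + \<eta> i / \<kappa>" by (auto split: if_splits)
    qed
    also have "\<dots> = 1 + n * \<eta> i / \<kappa>" using inn by (simp add: sum.distrib)
    finally show ?thesis .
  qed
  have S2: "(\<Sum>j<n. cmod (X $$ (i, j))) \<le> n * H / \<kappa>" if i: "i \<in> {..<n} - S" for i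
  proof -
    have inn: "i < n" using i by auto
    have "l2 n (\<lambda>k. \<Sum>j<n. X $$ (i, j) * B $$ (j, k)) = l2 n (\<lambda>k. A $$ (i, k))"
      using row[OF inn] by (intro L2_set_cong) auto
    hence "cmod (X $$ (i, j)) \<le> H / \<kappa>" if "j < n" for j
      using stab[OF that, of "\<lambda>j. X $$ (i, j)"] far[OF i] \<kappa> by (smt (verit) divide_right_mono)
    hence "(\<Sum>j<n. cmod (X $$ (i, j))) \<le> (\<Sum>j<n. H / \<kappa>)" by (intro sum_mono) auto
    thus ?thesis by simp
  qed
  have "cmod (Determinant.det X) \<le> (\<Prod>i<n. \<Sum>j<n. cmod (X $$ (i, j)))"
    by (rule det_le_prod_row_sums[OF X])
  also have "\<dots> \<le> (\<Prod>i<n. if i \<in> S then 1 + n * \<eta> i / \<kappa> else n * H / \<kappa>)"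
    using S1 S2 by (intro prod_mono) (auto intro!: sum_nonneg)
  also have "\<dots> = (\<Prod>i\<in>S. 1 + real n * \<eta> i / \<kappa>) * (real n * H / \<kappa>) ^ (n - card S)"
  proof -
    have "finite S" using S finite_subset by blast
    hence "card ({..<n} - S) = n - card S" using S by (simp add: card_Diff_subset)
    moreover have "{..<n} \<inter> {i. i \<in> S} = S" "{..<n} \<inter> - {i. i \<in> S} = {..<n} - S" using S by auto
    ultimately show ?thesis by (simp add: prod.If_cases)
  qed
  finally show ?thesis unfolding detA norm_mult by (subst mult.commute) (rule mult_left_mono, auto)
qed

lemma orthonormal_completion:
  fixes r :: "nat \<Rightarrow> nat \<Rightarrow> complex"
  assumes "J \<subseteq> {..<n}"
  shows "\<exists>r'. (\<forall>i\<in>J. r' i = r i) \<and> (\<forall>i\<in>{..<n}-J. (\<Sum>k<n. r' i k * cnj (r' i k)) = 1 \<and>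
      (\<forall>j<n. j \<noteq> i \<longrightarrow> (\<Sum>k<n. r' i k * cnj (r' j k)) = 0))"
  using assms
proof (induction "card ({..<n} - J)" arbitrary: J r)
  case 0
  hence "{..<n} - J = {}" by simp
  thus ?case by auto
next
  case (Suc m)
  then obtain i0 where i0: "i0 < n" "i0 \<notin> J"
    by (metis Diff_iff card.empty ex_in_conv lessThan_iff nat.distinct(1))
  obtain u where u: "\<exists>i<n. cmod (u i) = 1"
      "\<And>l. l < n \<Longrightarrow> l \<noteq> i0 \<Longrightarrow> (\<Sum>k<n. (if l \<in> J then cnj (r l k) else 0) * u k) = 0"
    using exists_kernel_vector[OF i0(1), of "\<lambda>l k. if l \<in> J then cnj (r l k) else 0"] by blast
  define s where "s = (\<Sum>k<n. (cmod (u k))\<^sup>2)"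
  have s: "s > 0"
  proof -
    obtain i where i: "i < n" "cmod (u i) = 1" using u(1) by blast
    have "(cmod (u i))\<^sup>2 \<le> s" unfolding s_def using i by (intro member_le_sum) auto
    thus ?thesis using i by simp
  qed
  define w where "w k = u k / of_real (sqrt s)" for k
  have w1: "(\<Sum>k<n. w k * cnj (w k)) = 1"
  proof -
    have "w k * cnj (w k) = of_real ((cmod (u k))\<^sup>2) / of_real s" for k
      using s by (simp add: w_def complex_norm_square[symmetric] of_real_mult[symmetric] del: of_real_mult)
    hence "(\<Sum>k<n. w k * cnj (w k)) = of_real s / of_real s"
      by (simp add: s_def sum_divide_distrib[symmetric])
    thus ?thesis using s by simp
  qed
  have w2: "(\<Sum>k<n. w k * cnj (r j k)) = 0" if "j \<in> J" for j
  proof -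
    have "j < n" "j \<noteq> i0" using that Suc.prems i0 by auto
    from u(2)[OF this] have "(\<Sum>k<n. cnj (r j k) * u k) = 0" using that by simp
    hence "(\<Sum>k<n. cnj (r j k) * u k) / of_real (sqrt s) = 0" by simp
    thus ?thesis by (simp add: w_def sum_divide_distrib mult.commute)
  qed
  have "m = card ({..<n} - insert i0 J)"
  proof -
    have "{..<n} - J = insert i0 ({..<n} - insert i0 J)" using i0 by auto
    hence "card ({..<n} - J) = Suc (card ({..<n} - insert i0 J))"
      by (metis Diff_iff card_insert_disjoint finite_Diff finite_lessThan insertI1)
    thus ?thesis using Suc.hyps(2) by simp
  qed
  moreover have "insert i0 J \<subseteq> {..<n}" using i0 Suc.prems by simp
  ultimately have "\<exists>r'. (\<forall>i\<in>insert i0 J. r' i = (r(i0 := w)) i) \<and> (\<forall>i\<in>{..<n}-insert i0 J. (\<Sum>k<n. r' i k * cnj (r' i k)) = 1 \<and>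
      (\<forall>j<n. j \<noteq> i \<longrightarrow> (\<Sum>k<n. r' i k * cnj (r' j k)) = 0))"
    by (rule Suc.hyps(1))
  then obtain r' where R: "(\<forall>i\<in>insert i0 J. r' i = (r(i0 := w)) i) \<and> (\<forall>i\<in>{..<n}-insert i0 J. (\<Sum>k<n. r' i k * cnj (r' i k)) = 1 \<and>
      (\<forall>j<n. j \<noteq> i \<longrightarrow> (\<Sum>k<n. r' i k * cnj (r' j k)) = 0))"
    by (rule exE)
  have r': "\<And>i. i \<in> insert i0 J \<Longrightarrow> r' i = (r(i0 := w)) i"
    "\<And>i. i \<in> {..<n} - insert i0 J \<Longrightarrow> (\<Sum>k<n. r' i k * cnj (r' i k)) = 1"
    "\<And>i j. i \<in> {..<n} - insert i0 J \<Longrightarrow> j < n \<Longrightarrow> j \<noteq> i \<Longrightarrow> (\<Sum>k<n. r' i k * cnj (r' j k)) = 0"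
    using R by (blast, simp_all)
  have ri0: "r' i0 = w" using r'(1)[of i0] by simp
  have "(\<Sum>k<n. w k * cnj (r' j k)) = 0" if j: "j < n" "j \<noteq> i0" for j
  proof (cases "j \<in> J")
    case True
    thus ?thesis using w2[OF True] r'(1)[of j] i0 by auto
  next
    case False
    have "(\<Sum>k<n. r' j k * cnj (r' i0 k)) = 0" by (rule r'(3)) (use False j i0 in auto)
    hence "cnj (\<Sum>k<n. r' j k * cnj (w k)) = 0" by (simp add: ri0)
    thus ?thesis by (simp add: mult.commute)
  qed
  hence "(\<Sum>k<n. r' i k * cnj (r' i k)) = 1 \<and> (\<forall>j<n. j \<noteq> i \<longrightarrow> (\<Sum>k<n. r' i k * cnj (r' j k)) = 0)"
    if "i \<in> {..<n} - J" for i
    using that w1 ri0 r'(2,3)[of i] by (cases "i = i0") auto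
  moreover have "\<forall>i\<in>J. r' i = r i" using r'(1) i0 by auto
  ultimately show ?case by blast
qed

lemma sum_cmod_sq_eq_l2: "of_real ((l2 n x)\<^sup>2) = (\<Sum>k<n. x k * cnj (x k))"
  by (simp add: L2_set_def sum_nonneg complex_norm_square[symmetric])

lemma stable_completion:
  assumes J: "J \<subseteq> {..<n}" and st: "rows_stable n \<epsilon> r J" and \<epsilon>: "\<epsilon> \<ge> 0"
  shows "\<exists>r'. (\<forall>i\<in>J. r' i = r i) \<and> (\<forall>i\<in>{..<n}-J. l2 n (r' i) = 1) \<and> rows_stable n (min \<epsilon> 1) r' {..<n}"
proof -
  obtain r' where r': "\<And>i. i \<in> J \<Longrightarrow> r' i = r i"
    "\<And>i. i \<in> {..<n} - J \<Longrightarrow> (\<Sum>k<n. r' i k * cnj (r' i k)) = 1"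
    "\<And>i j. i \<in> {..<n} - J \<Longrightarrow> j < n \<Longrightarrow> j \<noteq> i \<Longrightarrow> (\<Sum>k<n. r' i k * cnj (r' j k)) = 0"
    using orthonormal_completion[OF J, of r] by blast
  have l1: "l2 n (r' i) = 1" if "i \<in> {..<n} - J" for i
  proof -
    have "of_real ((l2 n (r' i))\<^sup>2) = (1::complex)" unfolding sum_cmod_sq_eq_l2 by (rule r'(2)[OF that])
    hence "(l2 n (r' i))\<^sup>2 = 1" by (simp only: of_real_eq_1_iff)
    thus ?thesis using L2_set_nonneg[of "\<lambda>k. cmod (r' i k)" "{..<n}"] by (simp add: power2_eq_1_iff)
  qed
  have orth': "(\<Sum>k<n. r' j k * cnj (r' i k)) = 0" if "i \<in> {..<n} - J" "j < n" "j \<noteq> i" for i j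
  proof -
    have "cnj (\<Sum>k<n. r' i k * cnj (r' j k)) = 0" using r'(3)[OF that] by simp
    thus ?thesis by (simp add: mult.commute)
  qed
  have "min \<epsilon> 1 * cmod (c j) \<le> l2 n (\<lambda>k. \<Sum>i<n. c i * r' i k)" if j: "j < n" for c j
  proof (cases "j \<in> J")
    case False
    hence jJ: "j \<in> {..<n} - J" using j by simp
    have "(\<Sum>k<n. (\<Sum>i<n. c i * r' i k) * cnj (r' j k)) = (\<Sum>i<n. c i * (\<Sum>k<n. r' i k * cnj (r' j k)))"
      by (simp add: sum_distrib_left sum_distrib_right mult_ac) (rule sum.swap)
    also have "\<dots> = (\<Sum>i<n. if i = j then c j else 0)"
      using r'(2)[OF jJ] orth'[OF jJ] by (intro sum.cong) auto
    also have "\<dots> = c j" using j by simp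
    finally have "cmod (c j) = cmod (\<Sum>k<n. (\<Sum>i<n. c i * r' i k) * cnj (r' j k))" by simp
    also have "\<dots> \<le> (\<Sum>k<n. \<bar>cmod (\<Sum>i<n. c i * r' i k)\<bar> * \<bar>cmod (r' j k)\<bar>)"
      by (rule order_trans[OF norm_sum]) (simp add: norm_mult)
    also have "\<dots> \<le> l2 n (\<lambda>k. \<Sum>i<n. c i * r' i k) * l2 n (r' j)" by (rule L2_set_mult_ineq)
    finally have "cmod (c j) \<le> l2 n (\<lambda>k. \<Sum>i<n. c i * r' i k)" using l1[OF jJ] by simp
    moreover have "min \<epsilon> 1 * cmod (c j) \<le> 1 * cmod (c j)" by (rule mult_right_mono) auto
    ultimately show ?thesis by simp
  next
    case True
    define x where "x k = (\<Sum>i\<in>J. c i * r i k)" for k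
    define y where "y k = (\<Sum>i\<in>{..<n}-J. c i * r' i k)" for k
    have xy: "(\<Sum>i<n. c i * r' i k) = x k + y k" for k
      unfolding x_def y_def using J r'(1) by (subst sum.subset_diff[OF J]) (auto simp: add.commute intro!: sum.cong)
    have "(\<Sum>k<n. x k * cnj (y k)) = (\<Sum>k<n. \<Sum>i\<in>J. \<Sum>j\<in>{..<n}-J. c i * cnj (c j) * (r' i k * cnj (r' j k)))"
      using r'(1) by (intro sum.cong refl) (simp add: x_def y_def sum_product mult_ac cong: sum.cong)
    also have "\<dots> = (\<Sum>i\<in>J. \<Sum>j\<in>{..<n}-J. c i * cnj (c j) * (\<Sum>k<n. r' i k * cnj (r' j k)))"
      by (subst sum.swap, rule sum.cong[OF refl], subst sum.swap) (simp add: sum_distrib_left)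
    also have "\<dots> = 0" using orth' J by (intro sum.neutral ballI) auto
    finally have o: "(\<Sum>k<n. x k * cnj (y k)) = 0" .
    have "cnj (\<Sum>k<n. x k * cnj (y k)) = 0" using o by simp
    hence o': "(\<Sum>k<n. y k * cnj (x k)) = 0" by (simp add: mult.commute)
    have "(of_real ((l2 n (\<lambda>k. x k + y k))\<^sup>2) :: complex) = of_real ((l2 n x)\<^sup>2 + (l2 n y)\<^sup>2)"
      unfolding of_real_add sum_cmod_sq_eq_l2 using o o' by (simp add: algebra_simps sum.distrib)
    hence "(l2 n (\<lambda>k. x k + y k))\<^sup>2 = (l2 n x)\<^sup>2 + (l2 n y)\<^sup>2" by (simp only: of_real_eq_iff)
    hence "(l2 n x)\<^sup>2 \<le> (l2 n (\<lambda>k. x k + y k))\<^sup>2" by simp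
    hence le: "l2 n x \<le> l2 n (\<lambda>k. x k + y k)" by (rule power2_le_imp_le) (rule L2_set_nonneg)
    have "min \<epsilon> 1 * cmod (c j) \<le> \<epsilon> * cmod (c j)" by (rule mult_right_mono) auto
    also have "\<dots> \<le> l2 n x" using st True unfolding rows_stable_def x_def by blast
    finally show ?thesis using le unfolding xy by linarith
  qed
  thus ?thesis using r'(1) l1 unfolding rows_stable_def by (intro exI[of _ r']) auto
qed

lemma rows_stable_perturb:
  assumes st: "rows_stable n \<kappa> b {..<n}"
    and near: "(\<Sum>i<n. l2 n (\<lambda>k. b' i k - b i k)) \<le> \<kappa> / 2" and \<kappa>: "\<kappa> \<ge> 0"
  shows "rows_stable n (\<kappa> / 2) b' {..<n}"
  unfolding rows_stable_def
proof (intro allI ballI)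
  fix c :: "nat \<Rightarrow> complex" and j assume j: "j \<in> {..<n}"
  define m where "m = Max ((\<lambda>i. cmod (c i)) ` {..<n})"
  have ne: "(\<lambda>i. cmod (c i)) ` {..<n} \<noteq> {}" using j by auto
  have mge: "cmod (c i) \<le> m" if "i < n" for i using that by (auto simp: m_def)
  have "m \<in> (\<lambda>i. cmod (c i)) ` {..<n}" unfolding m_def using ne by (intro Max_in) auto
  then obtain i0 where i0: "i0 < n" "cmod (c i0) = m" by auto
  have m0: "0 \<le> m" using i0(2) norm_ge_zero by metis
  have "l2 n (\<lambda>k. \<Sum>i<n. c i * (b i k - b' i k)) \<le> (\<Sum>i<n. l2 n (\<lambda>k. c i * (b i k - b' i k)))"
    by (rule l2_sum) simp
  also have "\<dots> \<le> (\<Sum>i<n. m * l2 n (\<lambda>k. b' i k - b i k))"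
    unfolding l2_mult using mge m0 by (intro sum_mono mult_mono) (auto simp: norm_minus_commute)
  also have "\<dots> \<le> m * (\<kappa> / 2)"
    unfolding sum_distrib_left[symmetric] using near m0 by (intro mult_left_mono)
  finally have 1: "l2 n (\<lambda>k. \<Sum>i<n. c i * (b i k - b' i k)) \<le> m * (\<kappa> / 2)" .
  have "\<kappa> * m \<le> l2 n (\<lambda>k. \<Sum>i<n. c i * b i k)"
    using st i0 unfolding rows_stable_def by (metis lessThan_iff)
  also have "\<dots> = l2 n (\<lambda>k. (\<Sum>i<n. c i * b' i k) + (\<Sum>i<n. c i * (b i k - b' i k)))"
    by (simp add: algebra_simps sum_subtractf)
  also have "\<dots> \<le> l2 n (\<lambda>k. \<Sum>i<n. c i * b' i k) + l2 n (\<lambda>k. \<Sum>i<n. c i * (b i k - b' i k))"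
    by (rule l2_triangle)
  finally have "\<kappa> / 2 * m \<le> l2 n (\<lambda>k. \<Sum>i<n. c i * b' i k)" using 1 by (simp add: field_simps)
  moreover have "\<kappa> / 2 * cmod (c j) \<le> \<kappa> / 2 * m" using mge j \<kappa> by (intro mult_left_mono) auto
  ultimately show "\<kappa> / 2 * cmod (c j) \<le> l2 n (\<lambda>k. \<Sum>i<n. c i * b' i k)" by linarith
qed

lemma eps_stable_rows_stable:
  assumes N: "N \<in> carrier_mat n n" and S: "S \<subseteq> {..<n}" and \<epsilon>: "\<epsilon> > 0"
    and st: "eps_stable n \<epsilon> (\<lambda>i. Matrix.row N i) S"
  shows "rows_stable n \<epsilon> (\<lambda>i k. N $$ (i, k)) S"
  unfolding rows_stable_def
proof (intro allI ballI)
  fix c :: "nat \<Rightarrow> complex" and j assume j: "j \<in> S"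
  interpret V: vec_space "TYPE(complex)" n .
  let ?X = "(\<lambda>i. Matrix.row N i) ` (S - {j})"
  have X: "?X \<subseteq> carrier_vec n" using N by auto
  have finS: "finite S" using S finite_subset by blast
  show "\<epsilon> * cmod (c j) \<le> l2 n (\<lambda>k. \<Sum>i\<in>S. c i * N $$ (i, k))"
  proof (cases "c j = 0")
    case True
    thus ?thesis by (simp add: L2_set_nonneg)
  next
    case False
    define d where "d i = - c i / c j" for i
    have comb: "Matrix.vec n (\<lambda>k. \<Sum>i\<in>F. d i * N $$ (i, k)) \<in> cspan n ?X" if "finite F" "F \<subseteq> S - {j}" for F
      using that
    proof (induction F rule: finite_induct)
      case empty
      have "Matrix.vec n (\<lambda>k. \<Sum>i\<in>{}. d i * N $$ (i, k)) = 0\<^sub>v n" by auto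
      thus ?case using V.span_zero[of ?X] by simp
    next
      case (insert i F)
      have "Matrix.row N i \<in> cspan n ?X" using insert.prems by (intro V.in_own_span[OF X, THEN subsetD]) auto
      hence "d i \<cdot>\<^sub>v Matrix.row N i \<in> cspan n ?X" by (rule V.smult_in_span[OF X])
      moreover have "Matrix.vec n (\<lambda>k. \<Sum>i\<in>insert i F. d i * N $$ (i, k))
        = d i \<cdot>\<^sub>v Matrix.row N i + Matrix.vec n (\<lambda>k. \<Sum>i\<in>F. d i * N $$ (i, k))"
        using insert N S by (intro eq_vecI) auto
      ultimately show ?case using insert V.span_add1[OF X] by auto
    qed
    let ?w = "Matrix.vec n (\<lambda>k. \<Sum>i\<in>S-{j}. d i * N $$ (i, k))"
    have "?w \<in> cspan n ?X" by (rule comb) (use finS in auto)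
    hence "vec_infdist (Matrix.row N j) (cspan n ?X) \<le> vec_dist (Matrix.row N j) ?w"
      unfolding vec_infdist_def
      by (intro cINF_lower) (auto intro!: bdd_belowI[of _ 0] simp: vec_dist_def L2_set_nonneg)
    hence "\<epsilon> \<le> vec_dist (Matrix.row N j) ?w" using st j by (auto simp: eps_stable_def)
    also have "\<dots> = l2 n (\<lambda>k. N $$ (j, k) - (\<Sum>i\<in>S-{j}. d i * N $$ (i, k)))"
      using N S j unfolding vec_dist_def by (intro L2_set_cong) (auto simp: dist_norm)
    also have "\<dots> = l2 n (\<lambda>k. inverse (c j) * (\<Sum>i\<in>S. c i * N $$ (i, k)))"
    proof (intro L2_set_cong refl arg_cong[where f = cmod])
      fix k
      show "N $$ (j, k) - (\<Sum>i\<in>S-{j}. d i * N $$ (i, k)) = inverse (c j) * (\<Sum>i\<in>S. c i * N $$ (i, k))"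
        using False by (simp add: sum.remove[OF finS j] d_def sum_distrib_left sum_negf distrib_left divide_inverse mult_ac)
    qed
    also have "\<dots> = inverse (cmod (c j)) * l2 n (\<lambda>k. \<Sum>i\<in>S. c i * N $$ (i, k))"
      by (simp only: l2_mult norm_inverse)
    finally show ?thesis using False by (simp add: field_simps)
  qed
qed

lemma l2_le_sum: "l2 n x \<le> (\<Sum>k<n. cmod (x k))"
  using L2_set_le_sum[of "{..<n}" "\<lambda>k. cmod (x k)"] by simp

lemma rows_stable_of_kernel_bound:
  fixes W :: "complex mat"
  assumes W: "W \<in> carrier_mat n n" and n: "n > 0" and t: "t > 0"
    and ker: "\<And>v. (\<forall>i<n. cmod (v i) \<le> 1) \<Longrightarrow> (\<exists>i<n. cmod (v i) = 1) \<Longrightarrow>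
        \<exists>i<n. t < cmod (\<Sum>j<n. v j * W $$ (i, j))"
  shows "rows_stable n (t / n) (\<lambda>i k. W $$ (i, k)) {..<n}"
proof -
  have gen: "\<exists>i<n. t * cmod (v k) \<le> cmod (\<Sum>j<n. v j * W $$ (i, j))" if k: "k < n" for v k
  proof -
    define m where "m = Max ((\<lambda>i. cmod (v i)) ` {..<n})"
    have ne: "(\<lambda>i. cmod (v i)) ` {..<n} \<noteq> {}" using k by auto
    have mge: "cmod (v i) \<le> m" if "i < n" for i using that by (auto simp: m_def)
    have "m \<in> (\<lambda>i. cmod (v i)) ` {..<n}" unfolding m_def using ne by (intro Max_in) auto
    then obtain i0 where i0: "i0 < n" "cmod (v i0) = m" by auto
    show ?thesis
    proof (cases "m = 0")
      case True
      hence "cmod (v k) = 0" using mge[OF k] by simp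
      thus ?thesis using k by auto
    next
      case False
      have "0 \<le> m" using i0(2) norm_ge_zero by metis
      hence m: "m > 0" using False by simp
      have a: "\<forall>i<n. cmod (v i / of_real m) \<le> 1" using mge m by (simp add: norm_divide)
      have "cmod (v i0 / of_real m) = 1" using i0(2) m by (simp add: norm_divide)
      hence b: "\<exists>i<n. cmod (v i / of_real m) = 1" using i0(1) by blast
      obtain i where i: "i < n" "t < cmod (\<Sum>j<n. v j / of_real m * W $$ (i, j))"
        using ker[OF a b] by blast
      have "(\<Sum>j<n. v j / of_real m * W $$ (i, j)) = (\<Sum>j<n. v j * W $$ (i, j)) / of_real m"
        by (simp add: sum_divide_distrib)
      hence "t < cmod (\<Sum>j<n. v j * W $$ (i, j)) / m"
        using i(2) m by (simp only: norm_divide norm_of_real abs_of_pos)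
      hence "t * m < cmod (\<Sum>j<n. v j * W $$ (i, j))" using m by (simp only: pos_less_divide_eq)
      moreover have "t * cmod (v k) \<le> t * m" using mge[OF k] t by simp
      ultimately show ?thesis using i(1) by (intro exI[of _ i]) auto
    qed
  qed
  have det0: "Determinant.det W \<noteq> 0"
  proof
    assume "Determinant.det W = 0"
    then obtain v where v: "v \<in> carrier_vec n" "v \<noteq> 0\<^sub>v n" "W *\<^sub>v v = 0\<^sub>v n"
      using det_0_iff_vec_prod_zero[OF W] by auto
    have z: "(\<Sum>j<n. vec_index v j * W $$ (i, j)) = 0" if i: "i < n" for i
    proof -
      have "0 = vec_index (W *\<^sub>v v) i" using v(3) i by simp
      also have "\<dots> = (\<Sum>j\<in>{0..<n}. vec_index v j * W $$ (i, j))"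
        using i v(1) W by (auto simp: scalar_prod_def mult.commute intro!: sum.cong)
      finally show ?thesis by (simp add: lessThan_atLeast0)
    qed
    have "vec_index v k = 0" if "k < n" for k
      using gen[OF that, of "\<lambda>i. vec_index v i"] z t by (auto simp: mult_le_0_iff)
    hence "v = 0\<^sub>v n" using v(1) by (intro eq_vecI) auto
    thus False using v(2) by simp
  qed
  define Q where "Q = inverse (Determinant.det W) \<cdot>\<^sub>m adj_mat W"
  have Q: "Q \<in> carrier_mat n n" using adj_mat(1)[OF W] by (simp add: Q_def)
  have "W * Q = inverse (Determinant.det W) \<cdot>\<^sub>m (Determinant.det W \<cdot>\<^sub>m 1\<^sub>m n)"
    unfolding Q_def adj_mat(2)[OF W, symmetric] using W adj_mat(1)[OF W] by (intro mult_smult_distrib)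
  also have "\<dots> = 1\<^sub>m n" using det0 by (intro eq_matI) auto
  finally have WQ: "W * Q = 1\<^sub>m n" .
  have wq: "(\<Sum>k<n. Q $$ (k, j) * W $$ (i, k)) = (if i = j then 1 else 0)" if "i < n" "j < n" for i j
  proof -
    have "(if i = j then 1 else 0) = (W * Q) $$ (i, j)" using that by (simp add: WQ)
    also have "\<dots> = (\<Sum>k\<in>{0..<n}. Q $$ (k, j) * W $$ (i, k))"
      using that W Q by (auto simp: scalar_prod_def mult.commute intro!: sum.cong)
    finally show ?thesis by (simp add: lessThan_atLeast0)
  qed
  have qb: "cmod (Q $$ (k, j)) \<le> 1 / t" if kj: "k < n" "j < n" for k j
  proof -
    obtain i where i: "i < n" "t * cmod (Q $$ (k, j)) \<le> cmod (\<Sum>l<n. Q $$ (l, j) * W $$ (i, l))"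
      using gen[OF kj(1), of "\<lambda>k. Q $$ (k, j)"] by blast
    hence "t * cmod (Q $$ (k, j)) \<le> 1" using wq[OF i(1) kj(2)] by (auto split: if_splits)
    thus ?thesis using t by (simp add: field_simps)
  qed
  show ?thesis unfolding rows_stable_def
  proof (intro allI ballI)
    fix c :: "nat \<Rightarrow> complex" and j assume "j \<in> {..<n}"
    hence j: "j < n" by simp
    let ?b = "\<lambda>k. \<Sum>i<n. c i * W $$ (i, k)"
    have "c j = (\<Sum>i<n. c i * (\<Sum>k<n. Q $$ (k, j) * W $$ (i, k)))"
      using wq j by (simp add: if_distrib[of "\<lambda>x. _ * x"] cong: if_cong)
    also have "\<dots> = (\<Sum>k<n. ?b k * Q $$ (k, j))"
      by (simp add: sum_distrib_left sum_distrib_right mult_ac) (rule sum.swap)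
    finally have "cmod (c j) \<le> (\<Sum>k<n. cmod (?b k) * cmod (Q $$ (k, j)))"
      by (metis (no_types, lifting) norm_mult norm_sum sum.cong)
    also have "\<dots> \<le> (\<Sum>k<n. l2 n ?b * (1 / t))"
    proof (intro sum_mono mult_mono)
      fix k assume k: "k \<in> {..<n}"
      show "cmod (?b k) \<le> l2 n ?b" by (rule member_le_L2_set[of _ _ "\<lambda>k. cmod (?b k)"]) (use k in auto)
      show "cmod (Q $$ (k, j)) \<le> 1 / t" using qb k j by simp
    qed (auto simp: L2_set_nonneg)
    finally have "cmod (c j) \<le> n * l2 n ?b / t" by simp
    thus "t / n * cmod (c j) \<le> l2 n ?b" using n t by (simp add: field_simps)
  qed
qed

lemma log_det_compare:
  fixes N' W :: "complex mat"
  assumes N': "N' \<in> carrier_mat n n" and W: "W \<in> carrier_mat n n" and S: "S \<subseteq> {..<n}" and n: "n > 0"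
    and near: "\<And>i k. i \<in> S \<Longrightarrow> k < n \<Longrightarrow> W $$ (i, k) - N' $$ (i, k) = E i k"
    and unit: "\<And>i. i \<in> {..<n} - S \<Longrightarrow> l2 n (\<lambda>k. N' $$ (i, k)) = 1"
    and stN: "rows_stable n \<epsilon> (\<lambda>i k. N' $$ (i, k)) {..<n}" and \<epsilon>: "0 < \<epsilon>" "\<epsilon> \<le> 1"
    and stW: "rows_stable n \<kappa> (\<lambda>i k. W $$ (i, k)) {..<n}" and \<kappa>: "0 < \<kappa>" "\<kappa> \<le> 1"
    and T: "(\<Sum>i<n. \<Sum>k<n. cmod (E i k)) \<le> T" "T \<le> \<epsilon> / 2"
    and H: "\<And>i. i < n \<Longrightarrow> l2 n (\<lambda>k. W $$ (i, k)) \<le> H" "1 \<le> H"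
  shows "Determinant.det W \<noteq> 0"
    and "\<bar>ln (cmod (Determinant.det W)) - ln (cmod (Determinant.det N'))\<bar>
      \<le> 2 * real n * T / \<epsilon> + real (n - card S) * (ln (real n * H / \<epsilon>) + ln (real n / \<kappa>))"
proof -
  have finS: "finite S" using S finite_subset by blast
  have cS: "card S \<le> n" using card_mono[OF _ S] by simp
  define \<eta> where "\<eta> i = (\<Sum>k<n. cmod (E i k))" for i
  have \<eta>0: "\<eta> i \<ge> 0" for i by (simp add: \<eta>_def sum_nonneg)
  have "(\<Sum>i\<in>S. \<eta> i) \<le> (\<Sum>i<n. \<eta> i)" by (rule sum_mono2) (use S \<eta>0 in auto)
  hence \<eta>T: "(\<Sum>i\<in>S. \<eta> i) \<le> T" using T by (simp add: \<eta>_def)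
  have T0: "T \<ge> 0" using \<eta>T sum_nonneg[of S \<eta>] \<eta>0 by (meson order_trans)
  define A' where "A' = mat n n (\<lambda>(i, k). if i \<in> S then W $$ (i, k) else N' $$ (i, k))"
  have A': "A' \<in> carrier_mat n n" by (simp add: A'_def)
  have A'i: "A' $$ (i, k) = (if i \<in> S then W $$ (i, k) else N' $$ (i, k))" if "i < n" "k < n" for i k
    using that by (simp add: A'_def)
  have dW: "l2 n (\<lambda>k. W $$ (i, k) - N' $$ (i, k)) \<le> \<eta> i" if i: "i \<in> S" for i
  proof -
    have "l2 n (\<lambda>k. W $$ (i, k) - N' $$ (i, k)) = l2 n (E i)" using near[OF i] by (intro L2_set_cong) auto
    thus ?thesis using l2_le_sum[where n = n and x = "E i"] by (simp add: \<eta>_def)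
  qed
  have dA: "l2 n (\<lambda>k. A' $$ (i, k) - N' $$ (i, k)) \<le> (if i \<in> S then \<eta> i else 0)" if i: "i < n" for i
  proof (cases "i \<in> S")
    case True
    have "l2 n (\<lambda>k. A' $$ (i, k) - N' $$ (i, k)) = l2 n (\<lambda>k. W $$ (i, k) - N' $$ (i, k))"
      using i True by (intro L2_set_cong) (auto simp: A'i)
    thus ?thesis using dW[OF True] True by simp
  next
    case False
    thus ?thesis using i by (simp add: A'i L2_set_def)
  qed
  have stA: "rows_stable n (\<epsilon> / 2) (\<lambda>i k. A' $$ (i, k)) {..<n}"
  proof (rule rows_stable_perturb[OF stN])
    have "(\<Sum>i<n. l2 n (\<lambda>k. A' $$ (i, k) - N' $$ (i, k))) \<le> (\<Sum>i<n. if i \<in> S then \<eta> i else 0)"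
      by (intro sum_mono dA) auto
    also have "\<dots> = (\<Sum>i\<in>S. \<eta> i)" using S by (simp add: sum.If_cases Int_absorb1)
    finally show "(\<Sum>i<n. l2 n (\<lambda>k. A' $$ (i, k) - N' $$ (i, k))) \<le> \<epsilon> / 2" using \<eta>T T(2) by linarith
  qed (use \<epsilon> in auto)
  note dets = rows_stable_det[OF stN \<epsilon>(1) N'] rows_stable_det[OF stW \<kappa>(1) W] rows_stable_det[OF stA _ A']
  show dW0: "Determinant.det W \<noteq> 0" by (rule dets(2))
  have dA0: "Determinant.det A' \<noteq> 0" using dets(3) \<epsilon> by simp
  have prodle: "(\<Prod>i\<in>S. 1 + real n * \<eta> i / c) \<le> exp (real n * T / c)" if c: "c > 0" for c :: real
  proof -
    have "(\<Prod>i\<in>S. 1 + real n * \<eta> i / c) \<le> (\<Prod>i\<in>S. exp (real n * \<eta> i / c))"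
      using \<eta>0 c by (intro prod_mono) (auto intro!: exp_ge_add_one_self add_nonneg_nonneg)
    also have "\<dots> = exp (\<Sum>i\<in>S. real n * \<eta> i / c)" using finS by (simp add: exp_sum)
    also have "(\<Sum>i\<in>S. real n * \<eta> i / c) = n * (\<Sum>i\<in>S. \<eta> i) / c"
      by (simp add: sum_distrib_left sum_divide_distrib)
    also have "exp \<dots> \<le> exp (real n * T / c)" using \<eta>T c by (simp add: divide_right_mono mult_left_mono)
    finally show ?thesis .
  qed
  have HE: "real n * H / \<epsilon> \<ge> 1"
  proof -
    have "\<epsilon> \<le> 1 * 1" using \<epsilon> by simp
    also have "1 * 1 \<le> real n * H" using n H(2) by (intro mult_mono) auto
    finally show ?thesis using \<epsilon> by (simp add: le_divide_eq)
  qed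
  have nk: "real n / \<kappa> \<ge> 1" using \<kappa> n by (simp add: le_divide_eq)
  have lnaux: "ln (x * (exp y * q ^ k)) = ln x + (y + real k * ln q)" if "x > 0" "1 \<le> q" for x y q :: real and k
    using that by (simp add: ln_mult ln_realpow)
  have 1: "ln (cmod (Determinant.det W)) \<le> ln (cmod (Determinant.det N')) + (real n * T / \<epsilon> + real (n - card S) * ln (real n * H / \<epsilon>))"
  proof -
    have "cmod (Determinant.det W) \<le> cmod (Determinant.det N') * ((\<Prod>i\<in>S. 1 + real n * \<eta> i / \<epsilon>) * (real n * H / \<epsilon>) ^ (n - card S))"
      by (rule det_compare_stable[OF stN \<epsilon>(1) N' W S dW]) (use H in auto)
    also have "\<dots> \<le> cmod (Determinant.det N') * (exp (real n * T / \<epsilon>) * (real n * H / \<epsilon>) ^ (n - card S))"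
      using HE \<epsilon> by (intro mult_left_mono mult_right_mono prodle) auto
    finally have "ln (cmod (Determinant.det W)) \<le> ln (cmod (Determinant.det N') * (exp (real n * T / \<epsilon>) * (real n * H / \<epsilon>) ^ (n - card S)))"
      using dW0 by (intro ln_mono) auto
    also have "\<dots> = ln (cmod (Determinant.det N')) + (real n * T / \<epsilon> + real (n - card S) * ln (real n * H / \<epsilon>))"
      by (rule lnaux) (use dets(1) HE in auto)
    finally show ?thesis .
  qed
  have 2: "ln (cmod (Determinant.det N')) \<le> ln (cmod (Determinant.det A')) + 2 * real n * T / \<epsilon>"
  proof -
    have nearN: "l2 n (\<lambda>k. N' $$ (i, k) - A' $$ (i, k)) \<le> (if i \<in> S then \<eta> i else 0)" if i: "i \<in> {..<n}" for i
      using dA[of i] i by (simp add: norm_minus_commute)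
    have "cmod (Determinant.det N') \<le> cmod (Determinant.det A') * ((\<Prod>i\<in>{..<n}. 1 + real n * (if i \<in> S then \<eta> i else 0) / (\<epsilon> / 2)) * (real n * 0 / (\<epsilon> / 2)) ^ (n - card {..<n}))"
      by (rule det_compare_stable[OF stA _ A' N' subset_refl nearN]) (use \<epsilon> in auto)
    also have "(\<Prod>i\<in>{..<n}. 1 + real n * (if i \<in> S then \<eta> i else 0) / (\<epsilon> / 2)) = (\<Prod>i\<in>S. 1 + real n * \<eta> i / (\<epsilon> / 2))"
      using S by (intro prod.mono_neutral_cong_right) auto
    finally have "cmod (Determinant.det N') \<le> cmod (Determinant.det A') * (\<Prod>i\<in>S. 1 + real n * \<eta> i / (\<epsilon> / 2))" by simp
    also have "\<dots> \<le> cmod (Determinant.det A') * exp (real n * T / (\<epsilon> / 2))"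
      using \<epsilon> by (intro mult_left_mono prodle) auto
    finally have "ln (cmod (Determinant.det N')) \<le> ln (cmod (Determinant.det A') * exp (real n * T / (\<epsilon> / 2)))"
      using dets(1) by (intro ln_mono) auto
    also have "\<dots> = ln (cmod (Determinant.det A')) + 2 * real n * T / \<epsilon>"
      using dA0 by (simp add: ln_mult)
    finally show ?thesis .
  qed
  have 3: "ln (cmod (Determinant.det A')) \<le> ln (cmod (Determinant.det W)) + real (n - card S) * ln (real n / \<kappa>)"
  proof -
    have a: "l2 n (\<lambda>k. A' $$ (i, k) - W $$ (i, k)) \<le> 0" if i: "i \<in> S" for i
    proof -
      have "i < n" using i S by auto
      thus ?thesis using i by (simp add: A'i L2_set_def)
    qed
    have b: "l2 n (\<lambda>k. A' $$ (i, k)) \<le> 1" if i: "i \<in> {..<n} - S" for i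
    proof -
      have "l2 n (\<lambda>k. A' $$ (i, k)) = l2 n (\<lambda>k. N' $$ (i, k))" using i by (intro L2_set_cong) (auto simp: A'i)
      thus ?thesis using unit[OF i] by simp
    qed
    have "cmod (Determinant.det A') \<le> cmod (Determinant.det W) * ((\<Prod>i\<in>S. 1 + real n * 0 / \<kappa>) * (real n * 1 / \<kappa>) ^ (n - card S))"
      by (rule det_compare_stable[OF stW \<kappa>(1) W A' S a b])
    hence "cmod (Determinant.det A') \<le> cmod (Determinant.det W) * (real n / \<kappa>) ^ (n - card S)" by simp
    hence "ln (cmod (Determinant.det A')) \<le> ln (cmod (Determinant.det W) * (real n / \<kappa>) ^ (n - card S))"
      using dA0 by (intro ln_mono) auto
    also have "\<dots> = ln (cmod (Determinant.det W)) + real (n - card S) * ln (real n / \<kappa>)"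
      using dW0 \<kappa> n by (simp add: ln_mult ln_realpow)
    finally show ?thesis .
  qed
  have l0: "0 \<le> real (n - card S) * ln (real n * H / \<epsilon>)" "0 \<le> real (n - card S) * ln (real n / \<kappa>)" using HE nk by auto
  have t0: "0 \<le> real n * T / \<epsilon>" using T0 \<epsilon> by simp
  have two: "2 * real n * T / \<epsilon> = 2 * (real n * T / \<epsilon>)" by simp
  have arith: "\<bar>w - u\<bar> \<le> 2 * x + (l1 + l2)"
    if "w \<le> u + (x + l1)" "u \<le> a + 2 * x" "a \<le> w + l2" "0 \<le> x" "0 \<le> l1" "0 \<le> l2" for w u x l1 l2 a :: real
    using that by linarith
  show "\<bar>ln (cmod (Determinant.det W)) - ln (cmod (Determinant.det N'))\<bar>
      \<le> 2 * real n * T / \<epsilon> + real (n - card S) * (ln (real n * H / \<epsilon>) + ln (real n / \<kappa>))"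
    unfolding distrib_left two by (rule arith[OF 1 2[unfolded two] 3 t0 l0])
qed

section \<open>Schur's inequality\<close>

lemma isometry_sum:
  fixes q :: "nat \<Rightarrow> nat \<Rightarrow> complex"
  assumes q: "\<And>k l. k < n \<Longrightarrow> l < n \<Longrightarrow> (\<Sum>i<n. q i l * cnj (q i k)) = (if k = l then 1 else 0)"
  shows "(\<Sum>i<n. (cmod (\<Sum>k<n. q i k * b k))\<^sup>2) = (\<Sum>k<n. (cmod (b k))\<^sup>2)"
proof -
  have "(of_real (\<Sum>i<n. (cmod (\<Sum>k<n. q i k * b k))\<^sup>2) :: complex)
    = (\<Sum>i<n. (\<Sum>l<n. q i l * b l) * cnj (\<Sum>k<n. q i k * b k))"
    unfolding of_real_sum by (intro sum.cong refl) (rule complex_norm_square)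
  also have "\<dots> = (\<Sum>i<n. \<Sum>l<n. \<Sum>k<n. b l * cnj (b k) * (q i l * cnj (q i k)))"
    by (simp add: sum_product mult_ac)
  also have "\<dots> = (\<Sum>l<n. \<Sum>k<n. b l * cnj (b k) * (\<Sum>i<n. q i l * cnj (q i k)))"
    by (subst sum.swap, rule sum.cong[OF refl], subst sum.swap) (simp add: sum_distrib_left)
  also have "\<dots> = (\<Sum>l<n. \<Sum>k<n. if k = l then b l * cnj (b k) else 0)"
    using q by (intro sum.cong) auto
  also have "\<dots> = (\<Sum>l<n. b l * cnj (b l))" by (intro sum.cong) auto
  also have "\<dots> = of_real (\<Sum>k<n. (cmod (b k))\<^sup>2)"
    unfolding of_real_sum by (intro sum.cong refl) (rule complex_norm_square[symmetric])
  finally show ?thesis by (simp only: of_real_eq_iff)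
qed

lemma sum_sq_eigenvalues_le:
  fixes A :: "complex mat"
  assumes "A \<in> carrier_mat n n" and "char_poly A = (\<Prod>e\<leftarrow>es. [:- e, 1:])"
  shows "(\<Sum>e\<leftarrow>es. (cmod e)\<^sup>2) \<le> (\<Sum>i<n. \<Sum>j<n. (cmod (A $$ (i, j)))\<^sup>2)"
  using assms
proof (induction es arbitrary: n A)
  case Nil
  show ?case by (simp add: sum_nonneg)
next
  case (Cons e es n A)
  note A = Cons.prems(1)
  have "poly (char_poly A) e = 0" unfolding Cons.prems(2) by simp
  hence "eigenvalue A e" using eigenvalue_root_char_poly[OF A] by simp
  then obtain v where v: "v \<in> carrier_vec n" "v \<noteq> 0\<^sub>v n" "A *\<^sub>v v = e \<cdot>\<^sub>v v"
    using A by (auto simp: eigenvalue_def eigenvector_def)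
  obtain i1 where i1: "i1 < n" "vec_index v i1 \<noteq> 0"
    using v(1,2) by (metis carrier_vecD eq_vecI index_zero_vec(1) index_zero_vec(2))
  then obtain m where n: "n = Suc m" by (cases n) auto
  define s where "s = (\<Sum>k<n. (cmod (vec_index v k))\<^sup>2)"
  have s: "s > 0"
  proof -
    have "(cmod (vec_index v i1))\<^sup>2 \<le> s" unfolding s_def using i1 by (intro member_le_sum) auto
    thus ?thesis using i1 by (smt (verit) zero_less_norm_iff zero_less_power)
  qed
  define w where "w k = vec_index v k / of_real (sqrt s)" for k
  have w1: "(\<Sum>k<n. w k * cnj (w k)) = 1"
  proof -
    have "w k * cnj (w k) = of_real ((cmod (vec_index v k))\<^sup>2) / of_real s" for k
      using s by (simp add: w_def complex_norm_square[symmetric] of_real_mult[symmetric] del: of_real_mult)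
    hence "(\<Sum>k<n. w k * cnj (w k)) = of_real s / of_real s"
      by (simp add: s_def sum_divide_distrib[symmetric])
    thus ?thesis using s by simp
  qed
  have Aw: "(\<Sum>k<n. A $$ (i, k) * w k) = e * w i" if i: "i < n" for i
  proof -
    have "e * vec_index v i = vec_index (A *\<^sub>v v) i" using v i by simp
    also have "\<dots> = (\<Sum>k\<in>{0..<n}. A $$ (i, k) * vec_index v k)"
      using i v(1) A by (auto simp: scalar_prod_def intro!: sum.cong)
    finally have "e * vec_index v i = (\<Sum>k<n. A $$ (i, k) * vec_index v k)" by (simp add: lessThan_atLeast0)
    hence "e * vec_index v i / of_real (sqrt s) = (\<Sum>k<n. A $$ (i, k) * vec_index v k) / of_real (sqrt s)" by simp
    thus ?thesis by (simp add: w_def sum_divide_distrib)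
  qed
  obtain r where r: "r 0 = w"
    "\<And>i. i \<in> {..<n} - {0} \<Longrightarrow> (\<Sum>k<n. r i k * cnj (r i k)) = 1"
    "\<And>i j. i \<in> {..<n} - {0} \<Longrightarrow> j < n \<Longrightarrow> j \<noteq> i \<Longrightarrow> (\<Sum>k<n. r i k * cnj (r j k)) = 0"
  proof -
    have "{0} \<subseteq> {..<n}" using n by simp
    from orthonormal_completion[OF this, of "\<lambda>_. w"] show ?thesis using that by blast
  qed
  have orth: "(\<Sum>k<n. r i k * cnj (r j k)) = (if i = j then 1 else 0)" if ij: "i < n" "j < n" for i j
  proof (cases "i = 0")
    case False
    thus ?thesis using r(2)[of i] r(3)[of i j] ij by auto
  next
    case True
    show ?thesis
    proof (cases "j = 0")
      case False
      hence "(\<Sum>k<n. r j k * cnj (r 0 k)) = 0" using r(3)[of j 0] ij n by auto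
      hence "cnj (\<Sum>k<n. r j k * cnj (r 0 k)) = 0" by simp
      thus ?thesis using True False by (simp add: mult.commute)
    qed (use True w1 r(1) in simp)
  qed
  define U where "U = mat n n (\<lambda>(k, i). r i k)"
  define V where "V = mat n n (\<lambda>(i, k). cnj (r i k))"
  have U: "U \<in> carrier_mat n n" and V: "V \<in> carrier_mat n n" by (auto simp: U_def V_def)
  have VU: "V * U = 1\<^sub>m n"
  proof (rule eq_matI)
    fix i j assume "i < dim_row (1\<^sub>m n :: complex mat)" "j < dim_col (1\<^sub>m n :: complex mat)"
    hence ij: "i < n" "j < n" by auto
    have "(V * U) $$ (i, j) = (\<Sum>k<n. r j k * cnj (r i k))"
      using ij by (auto simp: U_def V_def scalar_prod_def lessThan_atLeast0 mult.commute intro!: sum.cong)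
    thus "(V * U) $$ (i, j) = (1\<^sub>m n :: complex mat) $$ (i, j)" using orth[OF ij(2,1)] ij by auto
  qed (use U V in auto)
  have UV: "U * V = 1\<^sub>m n" by (rule mat_mult_left_right_inverse[OF V U VU])
  have orth2: "(\<Sum>i<n. r i l * cnj (r i k)) = (if k = l then 1 else 0)" if "k < n" "l < n" for k l
  proof -
    have "(U * V) $$ (l, k) = (\<Sum>i<n. r i l * cnj (r i k))"
      using that by (auto simp: U_def V_def scalar_prod_def lessThan_atLeast0 intro!: sum.cong)
    thus ?thesis using UV that by auto
  qed
  define A' where "A' = V * A * U"
  have A': "A' \<in> carrier_mat n n" using U V A by (simp add: A'_def)
  have AU: "(A * U) $$ (k, j) = (\<Sum>l<n. A $$ (k, l) * r j l)" if "k < n" "j < n" for k j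
    using that A U by (auto simp: U_def scalar_prod_def lessThan_atLeast0 intro!: sum.cong)
  have A'_alt: "A' = V * (A * U)" unfolding A'_def by (rule assoc_mult_mat[OF V A U])
  have A'e: "A' $$ (i, j) = (\<Sum>k<n. cnj (r i k) * (A * U) $$ (k, j))" if "i < n" "j < n" for i j
    unfolding A'_alt using that A U by (auto simp: V_def scalar_prod_def lessThan_atLeast0 intro!: sum.cong)
  have col0: "A' $$ (i, 0) = (if i = 0 then e else 0)" if i: "i < n" for i
  proof -
    have "A' $$ (i, 0) = (\<Sum>k<n. cnj (r i k) * (e * w k))"
      using A'e[OF i, of 0] AU[of _ 0] Aw n r(1) by auto
    also have "\<dots> = e * (\<Sum>k<n. r 0 k * cnj (r i k))" by (simp add: sum_distrib_left r(1) mult_ac)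
    also have "\<dots> = (if i = 0 then e else 0)" using orth[of 0 i] i n by auto
    finally show ?thesis .
  qed
  have "similar_mat A A'"
  proof (rule similar_matI[of _ _ U V n])
    have "U * A' * V = U * V * A * (U * V)"
      unfolding A'_def using U V A by (simp add: assoc_mult_mat[of _ n n _ n _ n])
    thus "A = U * A' * V" using UV A by simp
  qed (use U V A A' UV VU in auto)
  hence cp: "char_poly A' = char_poly A" by (simp add: char_poly_similar)
  define A1 where "A1 = mat 1 1 (\<lambda>_. e)"
  define A2 where "A2 = mat 1 m (\<lambda>(i, j). A' $$ (i, Suc j))"
  define A3 where "A3 = mat m m (\<lambda>(i, j). A' $$ (Suc i, Suc j))"
  have carr: "A1 \<in> carrier_mat 1 1" "A2 \<in> carrier_mat 1 m" "A3 \<in> carrier_mat m m"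
    by (auto simp: A1_def A2_def A3_def)
  have blk: "A' = four_block_mat A1 A2 (0\<^sub>m m 1) A3"
  proof (rule eq_matI)
    fix i j assume "i < dim_row (four_block_mat A1 A2 (0\<^sub>m m 1) A3)" "j < dim_col (four_block_mat A1 A2 (0\<^sub>m m 1) A3)"
    hence "i < n" "j < n" using carr n by auto
    thus "A' $$ (i, j) = four_block_mat A1 A2 (0\<^sub>m m 1) A3 $$ (i, j)"
      using col0[of i] n by (cases i; cases j) (auto simp: A1_def A2_def A3_def)
  qed (use A' carr n in auto)
  have "char_poly A' = char_poly A1 * char_poly A3"
    unfolding blk by (rule char_poly_four_block_zeros_col[OF carr])
  also have "char_poly A1 = [:-e, 1:]"
    by (simp add: A1_def char_poly_defs det_def sign_def)
  finally have "[:-e, 1:] * char_poly A3 = [:-e, 1:] * (\<Prod>e\<leftarrow>es. [:- e, 1:])"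
    using cp Cons.prems(2) by simp
  hence "char_poly A3 = (\<Prod>e\<leftarrow>es. [:- e, 1:])"
    by (metis mult_cancel_left pCons_eq_0_iff zero_neq_one)
  from Cons.IH[OF carr(3) this]
  have IH: "(\<Sum>e\<leftarrow>es. (cmod e)\<^sup>2) \<le> (\<Sum>i<m. \<Sum>j<m. (cmod (A3 $$ (i, j)))\<^sup>2)" .
  have "(\<Sum>e\<leftarrow>(e # es). (cmod e)\<^sup>2) \<le> (cmod e)\<^sup>2 + (\<Sum>i<m. \<Sum>j<m. (cmod (A' $$ (Suc i, Suc j)))\<^sup>2)"
    using IH by (simp add: A3_def)
  also have "\<dots> \<le> (\<Sum>i<n. \<Sum>j<n. (cmod (A' $$ (i, j)))\<^sup>2)"
  proof -
    have "(cmod e)\<^sup>2 \<le> (\<Sum>j<n. (cmod (A' $$ (0, j)))\<^sup>2)"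
      using member_le_sum[of 0 "{..<n}" "\<lambda>j. (cmod (A' $$ (0, j)))\<^sup>2"] col0[of 0] n by simp
    moreover have "(\<Sum>j<m. (cmod (A' $$ (Suc i, Suc j)))\<^sup>2) \<le> (\<Sum>j<n. (cmod (A' $$ (Suc i, j)))\<^sup>2)" for i
      unfolding n sum.lessThan_Suc_shift[of "\<lambda>j. (cmod (A' $$ (Suc i, j)))\<^sup>2" m] by simp
    hence "(\<Sum>i<m. \<Sum>j<m. (cmod (A' $$ (Suc i, Suc j)))\<^sup>2) \<le> (\<Sum>i<m. \<Sum>j<n. (cmod (A' $$ (Suc i, j)))\<^sup>2)"
      by (intro sum_mono)
    moreover have "(\<Sum>i<n. \<Sum>j<n. (cmod (A' $$ (i, j)))\<^sup>2) = (\<Sum>j<n. (cmod (A' $$ (0, j)))\<^sup>2) + (\<Sum>i<m. \<Sum>j<n. (cmod (A' $$ (Suc i, j)))\<^sup>2)"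
      unfolding n by (rule sum.lessThan_Suc_shift)
    ultimately show ?thesis by linarith
  qed
  also have "\<dots> = (\<Sum>j<n. \<Sum>i<n. (cmod (\<Sum>k<n. cnj (r i k) * (A * U) $$ (k, j)))\<^sup>2)"
    by (subst sum.swap) (auto simp: A'e intro!: sum.cong)
  also have "\<dots> = (\<Sum>j<n. \<Sum>k<n. (cmod ((A * U) $$ (k, j)))\<^sup>2)"
  proof (rule sum.cong[OF refl])
    fix j
    show "(\<Sum>i<n. (cmod (\<Sum>k<n. cnj (r i k) * (A * U) $$ (k, j)))\<^sup>2) = (\<Sum>k<n. (cmod ((A * U) $$ (k, j)))\<^sup>2)"
    proof (rule isometry_sum)
      fix k l assume kl: "k < n" "l < n"
      show "(\<Sum>i<n. cnj (r i l) * cnj (cnj (r i k))) = (if k = l then 1 else 0)"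
        using orth2[OF kl(2,1)] by (simp add: mult.commute)
    qed
  qed
  also have "\<dots> = (\<Sum>k<n. \<Sum>j<n. (cmod (\<Sum>l<n. r j l * A $$ (k, l)))\<^sup>2)"
    by (subst sum.swap) (auto simp: AU mult.commute intro!: sum.cong)
  also have "\<dots> = (\<Sum>k<n. \<Sum>l<n. (cmod (A $$ (k, l)))\<^sup>2)"
    by (rule sum.cong[OF refl]) (rule isometry_sum[OF orth2])
  finally show ?case .
qed

section \<open>The logarithmic kernel\<close>

lemma mean_value_ln_norm_one_plus:
  fixes a :: complex
  assumes a: "cmod a < 1"
  shows "((\<lambda>t. ln (cmod (1 + a * cis (2 * pi * t)))) has_integral 0) {0..1}"
proof -
  define f where "f = (\<lambda>u. Ln (1 + a * u))"
  have re: "Re (1 + a * u) > 0" if "cmod u \<le> 1" for u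
  proof -
    have "cmod (a * u) \<le> cmod a * 1" using that unfolding norm_mult by (intro mult_left_mono) auto
    hence "cmod (a * u) < 1" using a by simp
    thus ?thesis using abs_Re_le_cmod[of "a * u"] by simp
  qed
  have "f holomorphic_on cball 0 1" unfolding f_def
  proof (intro holomorphic_intros)
    fix u :: complex assume "u \<in> cball 0 1"
    thus "1 + a * u \<notin> \<real>\<^sub>\<le>\<^sub>0" using re[of u] by (auto simp: complex_nonpos_Reals_iff)
  qed
  from Cauchy_integral_circlepath_simple[OF this, of 0]
  have "((\<lambda>x. f (circlepath 0 1 x) / (circlepath 0 1 x - 0) * vector_derivative (circlepath 0 1) (at x within {0..1}))
      has_integral (2 * of_real pi * \<i> * f 0)) {0..1}"
    by (simp add: has_contour_integral_def)
  also have "?this \<longleftrightarrow> ((\<lambda>x. (2 * of_real pi * \<i>) * f (cis (2 * pi * x))) has_integral (2 * of_real pi * \<i> * f 0)) {0..1}"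
  proof (rule has_integral_cong)
    fix x :: real assume x: "x \<in> {0..1}"
    have c: "exp (2 * of_real pi * \<i> * of_real x) = cis (2 * pi * x)" by (simp add: cis_conv_exp mult_ac)
    show "f (circlepath 0 1 x) / (circlepath 0 1 x - 0) * vector_derivative (circlepath 0 1) (at x within {0..1})
       = (2 * of_real pi * \<i>) * f (cis (2 * pi * x))"
      using x by (simp add: vector_derivative_circlepath01 c) (simp add: circlepath c)
  qed
  finally have int: "((\<lambda>x. (2 * of_real pi * \<i>) * f (cis (2 * pi * x))) has_integral (2 * of_real pi * \<i> * f 0)) {0..1}" .
  define c :: complex where "c = 2 * of_real pi * \<i>"
  have "c \<noteq> 0" by (simp add: c_def)
  hence c: "inverse c * (c * x) = x" for x by (simp add: mult.assoc[symmetric])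
  have "((\<lambda>x. Re (inverse c * (c * f (cis (2 * pi * x))))) has_integral Re (inverse c * (c * f 0))) {0..1}"
    by (rule has_integral_Re[OF has_integral_mult_right[OF int[folded c_def]]])
  hence "((\<lambda>x. Re (f (cis (2 * pi * x)))) has_integral 0) {0..1}"
    unfolding c by (simp add: f_def)
  also have "?this \<longleftrightarrow> ?thesis"
  proof (rule has_integral_cong)
    fix x :: real
    have "1 + a * cis (2 * pi * x) \<noteq> 0" using re[of "cis (2 * pi * x)"] by (auto simp: complex_eq_iff)
    thus "Re (f (cis (2 * pi * x))) = ln (cmod (1 + a * cis (2 * pi * x)))" by (simp add: f_def Re_Ln)
  qed
  finally show ?thesis .
qed

lemma mean_value_ln_norm_circle:
  fixes u :: complex
  assumes r: "r > 0" and u: "cmod u \<noteq> r"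
  shows "((\<lambda>t. ln (cmod (u + of_real r * cis (2 * pi * t)))) has_integral ln (max (cmod u) r)) {0..1}"
proof (cases "cmod u > r")
  case True
  define a where "a = of_real r / u"
  have u0: "u \<noteq> 0" using True r by auto
  have a: "cmod a < 1" using True r u0 by (simp add: a_def norm_divide divide_less_eq)
  have "((\<lambda>t. ln (cmod (1 + a * cis (2 * pi * t))) + ln (cmod u)) has_integral (0 + (1 - 0) *\<^sub>R ln (cmod u))) {0..1}"
    using has_integral_const_real[of "ln (cmod u)" 0 1]
    by (intro has_integral_add mean_value_ln_norm_one_plus[OF a]) simp
  also have "?this \<longleftrightarrow> ?thesis"
  proof -
    have "ln (cmod (1 + a * cis (2 * pi * t))) + ln (cmod u) = ln (cmod (u + of_real r * cis (2 * pi * t)))" for t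
    proof -
      have nz: "1 + a * cis (2 * pi * t) \<noteq> 0"
      proof
        assume "1 + a * cis (2 * pi * t) = 0"
        hence "a * cis (2 * pi * t) = -1" by (simp add: add_eq_0_iff)
        hence "cmod (a * cis (2 * pi * t)) = 1" by simp
        thus False using a by (simp add: norm_mult)
      qed
      have "u + of_real r * cis (2 * pi * t) = u * (1 + a * cis (2 * pi * t))"
        using u0 by (simp add: a_def field_simps)
      thus ?thesis using nz u0 by (simp add: norm_mult ln_mult)
    qed
    thus ?thesis using True by (simp add: max_def)
  qed
  finally show ?thesis .
next
  case False
  hence lt: "cmod u < r" using u by simp
  define a where "a = cnj u / of_real r"
  have a: "cmod a < 1" using lt r by (simp add: a_def norm_divide)
  have "((\<lambda>t. ln (cmod (1 + a * cis (2 * pi * t))) + ln r) has_integral (0 + (1 - 0) *\<^sub>R ln r)) {0..1}"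
    using has_integral_const_real[of "ln r" 0 1]
    by (intro has_integral_add mean_value_ln_norm_one_plus[OF a]) simp
  also have "?this \<longleftrightarrow> ?thesis"
  proof -
    have "ln (cmod (1 + a * cis (2 * pi * t))) + ln r = ln (cmod (u + of_real r * cis (2 * pi * t)))" for t
    proof -
      have nz: "1 + a * cis (2 * pi * t) \<noteq> 0"
      proof
        assume "1 + a * cis (2 * pi * t) = 0"
        hence "a * cis (2 * pi * t) = -1" by (simp add: add_eq_0_iff)
        hence "cmod (a * cis (2 * pi * t)) = 1" by simp
        thus False using a by (simp add: norm_mult)
      qed
      have "cnj (u + of_real r * cis (2 * pi * t)) = cnj u + of_real r * cis (- (2 * pi * t))"
        by (simp add: cis_cnj)
      also have "\<dots> = cis (- (2 * pi * t)) * of_real r * (1 + a * cis (2 * pi * t))"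
        using r by (simp add: a_def field_simps cis_mult)
      finally have "cmod (u + of_real r * cis (2 * pi * t)) = r * cmod (1 + a * cis (2 * pi * t))"
        using r by (metis complex_mod_cnj norm_mult norm_cis mult_1 norm_of_real abs_of_pos)
      thus ?thesis using nz r by (simp add: ln_mult)
    qed
    thus ?thesis using lt by (simp add: max_def)
  qed
  finally show ?thesis .
qed

definition unit_interval :: "real measure" where
  "unit_interval = restrict_space lborel {0..1}"

lemma prob_space_unit_interval: "prob_space unit_interval"
  by (rule prob_spaceI) (simp add: unit_interval_def emeasure_restrict_space space_restrict_space)

lemma measurable_unit_interval: "f \<in> borel_measurable borel \<Longrightarrow> f \<in> borel_measurable unit_interval"
  unfolding unit_interval_def by (rule measurable_restrict_space1) simp

lemma integral_unit_interval:
  fixes f :: "real \<Rightarrow> real"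
  assumes f: "continuous_on {0..1} f" and I: "(f has_integral I) {0..1}"
  shows "(\<integral>t. f t \<partial>unit_interval) = I"
proof -
  have "set_integrable lborel {0..1} f"
    by (rule borel_integrable_atLeastAtMost'[OF f])
  hence "(LINT t : {0..1} | lborel. f t) = integral {0..1} f"
    by (rule set_borel_integral_eq_integral)
  thus ?thesis using I unfolding unit_interval_def
    by (simp add: integral_restrict_space set_lebesgue_integral_def integral_unique)
qed

lemma nn_integral_inverse_sqrt_finite:
  "(\<integral>\<^sup>+x. ennreal (16 * \<bar>x\<bar> powr (-1/2)) * indicator {-1..1} x \<partial>lborel) < \<infinity>"
proof -
  define h where "h x = ennreal (indicator {0..1} x * (16 * x powr (-1/2)))" for x :: real
  have [measurable]: "h \<in> borel_measurable borel" unfolding h_def by measurable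
  have "((\<lambda>x. 16 * x powr (-1/2)) has_integral (16 * (1 powr (-1/2 + 1) / (-1/2 + 1)))) {0..1::real}"
    by (intro has_integral_mult_right has_integral_powr_from_0) auto
  hence "(\<integral>\<^sup>+x. h x \<partial>lborel) = ennreal (16 * (1 powr (-1/2 + 1) / (-1/2 + 1)))"
    unfolding h_def by (intro nn_integral_has_integral_lebesgue) auto
  hence fin: "(\<integral>\<^sup>+x. h x \<partial>lborel) < \<infinity>" by simp
  have "(\<integral>\<^sup>+x. h x \<partial>lborel) = (\<integral>\<^sup>+x. h (- x) \<partial>lborel)"
    using nn_integral_real_affine[of h "-1" 0] by simp
  hence "(\<integral>\<^sup>+x. h x + h (- x) \<partial>lborel) < \<infinity>"
    using fin by (subst nn_integral_add) auto
  moreover have "(\<integral>\<^sup>+x. ennreal (16 * \<bar>x\<bar> powr (-1/2)) * indicator {-1..1} x \<partial>lborel) \<le> (\<integral>\<^sup>+x. h x + h (- x) \<partial>lborel)"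
    by (rule nn_integral_mono) (auto simp: h_def indicator_def)
  ultimately show ?thesis by (rule order_le_less_trans[rotated])
qed

lemma ln_sq_le_powr:
  fixes x :: real
  assumes "0 < x" "x \<le> 1"
  shows "(ln x)\<^sup>2 \<le> 16 * x powr (-1/2)"
proof -
  have "ln (x powr (-1/4)) \<le> x powr (-1/4)"
    using assms ln_bound[of "x powr (-1/4)"] by simp
  hence "- ln x \<le> 4 * x powr (-1/4)" using assms by (simp add: ln_powr)
  moreover have "0 \<le> - ln x" using assms by simp
  ultimately have "(- ln x)\<^sup>2 \<le> (4 * x powr (-1/4))\<^sup>2" by (intro power_mono) auto
  also have "\<dots> = 16 * (x powr (-1/4) * x powr (-1/4))" by (simp add: power2_eq_square)
  also have "x powr (-1/4) * x powr (-1/4) = x powr (-1/2)" using assms by (simp add: powr_add[symmetric])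
  finally show ?thesis by simp
qed

lemma ln_norm_sq_le:
  assumes "Re u \<noteq> 0"
  shows "(ln (cmod u))\<^sup>2 \<le> (cmod u)\<^sup>2 + (if \<bar>Re u\<bar> \<le> 1 then 16 * \<bar>Re u\<bar> powr (-1/2) else 0)"
proof (cases "cmod u \<ge> 1")
  case True
  hence "ln (cmod u) \<le> cmod u" "0 \<le> ln (cmod u)" by (auto intro!: ln_bound)
  hence "(ln (cmod u))\<^sup>2 \<le> (cmod u)\<^sup>2" by (intro power_mono) auto
  thus ?thesis by (smt (verit) powr_ge_zero)
next
  case False
  have re: "0 < \<bar>Re u\<bar>" "\<bar>Re u\<bar> \<le> cmod u" using assms abs_Re_le_cmod by auto
  hence "ln \<bar>Re u\<bar> \<le> ln (cmod u)" by (intro ln_mono) auto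
  moreover have "0 < cmod u" using re by linarith
  hence "ln (cmod u) \<le> 0" using False by simp
  ultimately have "(- ln (cmod u))\<^sup>2 \<le> (- ln \<bar>Re u\<bar>)\<^sup>2" by (intro power_mono) auto
  also have "\<dots> \<le> 16 * \<bar>Re u\<bar> powr (-1/2)" using ln_sq_le_powr[of "\<bar>Re u\<bar>"] re False by simp
  finally show ?thesis using re False by (simp add: add_increasing)
qed

lemma AE_lborel_Re_neq: "AE z in lborel. Re z \<noteq> (c::real)"
proof -
  have "{z::complex. z \<bullet> 1 = c} \<in> null_sets lebesgue"
    using negligible_standard_hyperplane[of "1::complex" c]
    by (simp add: negligible_iff_null_sets Basis_complex_def)
  hence "AE z in lebesgue. z \<notin> {z::complex. z \<bullet> 1 = c}" by (rule AE_not_in)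
  hence "AE z in lebesgue. Re z \<noteq> (c::real)" by eventually_elim (simp add: inner_complex_def)
  thus ?thesis by (simp add: AE_completion_iff)
qed

lemma nn_integral_ln_norm_sq:
  fixes R :: real
  assumes R: "R \<ge> 0"
  shows "\<exists>C\<ge>0. \<forall>w. (\<integral>\<^sup>+z\<in>cball 0 R. ennreal ((ln (cmod (z - w)))\<^sup>2) \<partial>lborel) \<le> ennreal (C * (1 + (cmod w)\<^sup>2))"
proof -
  define K0 where "K0 = (\<integral>\<^sup>+x. ennreal (16 * \<bar>x\<bar> powr (-1/2)) * indicator {-1..1} x \<partial>lborel)"
  have K0: "K0 < \<infinity>" unfolding K0_def by (rule nn_integral_inverse_sqrt_finite)
  define k0 where "k0 = enn2real K0"
  have k0: "K0 = ennreal k0" "k0 \<ge> 0" using K0 by (auto simp: k0_def)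
  define v where "v = measure lborel (cball (0::complex) R)"
  have v: "emeasure lborel (cball (0::complex) R) = ennreal v" "v \<ge> 0"
    using emeasure_bounded_finite[of "cball (0::complex) R"]
    by (auto simp: v_def emeasure_eq_ennreal_measure)
  define C where "C = 2 * v * (1 + R\<^sup>2) + 2 * R * k0"
  have C: "C \<ge> 0" using v k0 R by (simp add: C_def)
  have "(\<integral>\<^sup>+z\<in>cball 0 R. ennreal ((ln (cmod (z - w)))\<^sup>2) \<partial>lborel) \<le> ennreal (C * (1 + (cmod w)\<^sup>2))" for w
  proof -
    define f1 where "f1 x = ennreal (16 * \<bar>x - Re w\<bar> powr (-1/2)) * indicator {Re w - 1..Re w + 1} x" for x
    define f2 where "f2 y = (indicator {-R..R} y :: ennreal)" for y :: real
    have [measurable]: "f1 \<in> borel_measurable borel" "f2 \<in> borel_measurable borel"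
      unfolding f1_def f2_def by measurable
    have f1: "(\<integral>\<^sup>+x. f1 x \<partial>lborel) = K0"
      by (subst nn_integral_real_affine[of f1 1 "Re w"])
        (auto simp: f1_def K0_def indicator_def intro!: nn_integral_cong)
    have prod: "(\<integral>\<^sup>+z. f1 (Re z) * f2 (Im z) \<partial>lborel) = K0 * ennreal (2 * R)"
    proof -
      define f where "f b = (if b = 1 then f1 else f2)" for b :: complex
      have "(\<integral>\<^sup>+z. (\<Prod>b\<in>Basis. f b (z \<bullet> b)) \<partial>lborel) = (\<Prod>b\<in>Basis. (\<integral>\<^sup>+x. f b x \<partial>lborel))"
        by (rule nn_integral_lborel_prod) (auto simp: f_def)
      moreover have "(\<Prod>b\<in>Basis. f b (z \<bullet> b)) = f1 (Re z) * f2 (Im z)" for z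
        by (simp add: Basis_complex_def f_def inner_complex_def)
      moreover have "(\<integral>\<^sup>+x. f2 x \<partial>lborel) = ennreal (2 * R)" using R by (simp add: f2_def)
      moreover have "(\<Prod>b\<in>Basis. (\<integral>\<^sup>+x. f b x \<partial>lborel)) = (\<integral>\<^sup>+x. f1 x \<partial>lborel) * (\<integral>\<^sup>+x. f2 x \<partial>lborel)"
        by (simp add: Basis_complex_def f_def)
      ultimately show ?thesis using f1 by simp
    qed
    define A where "A = 2 * (R\<^sup>2 + (cmod w)\<^sup>2)"
    have A: "A \<ge> 0" by (simp add: A_def)
    have "(\<integral>\<^sup>+z\<in>cball 0 R. ennreal ((ln (cmod (z - w)))\<^sup>2) \<partial>lborel)
      \<le> (\<integral>\<^sup>+z. ennreal A * indicator (cball 0 R) z + f1 (Re z) * f2 (Im z) \<partial>lborel)"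
    proof (rule nn_integral_mono_AE)
      show "AE z in lborel. ennreal ((ln (cmod (z - w)))\<^sup>2) * indicator (cball 0 R) z
         \<le> ennreal A * indicator (cball 0 R) z + f1 (Re z) * f2 (Im z)"
        using AE_lborel_Re_neq[of "Re w"]
      proof eventually_elim
        case (elim z)
        show ?case
        proof (cases "z \<in> cball 0 R")
          case True
          hence z: "cmod z \<le> R" by simp
          have im: "\<bar>Im z\<bar> \<le> R" using abs_Im_le_cmod[of z] z by linarith
          hence f2z: "f2 (Im z) = 1" by (auto simp: f2_def indicator_def)
          have "cmod (z - w) \<le> R + cmod w" using norm_triangle_ineq4[of z w] z by linarith
          hence "(cmod (z - w))\<^sup>2 \<le> (R + cmod w)\<^sup>2" by (intro power_mono) auto
          also have "\<dots> \<le> 2 * (R\<^sup>2 + (cmod w)\<^sup>2)" using zero_le_power2[of "R - cmod w"] by (simp add: power2_eq_square algebra_simps)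
          finally have a: "(cmod (z - w))\<^sup>2 \<le> 2 * (R\<^sup>2 + (cmod w)\<^sup>2)" .
          define B where "B = (if \<bar>Re z - Re w\<bar> \<le> 1 then 16 * \<bar>Re z - Re w\<bar> powr (-1/2) else 0)"
          have B: "B \<ge> 0" by (simp add: B_def)
          have "Re (z - w) \<noteq> 0" using elim by simp
          from ln_norm_sq_le[OF this, unfolded minus_complex.sel] have "(ln (cmod (z - w)))\<^sup>2 \<le> A + B"
            using a unfolding B_def A_def by linarith
          hence "ennreal ((ln (cmod (z - w)))\<^sup>2) \<le> ennreal A + ennreal B"
            using A B by (simp add: ennreal_plus[symmetric] ennreal_leI del: ennreal_plus)
          also have "ennreal B = f1 (Re z)"
            by (auto simp: f1_def B_def indicator_def abs_le_iff)
          finally show ?thesis using True f2z by simp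
        qed simp
      qed
    qed
    also have "\<dots> = ennreal A * ennreal v + ennreal k0 * ennreal (2 * R)"
    proof (subst nn_integral_add)
      have cb[measurable]: "cball (0::complex) R \<in> sets borel" by simp
      show "(\<lambda>z. ennreal A * indicator (cball (0::complex) R) z) \<in> borel_measurable lborel"
        "(\<lambda>z. f1 (Re z) * f2 (Im z)) \<in> borel_measurable lborel" by measurable
      show "(\<integral>\<^sup>+z\<in>cball (0::complex) R. ennreal A \<partial>lborel) + (\<integral>\<^sup>+z. f1 (Re z) * f2 (Im z) \<partial>lborel) =
        ennreal A * ennreal v + ennreal k0 * ennreal (2 * R)"
        by (subst nn_integral_cmult_indicator) (simp_all only: cb sets_lborel prod v(1) k0(1))
    qed
    also have "\<dots> = ennreal (A * v + k0 * (2 * R))"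
      using v k0 R A by (simp add: ennreal_mult ennreal_plus)
    also have "\<dots> \<le> ennreal (C * (1 + (cmod w)\<^sup>2))"
    proof (rule ennreal_leI)
      have "0 \<le> R\<^sup>2 * (cmod w)\<^sup>2 * v" "0 \<le> k0 * (2 * R) * (cmod w)\<^sup>2" using v k0 R by auto
      thus "A * v + k0 * (2 * R) \<le> C * (1 + (cmod w)\<^sup>2)"
        using v by (simp add: C_def A_def algebra_simps)
    qed
    finally show ?thesis .
  qed
  thus ?thesis using C by blast
qed

definition log_kernel :: "real \<Rightarrow> complex \<Rightarrow> real" where
  "log_kernel r u = ln (max (cmod u) r) - ln (cmod u)"

definition circle_avg_diff :: "(complex \<Rightarrow> complex) \<Rightarrow> real \<Rightarrow> complex \<Rightarrow> complex" where
  "circle_avg_diff g r z = (\<integral>t. g (z - of_real r * cis (2 * pi * t)) \<partial>unit_interval) - g z"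

lemma nn_integral_abs_ln_norm:
  fixes R :: real
  assumes R: "R \<ge> 0"
  shows "\<exists>C\<ge>0. \<forall>w. (\<integral>\<^sup>+z\<in>cball 0 R. ennreal \<bar>ln (cmod (z - w))\<bar> \<partial>lborel) \<le> ennreal (C * (1 + (cmod w)\<^sup>2))"
proof -
  obtain C where C: "C \<ge> 0" "\<And>w. (\<integral>\<^sup>+z\<in>cball 0 R. ennreal ((ln (cmod (z - w)))\<^sup>2) \<partial>lborel) \<le> ennreal (C * (1 + (cmod w)\<^sup>2))"
    using nn_integral_ln_norm_sq[OF R] by blast
  define v where "v = measure lborel (cball (0::complex) R)"
  have v: "emeasure lborel (cball (0::complex) R) = ennreal v" "v \<ge> 0"
    using emeasure_bounded_finite[of "cball (0::complex) R"]
    by (auto simp: v_def emeasure_eq_ennreal_measure)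
  have cb[measurable]: "cball (0::complex) R \<in> sets borel" by simp
  have "(\<integral>\<^sup>+z\<in>cball 0 R. ennreal \<bar>ln (cmod (z - w))\<bar> \<partial>lborel) \<le> ennreal ((C + v) * (1 + (cmod w)\<^sup>2))" for w
  proof -
    have "(\<integral>\<^sup>+z\<in>cball 0 R. ennreal \<bar>ln (cmod (z - w))\<bar> \<partial>lborel)
      \<le> (\<integral>\<^sup>+z. ennreal ((ln (cmod (z - w)))\<^sup>2) * indicator (cball 0 R) z + indicator (cball 0 R) z \<partial>lborel)"
    proof (rule nn_integral_mono)
      fix z
      have "\<bar>x\<bar> \<le> x\<^sup>2 + 1" for x :: real
        using zero_le_power2[of "\<bar>x\<bar> - 1"] by (simp add: power2_eq_square algebra_simps abs_if split: if_splits)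
      hence "ennreal \<bar>ln (cmod (z - w))\<bar> \<le> ennreal ((ln (cmod (z - w)))\<^sup>2 + 1)" by (rule ennreal_leI)
      thus "ennreal \<bar>ln (cmod (z - w))\<bar> * indicator (cball 0 R) z \<le> ennreal ((ln (cmod (z - w)))\<^sup>2) * indicator (cball 0 R) z + indicator (cball 0 R) z"
        by (auto simp: indicator_def ennreal_plus)
    qed
    also have "\<dots> = (\<integral>\<^sup>+z\<in>cball 0 R. ennreal ((ln (cmod (z - w)))\<^sup>2) \<partial>lborel) + ennreal v"
      using cb v by (subst nn_integral_add) auto
    also have "\<dots> \<le> ennreal (C * (1 + (cmod w)\<^sup>2)) + ennreal v"
      by (intro add_right_mono C)
    also have "\<dots> = ennreal (C * (1 + (cmod w)\<^sup>2) + v)" using C v by (simp add: ennreal_plus)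
    also have "\<dots> \<le> ennreal ((C + v) * (1 + (cmod w)\<^sup>2))"
      using v by (intro ennreal_leI) (simp add: algebra_simps)
    finally show ?thesis .
  qed
  thus ?thesis using C(1) v(2) by (intro exI[of _ "C + v"]) auto
qed

lemma integral_lborel_shift:
  fixes f :: "complex \<Rightarrow> 'b::{banach, second_countable_topology}"
  shows "f \<in> borel_measurable borel \<Longrightarrow> (\<integral>z. f z \<partial>lborel) = (\<integral>z. f (z + c) \<partial>lborel)"
  by (subst lborel_distr_plus[of c, symmetric], subst integral_distr) (auto simp: add.commute)

lemma integrable_lborel_shift:
  fixes f :: "complex \<Rightarrow> 'b::{banach, second_countable_topology}"
  assumes "f \<in> borel_measurable borel" "integrable lborel f"
  shows "integrable lborel (\<lambda>z. f (z + c))"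
proof -
  have "integrable (distr lborel borel ((+) c)) f" using assms(2) by (simp add: lborel_distr_plus)
  thus ?thesis using assms(1) by (subst (asm) integrable_distr_eq) (auto simp: add.commute)
qed

lemma AE_lborel_norm_neq: "AE z in lborel. cmod (z - w) \<noteq> r"
proof -
  have "AE z in lebesgue. z \<notin> sphere w r"
    by (rule AE_not_in) (use negligible_sphere in \<open>simp add: negligible_iff_null_sets\<close>)
  hence "AE z in lebesgue. cmod (z - w) \<noteq> r" by eventually_elim (simp add: dist_norm norm_minus_commute)
  thus ?thesis by (simp add: AE_completion_iff)
qed

lemma log_kernel_measurable[measurable]: "log_kernel r \<in> borel_measurable borel"
  unfolding log_kernel_def[abs_def] by measurable

lemma log_kernel_outside: "r \<le> cmod u \<Longrightarrow> log_kernel r u = 0"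
  by (simp add: log_kernel_def max_def)

lemma log_kernel_nonneg: "u \<noteq> 0 \<Longrightarrow> 0 \<le> log_kernel r u"
  by (auto simp: log_kernel_def max_def intro!: ln_mono)

lemma integrable_log_kernel:
  assumes r: "r > 0"
  shows "integrable lborel (log_kernel r)"
proof (rule integrableI_bounded)
  obtain C where C: "C \<ge> 0" "\<And>w. (\<integral>\<^sup>+z\<in>cball 0 r. ennreal \<bar>ln (cmod (z - w))\<bar> \<partial>lborel) \<le> ennreal (C * (1 + (cmod w)\<^sup>2))"
    using nn_integral_abs_ln_norm[of r] r by auto
  have cb[measurable]: "cball (0::complex) r \<in> sets borel" by simp
  have fin: "emeasure lborel (cball (0::complex) r) < \<infinity>" by (rule emeasure_bounded_finite) simp
  have "(\<integral>\<^sup>+u. ennreal (norm (log_kernel r u)) \<partial>lborel)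
    \<le> (\<integral>\<^sup>+z. ennreal \<bar>ln r\<bar> * indicator (cball 0 r) z + ennreal \<bar>ln (cmod (z - 0))\<bar> * indicator (cball 0 r) z \<partial>lborel)"
  proof (rule nn_integral_mono)
    fix u :: complex
    show "ennreal (norm (log_kernel r u)) \<le> ennreal \<bar>ln r\<bar> * indicator (cball 0 r) u + ennreal \<bar>ln (cmod (u - 0))\<bar> * indicator (cball 0 r) u"
    proof (cases "cmod u \<le> r")
      case True
      have "\<bar>ln r - ln (cmod u)\<bar> \<le> \<bar>ln r\<bar> + \<bar>ln (cmod u)\<bar>" by linarith
      thus ?thesis using True by (simp add: log_kernel_def max_def ennreal_plus[symmetric] ennreal_leI del: ennreal_plus)
    qed (simp add: log_kernel_outside)
  qed
  also have "\<dots> = ennreal \<bar>ln r\<bar> * emeasure lborel (cball (0::complex) r) + (\<integral>\<^sup>+z\<in>cball 0 r. ennreal \<bar>ln (cmod (z - 0))\<bar> \<partial>lborel)"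
    using cb by (subst nn_integral_add) (auto simp: nn_integral_cmult_indicator)
  also have "\<dots> < \<infinity>"
    using fin order_le_less_trans[OF C(2)[of 0]] by (simp add: ennreal_mult_less_top)
  finally show "(\<integral>\<^sup>+u. ennreal (norm (log_kernel r u)) \<partial>lborel) < \<infinity>" .
qed simp

lemma log_kernel_integral_pos:
  assumes r: "r > 0"
  shows "0 < (\<integral>u. log_kernel r u \<partial>lborel)"
proof -
  have cb[measurable]: "cball (0::complex) (r / 2) \<in> sets borel" by simp
  have fin: "emeasure lborel (cball (0::complex) (r / 2)) < \<infinity>" by (rule emeasure_bounded_finite) simp
  have "0 < ln 2 * measure lborel (cball (0::complex) (r / 2))"
    using content_cball_pos[of "r / 2" "0::complex"] r by simp
  also have "\<dots> = (\<integral>u. ln 2 * indicator (cball (0::complex) (r / 2)) u \<partial>lborel)" using fin by simp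
  also have "\<dots> \<le> (\<integral>u. log_kernel r u \<partial>lborel)"
  proof (rule integral_mono_AE[OF _ integrable_log_kernel[OF r]])
    show "integrable lborel (\<lambda>u::complex. ln 2 * indicat_real (cball 0 (r / 2)) u)"
      by (intro integrable_mult_right integrable_real_indicator) (use fin cb in auto)
    show "AE u in lborel. ln 2 * indicator (cball 0 (r / 2)) u \<le> log_kernel r u"
      using AE_lborel_singleton[of "0::complex"]
    proof eventually_elim
      case (elim u)
      show ?case
      proof (cases "u \<in> cball 0 (r / 2)")
        case True
        hence u: "cmod u \<le> r / 2" "cmod u > 0" using elim by auto
        hence "ln (2 * cmod u) \<le> ln r" by (intro ln_mono) auto
        hence "ln 2 + ln (cmod u) \<le> ln r" using u by (simp add: ln_mult)
        moreover have "cmod u \<le> r" using u by linarith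
        ultimately show ?thesis using True by (simp add: log_kernel_def max_def)
      qed (use log_kernel_nonneg[OF elim] in simp)
    qed
  qed
  finally show ?thesis .
qed

lemma compact_support_bounded:
  fixes g :: "complex \<Rightarrow> complex"
  assumes g: "continuous_on UNIV g" and supp: "\<And>z. R < cmod z \<Longrightarrow> g z = 0"
  shows "\<exists>B\<ge>0. \<forall>z. cmod (g z) \<le> B"
proof -
  have "compact (g ` cball 0 R)"
    by (intro compact_continuous_image continuous_on_subset[OF g]) auto
  hence "bounded (g ` cball 0 R)" by (rule compact_imp_bounded)
  then obtain B where B: "\<And>z. z \<in> cball 0 R \<Longrightarrow> cmod (g z) \<le> B"
    unfolding bounded_iff by (metis imageI)
  have "cmod (g z) \<le> max B 0" for z
    using B[of z] supp[of z] by (cases "cmod z \<le> R") (auto simp del: norm_le_zero_iff)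
  thus ?thesis by (intro exI[of _ "max B 0"]) auto
qed

lemma log_kernel_convolution_close:
  fixes g :: "complex \<Rightarrow> complex"
  assumes g: "continuous_on UNIV g" and supp: "\<And>z. R < cmod z \<Longrightarrow> g z = 0" and r: "r > 0"
    and \<eta>: "\<And>z. cmod (z - w) \<le> r \<Longrightarrow> cmod (g z - g w) \<le> \<eta>"
  shows "integrable lborel (\<lambda>z. g z * of_real (log_kernel r (z - w)))"
    and "cmod ((\<integral>z. g z * of_real (log_kernel r (z - w)) \<partial>lborel) - of_real (\<integral>u. log_kernel r u \<partial>lborel) * g w)
      \<le> (\<integral>u. log_kernel r u \<partial>lborel) * \<eta>"
proof -
  have [measurable]: "g \<in> borel_measurable borel" using g by (rule borel_measurable_continuous_onI)
  obtain B where B: "B \<ge> 0" "\<And>z. cmod (g z) \<le> B" using compact_support_bounded[OF g supp] by blast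
  have ik: "integrable lborel (\<lambda>z. log_kernel r (z - w))"
    using integrable_lborel_shift[OF _ integrable_log_kernel[OF r], of "-w"] by simp
  have kap: "(\<integral>z. log_kernel r (z - w) \<partial>lborel) = (\<integral>u. log_kernel r u \<partial>lborel)"
    using integral_lborel_shift[of "log_kernel r" "-w"] by simp
  have ik': "integrable lborel (\<lambda>z. c * of_real (log_kernel r (z - w)) :: complex)" for c
    using ik by (intro integrable_mult_right integrable_of_real)
  show ig: "integrable lborel (\<lambda>z. g z * of_real (log_kernel r (z - w)))"
  proof (rule Bochner_Integration.integrable_bound[OF integrable_mult_right[OF ik, of B]])
    show "AE z in lborel. norm (g z * complex_of_real (log_kernel r (z - w))) \<le> norm (B * log_kernel r (z - w))"
      using B by (intro AE_I2) (auto simp: norm_mult abs_mult intro!: mult_right_mono)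
  qed simp
  have "(\<integral>z. g z * of_real (log_kernel r (z - w)) \<partial>lborel) - of_real (\<integral>u. log_kernel r u \<partial>lborel) * g w
    = (\<integral>z. g z * of_real (log_kernel r (z - w)) \<partial>lborel) - (\<integral>z. g w * of_real (log_kernel r (z - w)) \<partial>lborel)"
    by (simp add: kap mult.commute)
  also have "\<dots> = (\<integral>z. (g z - g w) * of_real (log_kernel r (z - w)) \<partial>lborel)"
    using ig ik' by (subst Bochner_Integration.integral_diff[symmetric]) (auto simp: left_diff_distrib)
  also have "cmod \<dots> \<le> (\<integral>z. cmod ((g z - g w) * of_real (log_kernel r (z - w))) \<partial>lborel)"
    by (rule integral_norm_bound)
  also have "\<dots> \<le> (\<integral>z. \<eta> * log_kernel r (z - w) \<partial>lborel)"
  proof (rule integral_mono_AE)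
    show "integrable lborel (\<lambda>z. cmod ((g z - g w) * of_real (log_kernel r (z - w))))"
      using Bochner_Integration.integrable_diff[OF ig ik'[of "g w"]] by (simp add: left_diff_distrib)
    show "integrable lborel (\<lambda>z. \<eta> * log_kernel r (z - w))" using ik by simp
    show "AE z in lborel. norm ((g z - g w) * complex_of_real (log_kernel r (z - w))) \<le> \<eta> * log_kernel r (z - w)"
      using AE_lborel_singleton[of w]
    proof eventually_elim
      case (elim z)
      hence k: "0 \<le> log_kernel r (z - w)" by (intro log_kernel_nonneg) auto
      show ?case
      proof (cases "cmod (z - w) \<le> r")
        case True
        thus ?thesis using \<eta>[OF True] k by (simp add: norm_mult mult_right_mono)
      qed (simp add: log_kernel_outside)
    qed
  qed
  also have "\<dots> = (\<integral>u. log_kernel r u \<partial>lborel) * \<eta>" by (simp add: kap mult.commute)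
  finally show "cmod ((\<integral>z. g z * of_real (log_kernel r (z - w)) \<partial>lborel) - of_real (\<integral>u. log_kernel r u \<partial>lborel) * g w)
      \<le> (\<integral>u. log_kernel r u \<partial>lborel) * \<eta>" .
qed

lemma circle_avg_diff_properties:
  fixes g :: "complex \<Rightarrow> complex"
  assumes g: "continuous_on UNIV g" and supp: "\<And>z. R < cmod z \<Longrightarrow> g z = 0" and r: "r > 0"
    and B: "\<And>z. cmod (g z) \<le> B"
  shows "circle_avg_diff g r \<in> borel_measurable borel"
    and "R + r < cmod z \<Longrightarrow> circle_avg_diff g r z = 0"
    and "cmod (circle_avg_diff g r z) \<le> 2 * B"
proof -
  interpret U: prob_space unit_interval by (rule prob_space_unit_interval)
  have [measurable]: "g \<in> borel_measurable borel" using g by (rule borel_measurable_continuous_onI)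
  have [measurable]: "(\<lambda>t. cis (2 * pi * t)) \<in> borel_measurable unit_interval"
    by (intro measurable_unit_interval borel_measurable_continuous_onI continuous_intros)
  show "circle_avg_diff g r \<in> borel_measurable borel"
    unfolding circle_avg_diff_def[abs_def] by measurable
  have "cmod (z - of_real r * cis (2 * pi * t)) \<ge> cmod z - r" for t
    using norm_triangle_ineq2[of z "of_real r * cis (2 * pi * t)"] r by (simp add: norm_mult)
  note far = this
  {
    assume z: "R + r < cmod z"
    have "R < cmod (z - of_real r * cis (2 * pi * t))" for t using far[of t] z by linarith
    hence "g (z - of_real r * cis (2 * pi * t)) = 0" for t by (rule supp)
    moreover have "g z = 0" using z r by (intro supp) linarith
    ultimately show "circle_avg_diff g r z = 0" by (simp add: circle_avg_diff_def)
  }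
  have "cmod (\<integral>t. g (z - of_real r * cis (2 * pi * t)) \<partial>unit_interval) \<le> (\<integral>t. B \<partial>unit_interval)"
    by (rule order_trans[OF integral_norm_bound integral_mono]) (auto intro!: U.integrable_const_bound[of _ B] B)
  hence "cmod (\<integral>t. g (z - of_real r * cis (2 * pi * t)) \<partial>unit_interval) \<le> B" by (simp add: U.prob_space)
  thus "cmod (circle_avg_diff g r z) \<le> 2 * B"
    unfolding circle_avg_diff_def using norm_triangle_ineq4 B[of z] by (smt (verit))
qed

lemma circle_avg_diff_ln:
  fixes g :: "complex \<Rightarrow> complex"
  assumes g: "continuous_on UNIV g" and supp: "\<And>z. R < cmod z \<Longrightarrow> g z = 0" and R: "R \<ge> 0" and r: "r > 0"
  shows "integrable lborel (\<lambda>z. circle_avg_diff g r z * of_real (ln (cmod (z - w))))"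
    and "(\<integral>z. circle_avg_diff g r z * of_real (ln (cmod (z - w))) \<partial>lborel) = (\<integral>z. g z * of_real (log_kernel r (z - w)) \<partial>lborel)"
proof -
  interpret U: prob_space unit_interval by (rule prob_space_unit_interval)
  interpret P: pair_sigma_finite unit_interval "lborel :: complex measure" ..
  have [measurable]: "g \<in> borel_measurable borel" using g by (rule borel_measurable_continuous_onI)
  define e where "e t = of_real r * cis (2 * pi * t)" for t
  have em[measurable]: "e \<in> borel_measurable unit_interval"
    unfolding e_def by (intro measurable_unit_interval borel_measurable_continuous_onI continuous_intros)
  have ne: "cmod (e t) = r" for t using r by (simp add: e_def norm_mult)
  obtain B where B: "B \<ge> 0" "\<And>z. cmod (g z) \<le> B" using compact_support_bounded[OF g supp] by blast
  obtain C where C: "C \<ge> 0" "\<And>w. (\<integral>\<^sup>+z\<in>cball 0 (R + r). ennreal \<bar>ln (cmod (z - w))\<bar> \<partial>lborel) \<le> ennreal (C * (1 + (cmod w)\<^sup>2))"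
    using nn_integral_abs_ln_norm[of "R + r"] R r by auto
  define D where "D = B * (C * (1 + (cmod w + r)\<^sup>2))"
  have bnd: "(\<integral>\<^sup>+z. ennreal (cmod (g (z - a) * of_real (ln (cmod (z - b))))) \<partial>lborel) \<le> ennreal D"
    if a: "cmod a \<le> r" and b: "cmod b \<le> cmod w + r" for a b
  proof -
    have "(\<integral>\<^sup>+z. ennreal (cmod (g (z - a) * of_real (ln (cmod (z - b))))) \<partial>lborel)
      \<le> (\<integral>\<^sup>+z. ennreal B * (ennreal \<bar>ln (cmod (z - b))\<bar> * indicator (cball 0 (R + r)) z) \<partial>lborel)"
    proof (rule nn_integral_mono)
      fix z
      show "ennreal (cmod (g (z - a) * of_real (ln (cmod (z - b))))) \<le> ennreal B * (ennreal \<bar>ln (cmod (z - b))\<bar> * indicator (cball 0 (R + r)) z)"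
      proof (cases "cmod z \<le> R + r")
        case True
        have "cmod (g (z - a)) * \<bar>ln (cmod (z - b))\<bar> \<le> B * \<bar>ln (cmod (z - b))\<bar>"
          by (intro mult_right_mono B) auto
        thus ?thesis using True B by (simp add: norm_mult ennreal_mult[symmetric] ennreal_leI)
      next
        case False
        hence "R < cmod (z - a)" using norm_triangle_ineq2[of z a] a by linarith
        thus ?thesis by (simp add: supp)
      qed
    qed
    also have "\<dots> = ennreal B * (\<integral>\<^sup>+z\<in>cball 0 (R + r). ennreal \<bar>ln (cmod (z - b))\<bar> \<partial>lborel)"
    proof (rule nn_integral_cmult)
      have [measurable]: "cball (0::complex) (R + r) \<in> sets borel" by simp
      show "(\<lambda>z. ennreal \<bar>ln (cmod (z - b))\<bar> * indicator (cball 0 (R + r)) z) \<in> borel_measurable lborel"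
        by measurable
    qed
    also have "\<dots> \<le> ennreal B * ennreal (C * (1 + (cmod b)\<^sup>2))" by (intro mult_left_mono C) auto
    also have "\<dots> = ennreal (B * (C * (1 + (cmod b)\<^sup>2)))" using B C by (simp add: ennreal_mult)
    also have "\<dots> \<le> ennreal D" unfolding D_def
      using b B C by (intro ennreal_leI mult_left_mono add_left_mono power_mono) auto
    finally show ?thesis .
  qed
  define h1 where "h1 t z = g (z - e t) * of_real (ln (cmod (z - w)))" for t z
  define h2 where "h2 t z = g z * of_real (ln (cmod (z + e t - w)))" for t z
  have [measurable]: "case_prod h1 \<in> borel_measurable (unit_interval \<Otimes>\<^sub>M lborel)"
    "case_prod h2 \<in> borel_measurable (unit_interval \<Otimes>\<^sub>M lborel)"
    unfolding h1_def h2_def by measurable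
  have i1: "integrable (unit_interval \<Otimes>\<^sub>M lborel) (case_prod h1)"
  proof (rule integrableI_bounded)
    have "(\<integral>\<^sup>+x. ennreal (norm (case_prod h1 x)) \<partial>(unit_interval \<Otimes>\<^sub>M lborel)) = (\<integral>\<^sup>+t. \<integral>\<^sup>+z. ennreal (norm (h1 t z)) \<partial>lborel \<partial>unit_interval)"
      by (subst lborel.nn_integral_fst[symmetric]) auto
    also have "\<dots> \<le> (\<integral>\<^sup>+t. ennreal D \<partial>unit_interval)"
      unfolding h1_def using r by (intro nn_integral_mono bnd) (auto simp: ne)
    also have "\<dots> < \<infinity>" by (simp add: U.emeasure_space_1)
    finally show "(\<integral>\<^sup>+x. ennreal (norm (case_prod h1 x)) \<partial>(unit_interval \<Otimes>\<^sub>M lborel)) < \<infinity>" .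
  qed simp
  have i2: "integrable (unit_interval \<Otimes>\<^sub>M lborel) (case_prod h2)"
  proof (rule integrableI_bounded)
    have "(\<integral>\<^sup>+x. ennreal (norm (case_prod h2 x)) \<partial>(unit_interval \<Otimes>\<^sub>M lborel)) = (\<integral>\<^sup>+t. \<integral>\<^sup>+z. ennreal (norm (h2 t z)) \<partial>lborel \<partial>unit_interval)"
      by (subst lborel.nn_integral_fst[symmetric]) auto
    also have "\<dots> \<le> (\<integral>\<^sup>+t. ennreal D \<partial>unit_interval)"
    proof (rule nn_integral_mono)
      fix t
      have "cmod (w - e t) \<le> cmod w + r" using norm_triangle_ineq4[of w "e t"] by (simp add: ne)
      from bnd[OF _ this, of 0] show "(\<integral>\<^sup>+z. ennreal (norm (h2 t z)) \<partial>lborel) \<le> ennreal D"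
        unfolding h2_def using r by (simp add: diff_diff_eq2)
    qed
    also have "\<dots> < \<infinity>" by (simp add: U.emeasure_space_1)
    finally show "(\<integral>\<^sup>+x. ennreal (norm (case_prod h2 x)) \<partial>(unit_interval \<Otimes>\<^sub>M lborel)) < \<infinity>" .
  qed simp
  have il: "integrable lborel (\<lambda>z. g z * of_real (ln (cmod (z - w))))"
  proof (rule integrableI_bounded)
    show "(\<integral>\<^sup>+z. ennreal (norm (g z * of_real (ln (cmod (z - w))))) \<partial>lborel) < \<infinity>"
      using bnd[of 0 w] r by (auto simp: less_top[symmetric] top_unique)
  qed simp
  have split: "circle_avg_diff g r z * of_real (ln (cmod (z - w))) = (\<integral>t. h1 t z \<partial>unit_interval) - g z * of_real (ln (cmod (z - w)))" for z
    by (simp add: circle_avg_diff_def h1_def e_def left_diff_distrib)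
  have ih1: "integrable lborel (\<lambda>z. \<integral>t. h1 t z \<partial>unit_interval)"
    by (rule P.integrable_snd[OF i1])
  show "integrable lborel (\<lambda>z. circle_avg_diff g r z * of_real (ln (cmod (z - w))))"
    unfolding split by (intro Bochner_Integration.integrable_diff ih1 il)
  have "(\<integral>z. (\<integral>t. h1 t z \<partial>unit_interval) \<partial>lborel) = (\<integral>t. (\<integral>z. h1 t z \<partial>lborel) \<partial>unit_interval)"
    by (rule P.Fubini_integral[OF i1])
  also have "\<dots> = (\<integral>t. (\<integral>z. h2 t z \<partial>lborel) \<partial>unit_interval)"
  proof (rule Bochner_Integration.integral_cong[OF refl])
    fix t
    have "(\<lambda>z. h1 t z) \<in> borel_measurable borel" unfolding h1_def by measurable
    from integral_lborel_shift[OF this, of "e t"]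
    show "(\<integral>z. h1 t z \<partial>lborel) = (\<integral>z. h2 t z \<partial>lborel)" by (simp add: h1_def h2_def)
  qed
  also have "\<dots> = (\<integral>z. (\<integral>t. h2 t z \<partial>unit_interval) \<partial>lborel)"
    by (rule P.Fubini_integral[OF i2, symmetric])
  also have "\<dots> = (\<integral>z. g z * of_real (ln (max (cmod (z - w)) r)) \<partial>lborel)"
  proof (rule Bochner_Integration.integral_cong_AE)
    show "(\<lambda>z. \<integral>t. h2 t z \<partial>unit_interval) \<in> borel_measurable lborel"
      by (rule borel_measurable_integrable[OF P.integrable_snd[OF i2]])
    show "AE z in lborel. (\<integral>t. h2 t z \<partial>unit_interval) = g z * of_real (ln (max (cmod (z - w)) r))"
      using AE_lborel_norm_neq[of w r]
    proof eventually_elim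
      case (elim z)
      have nz: "z - w + of_real r * cis (2 * pi * t) \<noteq> 0" for t
      proof
        assume "z - w + of_real r * cis (2 * pi * t) = 0"
        hence "cmod (z - w) = cmod (- (of_real r * cis (2 * pi * t)))" by (metis add_eq_0_iff2)
        thus False using elim r by (simp add: norm_mult)
      qed
      have "(\<integral>t. ln (cmod (z - w + of_real r * cis (2 * pi * t))) \<partial>unit_interval) = ln (max (cmod (z - w)) r)"
        by (rule integral_unit_interval[OF _ mean_value_ln_norm_circle[OF r elim]])
          (use nz in \<open>auto intro!: continuous_intros\<close>)
      moreover have "(\<integral>t. h2 t z \<partial>unit_interval) = g z * of_real (\<integral>t. ln (cmod (z - w + of_real r * cis (2 * pi * t))) \<partial>unit_interval)"
        by (simp add: h2_def e_def algebra_simps)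
      ultimately show ?case by simp
    qed
  qed simp
  finally have eq: "(\<integral>z. (\<integral>t. h1 t z \<partial>unit_interval) \<partial>lborel) = (\<integral>z. g z * of_real (ln (max (cmod (z - w)) r)) \<partial>lborel)" .
  have ik: "integrable lborel (\<lambda>z. g z * of_real (log_kernel r (z - w)))"
  proof (rule log_kernel_convolution_close(1)[OF g supp r])
    show "cmod (g z - g w) \<le> 2 * B" for z
      using norm_triangle_ineq4[of "g z" "g w"] B(2)[of z] B(2)[of w] by linarith
  qed
  have dec: "g z * of_real (ln (max (cmod (z - w)) r)) = g z * of_real (log_kernel r (z - w)) + g z * of_real (ln (cmod (z - w)))" for z
    by (simp add: log_kernel_def algebra_simps)
  show "(\<integral>z. circle_avg_diff g r z * of_real (ln (cmod (z - w))) \<partial>lborel) = (\<integral>z. g z * of_real (log_kernel r (z - w)) \<partial>lborel)"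
    unfolding split using ih1 il eq ik
    by (simp add: Bochner_Integration.integral_diff dec Bochner_Integration.integral_add)
qed

section \<open>The replacement principle\<close>

text \<open>With \<open>ln 0 = 0\<close> the potential vanishes, instead of being minus infinity, at the points where the determinant vanishes.\<close>

definition log_potential :: "nat \<Rightarrow> complex mat \<Rightarrow> complex \<Rightarrow> real" where
  "log_potential n A z = ln (cmod (Determinant.det (A + z \<cdot>\<^sub>m 1\<^sub>m n))) / n"

lemma obtain_eigenvalues:
  fixes A :: "complex mat"
  assumes A: "A \<in> carrier_mat n n"
  obtains es where "length es = n" "mset es = proots (char_poly A)" "char_poly A = (\<Prod>e\<leftarrow>es. [:- e, 1:])"
proof -
  obtain es where es: "mset es = proots (char_poly A)" using ex_mset by blast
  have monic: "degree (char_poly A) = n" "lead_coeff (char_poly A) = 1"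
    using degree_monic_char_poly[OF A] by auto
  have "length es = n" using monic(1) es by (metis size_mset size_proots_complex)
  moreover have "char_poly A = (\<Prod>e\<leftarrow>es. [:- e, 1:])"
    using complex_poly_decompose_multiset[of "char_poly A"] monic(2)
    by (simp add: es[symmetric] prod_mset_prod_list[symmetric])
  ultimately show ?thesis using es that by blast
qed

lemma norm_det_shift:
  fixes A :: "complex mat"
  assumes A: "A \<in> carrier_mat n n" and es: "char_poly A = (\<Prod>e\<leftarrow>es. [:- e, 1:])" "length es = n"
  shows "cmod (Determinant.det (A + z \<cdot>\<^sub>m 1\<^sub>m n)) = (\<Prod>i<n. cmod (z + es ! i))"
proof -
  have "- char_matrix A (- z) = (-1) \<cdot>\<^sub>m (A + z \<cdot>\<^sub>m 1\<^sub>m n)"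
    using A by (intro eq_matI) (auto simp: char_matrix_def)
  hence "poly (char_poly A) (- z) = (-1) ^ n * Determinant.det (A + z \<cdot>\<^sub>m 1\<^sub>m n)"
    using A by (simp add: char_poly_matrix[OF A])
  hence "cmod (Determinant.det (A + z \<cdot>\<^sub>m 1\<^sub>m n)) = cmod (poly (char_poly A) (- z))"
    by (simp add: norm_mult norm_power)
  also have "poly (char_poly A) (- z) = (\<Prod>i<n. - z - es ! i)"
    unfolding es(1) by (simp add: poly_prod_list prod.list_conv_set_nth es(2) lessThan_atLeast0 poly_prod)
      (intro prod.cong, auto)
  also have "cmod \<dots> = (\<Prod>i<n. cmod (z + es ! i))"
  proof -
    have "cmod (- z - es ! i) = cmod (z + es ! i)" for i
    proof -
      have "- z - es ! i = - (z + es ! i)" by simp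
      thus ?thesis by (simp only: norm_minus_cancel)
    qed
    thus ?thesis by (simp add: prod_norm[symmetric])
  qed
  finally show ?thesis .
qed

lemma log_potential_AE:
  fixes A :: "complex mat"
  assumes A: "A \<in> carrier_mat n n" and es: "char_poly A = (\<Prod>e\<leftarrow>es. [:- e, 1:])" "length es = n"
  shows "AE z in lborel. log_potential n A z = (\<Sum>i<n. ln (cmod (z - (- es ! i)))) / n"
proof -
  have "AE z in lborel. \<forall>i\<in>{..<n}. z \<noteq> - es ! i"
    by (rule AE_finite_allI) (auto intro: AE_lborel_singleton)
  thus ?thesis
  proof eventually_elim
    case (elim z)
    have "ln (\<Prod>i<n. cmod (z + es ! i)) = (\<Sum>i<n. ln (cmod (z + es ! i)))"
      using elim by (intro ln_prod) (auto simp: add_eq_0_iff2)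
    thus ?case unfolding log_potential_def norm_det_shift[OF A es] by simp
  qed
qed

lemma continuous_det_measurable:
  fixes F :: "'x \<Rightarrow> complex mat"
  assumes F: "\<And>x. x \<in> space N \<Longrightarrow> F x \<in> carrier_mat n n"
    and m: "\<And>i j. i < n \<Longrightarrow> j < n \<Longrightarrow> (\<lambda>x. F x $$ (i, j)) \<in> borel_measurable N"
  shows "(\<lambda>x. Determinant.det (F x)) \<in> borel_measurable N"
proof -
  have "(\<lambda>x. \<Sum>p\<in>{p. p permutes {0..<n}}. signof p * (\<Prod>i = 0..<n. F x $$ (i, p i))) \<in> borel_measurable N"
    by (intro borel_measurable_sum borel_measurable_times borel_measurable_const borel_measurable_prod m)
      (auto dest: permutes_in_image)
  thus ?thesis by (rule measurable_cong[THEN iffD1, rotated]) (simp add: det_def'[OF F])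
qed

lemma log_potential_measurable:
  assumes A: "\<And>\<omega>. \<omega> \<in> space M \<Longrightarrow> A \<omega> \<in> carrier_mat n n"
    and m: "\<And>i j. i < n \<Longrightarrow> j < n \<Longrightarrow> (\<lambda>\<omega>. A \<omega> $$ (i, j)) \<in> borel_measurable M"
  shows "(\<lambda>x. log_potential n (A (fst x)) (snd x)) \<in> borel_measurable (M \<Otimes>\<^sub>M lborel)"
proof -
  have "(\<lambda>x. Determinant.det (A (fst x) + snd x \<cdot>\<^sub>m 1\<^sub>m n)) \<in> borel_measurable (M \<Otimes>\<^sub>M lborel)"
  proof (rule continuous_det_measurable)
    fix x assume "x \<in> space (M \<Otimes>\<^sub>M (lborel :: complex measure))"
    thus "A (fst x) + snd x \<cdot>\<^sub>m 1\<^sub>m n \<in> carrier_mat n n" using A by (auto simp: space_pair_measure)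
  next
    fix i j assume ij: "i < n" "j < n"
    have [measurable]: "(\<lambda>\<omega>. A \<omega> $$ (i, j)) \<in> borel_measurable M" by (rule m[OF ij])
    have "(\<lambda>x. A (fst x) $$ (i, j) + (if i = j then snd x else 0)) \<in> borel_measurable (M \<Otimes>\<^sub>M lborel)" by measurable
    thus "(\<lambda>x. (A (fst x) + snd x \<cdot>\<^sub>m 1\<^sub>m n) $$ (i, j)) \<in> borel_measurable (M \<Otimes>\<^sub>M lborel)"
      by (rule measurable_cong[THEN iffD1, rotated]) (use ij in auto)
  qed
  thus ?thesis unfolding log_potential_def by measurable
qed

lemma log_potential_measurable':
  assumes A: "A \<in> carrier_mat n n"
  shows "log_potential n A \<in> borel_measurable lborel"
proof -
  have "(\<lambda>z. Determinant.det (A + z \<cdot>\<^sub>m 1\<^sub>m n)) \<in> borel_measurable lborel"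
  proof (rule continuous_det_measurable)
    fix i j assume ij: "i < n" "j < n"
    have "(\<lambda>z. A $$ (i, j) + (if i = j then z else 0)) \<in> borel_measurable lborel" by measurable
    thus "(\<lambda>z. (A + z \<cdot>\<^sub>m 1\<^sub>m n) $$ (i, j)) \<in> borel_measurable lborel"
      by (rule measurable_cong[THEN iffD1, rotated]) (use ij A in auto)
  qed (use A in auto)
  thus ?thesis unfolding log_potential_def[abs_def] by measurable
qed

lemma nn_integral_log_potential_sq:
  fixes R :: real
  assumes R: "R \<ge> 0"
  shows "\<exists>C\<ge>0. \<forall>n>0. \<forall>A\<in>carrier_mat n n.
    (\<integral>\<^sup>+z\<in>cball 0 R. ennreal ((log_potential n A z)\<^sup>2) \<partial>lborel)
      \<le> ennreal (C * (1 + (\<Sum>i<n. \<Sum>j<n. (cmod (A $$ (i, j)))\<^sup>2) / n))"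
proof -
  obtain C where C: "C \<ge> 0" "\<And>w. (\<integral>\<^sup>+z\<in>cball 0 R. ennreal ((ln (cmod (z - w)))\<^sup>2) \<partial>lborel) \<le> ennreal (C * (1 + (cmod w)\<^sup>2))"
    using nn_integral_ln_norm_sq[OF R] by blast
  have cb[measurable]: "cball (0::complex) R \<in> sets borel" by simp
  have "(\<integral>\<^sup>+z\<in>cball 0 R. ennreal ((log_potential n A z)\<^sup>2) \<partial>lborel)
      \<le> ennreal (C * (1 + (\<Sum>i<n. \<Sum>j<n. (cmod (A $$ (i, j)))\<^sup>2) / n))"
    if n: "n > 0" and A: "A \<in> carrier_mat n n" for n A
  proof -
    obtain es where es: "length es = n" "char_poly A = (\<Prod>e\<leftarrow>es. [:- e, 1:])"
      using obtain_eigenvalues[OF A] by blast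
    have "(\<integral>\<^sup>+z\<in>cball 0 R. ennreal ((log_potential n A z)\<^sup>2) \<partial>lborel)
      \<le> (\<integral>\<^sup>+z. (\<Sum>i<n. ennreal (1 / n) * (ennreal ((ln (cmod (z - (- es ! i))))\<^sup>2) * indicator (cball 0 R) z)) \<partial>lborel)"
    proof (rule nn_integral_mono_AE)
      show "AE z in lborel. ennreal ((log_potential n A z)\<^sup>2) * indicator (cball 0 R) z
        \<le> (\<Sum>i<n. ennreal (1 / n) * (ennreal ((ln (cmod (z - (- es ! i))))\<^sup>2) * indicator (cball 0 R) z))"
        using log_potential_AE[OF A es(2,1)]
      proof eventually_elim
        case (elim z)
        let ?l = "\<lambda>i. ln (cmod (z - (- es ! i)))"
        have "(\<Sum>i<n. ?l i)\<^sup>2 \<le> real n * (\<Sum>i<n. (?l i)\<^sup>2)"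
          using Cauchy_Schwarz_ineq_sum[of "\<lambda>_. 1" ?l "{..<n}"] by simp
        hence "(log_potential n A z)\<^sup>2 \<le> (\<Sum>i<n. (1 / n) * (?l i)\<^sup>2)"
          unfolding elim using n by (simp add: power_divide sum_divide_distrib[symmetric] field_simps power2_eq_square)
        hence "ennreal ((log_potential n A z)\<^sup>2) \<le> ennreal (\<Sum>i<n. (1 / n) * (?l i)\<^sup>2)" by (rule ennreal_leI)
        also have "\<dots> = (\<Sum>i<n. ennreal (1 / n) * ennreal ((?l i)\<^sup>2))"
          by (simp add: sum_ennreal[symmetric] ennreal_mult'[symmetric] del: sum_ennreal)
        finally show ?case by (cases "z \<in> cball 0 R") auto
      qed
    qed
    also have "\<dots> = (\<Sum>i<n. ennreal (1 / n) * (\<integral>\<^sup>+z\<in>cball 0 R. ennreal ((ln (cmod (z - (- es ! i))))\<^sup>2) \<partial>lborel))"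
      by (subst nn_integral_sum) (auto simp: nn_integral_cmult)
    also have "\<dots> \<le> (\<Sum>i<n. ennreal (1 / n) * ennreal (C * (1 + (cmod (- es ! i))\<^sup>2)))"
      by (intro sum_mono mult_left_mono C) auto
    also have "\<dots> = ennreal (\<Sum>i<n. (1 / n) * (C * (1 + (cmod (es ! i))\<^sup>2)))"
      using C by (simp add: ennreal_mult'[symmetric] sum_ennreal)
    also have "\<dots> \<le> ennreal (C * (1 + (\<Sum>i<n. \<Sum>j<n. (cmod (A $$ (i, j)))\<^sup>2) / n))"
    proof (rule ennreal_leI)
      have "(\<Sum>i<n. (cmod (es ! i))\<^sup>2) = (\<Sum>e\<leftarrow>es. (cmod e)\<^sup>2)"
        by (simp add: sum.list_conv_set_nth es(1) lessThan_atLeast0)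
      also have "\<dots> \<le> (\<Sum>i<n. \<Sum>j<n. (cmod (A $$ (i, j)))\<^sup>2)" by (rule sum_sq_eigenvalues_le[OF A es(2)])
      finally have le: "(\<Sum>i<n. (cmod (es ! i))\<^sup>2) \<le> (\<Sum>i<n. \<Sum>j<n. (cmod (A $$ (i, j)))\<^sup>2)" .
      have "(\<Sum>i<n. (1 / n) * (C * (1 + (cmod (es ! i))\<^sup>2))) = C * (1 + (\<Sum>i<n. (cmod (es ! i))\<^sup>2) / n)"
        using n by (simp add: sum_distrib_left[symmetric] sum_divide_distrib[symmetric] sum.distrib field_simps)
      also have "\<dots> \<le> C * (1 + (\<Sum>i<n. \<Sum>j<n. (cmod (A $$ (i, j)))\<^sup>2) / n)"
        using C le by (intro mult_left_mono add_left_mono divide_right_mono) auto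
      finally show "(\<Sum>i<n. (1 / n) * (C * (1 + (cmod (es ! i))\<^sup>2))) \<le> C * (1 + (\<Sum>i<n. \<Sum>j<n. (cmod (A $$ (i, j)))\<^sup>2) / n)" .
    qed
    finally show ?thesis .
  qed
  thus ?thesis using C(1) by blast
qed

lemma esd_integral_approx:
  fixes f :: "complex \<Rightarrow> complex"
  assumes f: "continuous_on UNIV f" and supp: "\<And>z. R < cmod z \<Longrightarrow> f z = 0" and R: "R \<ge> 0" and r: "r > 0"
    and \<eta>: "\<And>u v. cmod (u - v) \<le> r \<Longrightarrow> cmod (f u - f v) \<le> \<eta>"
    and A: "A \<in> carrier_mat n n" and n: "n > 0"
  defines "G \<equiv> circle_avg_diff (\<lambda>z. f (- z)) r" and "\<kappa> \<equiv> (\<integral>u. log_kernel r u \<partial>lborel)"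
  shows "integrable lborel (\<lambda>z. G z * of_real (log_potential n A z))"
    and "cmod ((\<integral>z. G z * of_real (log_potential n A z) \<partial>lborel) - of_real \<kappa> * (\<integral>z. f z \<partial>esd A)) \<le> \<kappa> * \<eta>"
proof -
  obtain es where es: "length es = n" "mset es = proots (char_poly A)" "char_poly A = (\<Prod>e\<leftarrow>es. [:- e, 1:])"
    using obtain_eigenvalues[OF A] by blast
  let ?g = "\<lambda>z. f (- z)"
  have g: "continuous_on UNIV ?g" by (intro continuous_on_compose2[OF f] continuous_intros) auto
  have gs: "\<And>z. R < cmod z \<Longrightarrow> ?g z = 0" using supp by simp
  obtain B where B: "\<And>z. cmod (?g z) \<le> B" using compact_support_bounded[OF g gs] by blast
  have Gm[measurable]: "G \<in> borel_measurable borel"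
    unfolding G_def by (rule circle_avg_diff_properties(1)[OF g gs r B])
  have [measurable]: "log_potential n A \<in> borel_measurable borel" using log_potential_measurable'[OF A] by simp
  let ?l = "\<lambda>i z. G z * of_real (ln (cmod (z - (- es ! i))))"
  have il: "integrable lborel (?l i)" for i
    unfolding G_def by (rule circle_avg_diff_ln(1)[OF g gs R r])
  have isum: "integrable lborel (\<lambda>z. (\<Sum>i<n. ?l i z) / n)"
    by (intro integrable_divide Bochner_Integration.integrable_sum il)
  have AE: "AE z in lborel. (\<Sum>i<n. ?l i z) / n = G z * of_real (log_potential n A z)"
    using log_potential_AE[OF A es(3,1)]
    by eventually_elim (simp add: sum_distrib_left)
  show "integrable lborel (\<lambda>z. G z * of_real (log_potential n A z))"
    using isum by (rule integrable_cong_AE_imp) (use AE in auto)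
  have "(\<integral>z. G z * of_real (log_potential n A z) \<partial>lborel) = (\<integral>z. (\<Sum>i<n. ?l i z) / n \<partial>lborel)"
    by (rule Bochner_Integration.integral_cong_AE) (use AE in auto)
  also have "\<dots> = (\<Sum>i<n. (\<integral>z. ?l i z \<partial>lborel)) / n"
    using il by (simp add: Bochner_Integration.integral_sum)
  finally have 1: "(\<integral>z. G z * of_real (log_potential n A z) \<partial>lborel) = (\<Sum>i<n. (\<integral>z. ?l i z \<partial>lborel)) / n" .
  have fm: "f \<in> borel_measurable borel" using f by (rule borel_measurable_continuous_onI)
  have "(\<integral>z. f z \<partial>esd A) = (\<Sum>z\<in>#mset es. f z) / n"
    using integral_esd[OF A n fm] by (simp add: es(2))
  also have "(\<Sum>z\<in>#mset es. f z) = (\<Sum>i<n. f (es ! i))"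
    by (simp only: sum_mset_sum_list mset_map[symmetric]) (simp add: sum.list_conv_set_nth es(1) lessThan_atLeast0)
  finally have 2: "(\<integral>z. f z \<partial>esd A) = (\<Sum>i<n. f (es ! i)) / n" .
  have "(\<integral>z. G z * of_real (log_potential n A z) \<partial>lborel) - of_real \<kappa> * (\<integral>z. f z \<partial>esd A)
    = (\<Sum>i<n. (\<integral>z. ?l i z \<partial>lborel) - of_real \<kappa> * f (es ! i)) / n"
    unfolding 1 2 by (simp add: sum_subtractf sum_distrib_left diff_divide_distrib)
  also have "cmod \<dots> \<le> (\<Sum>i<n. \<kappa> * \<eta>) / n"
    unfolding norm_divide
  proof (rule frac_le)
    show "cmod (\<Sum>i<n. (\<integral>z. ?l i z \<partial>lborel) - of_real \<kappa> * f (es ! i)) \<le> (\<Sum>i<n. \<kappa> * \<eta>)"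
    proof (rule sum_norm_le)
      fix i
      have "(\<integral>z. ?l i z \<partial>lborel) = (\<integral>z. ?g z * of_real (log_kernel r (z - (- es ! i))) \<partial>lborel)"
        unfolding G_def by (rule circle_avg_diff_ln(2)[OF g gs R r])
      moreover have "cmod ((\<integral>z. ?g z * of_real (log_kernel r (z - (- es ! i))) \<partial>lborel) - of_real \<kappa> * ?g (- es ! i)) \<le> \<kappa> * \<eta>"
        unfolding \<kappa>_def
      proof (rule log_kernel_convolution_close(2)[OF g gs r])
        fix z assume "cmod (z - (- es ! i)) \<le> r"
        hence "cmod (- z - (- (- es ! i))) \<le> r" by (metis minus_diff_commute norm_minus_cancel minus_diff_minus)
        thus "cmod (?g z - ?g (- es ! i)) \<le> \<eta>" by (rule \<eta>)
      qed
      ultimately show "cmod ((\<integral>z. ?l i z \<partial>lborel) - of_real \<kappa> * f (es ! i)) \<le> \<kappa> * \<eta>" by simp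
    qed
    have "0 \<le> \<eta>" using \<eta>[of 0 0] r by simp
    moreover have "0 \<le> \<kappa>" using log_kernel_integral_pos[OF r] by (simp add: \<kappa>_def)
    ultimately show "0 \<le> (\<Sum>i<n. \<kappa> * \<eta>)" by (intro sum_nonneg) auto
  qed (use n in auto)
  also have "\<dots> = \<kappa> * \<eta>" using n by simp
  finally show "cmod ((\<integral>z. G z * of_real (log_potential n A z) \<partial>lborel) - of_real \<kappa> * (\<integral>z. f z \<partial>esd A)) \<le> \<kappa> * \<eta>" .
qed

lemma compact_support_uniform:
  fixes f :: "complex \<Rightarrow> complex"
  assumes f: "continuous_on UNIV f" and supp: "\<And>z. R < cmod z \<Longrightarrow> f z = 0" and \<eta>: "\<eta> > 0"
  shows "\<exists>d>0. \<forall>u v. cmod (u - v) \<le> d \<longrightarrow> cmod (f u - f v) \<le> \<eta>"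
proof -
  have "uniformly_continuous_on (cball 0 (R + 1)) f"
    by (intro compact_uniformly_continuous continuous_on_subset[OF f]) auto
  then obtain d where d: "d > 0" "\<And>u v. u \<in> cball 0 (R + 1) \<Longrightarrow> v \<in> cball 0 (R + 1) \<Longrightarrow> dist v u < d \<Longrightarrow> dist (f v) (f u) < \<eta>"
    using \<eta> unfolding uniformly_continuous_on_def by blast
  define d' where "d' = min (d / 2) 1"
  have "cmod (f u - f v) \<le> \<eta>" if uv: "cmod (u - v) \<le> d'" for u v
  proof (cases "cmod u \<le> R + 1 \<and> cmod v \<le> R + 1")
    case True
    have "dist u v < d" using uv d(1) by (auto simp: dist_norm d'_def min_def split: if_splits)
    thus ?thesis using d(2)[of v u] True by (auto simp: dist_norm)
  next
    case False
    have "\<bar>cmod u - cmod v\<bar> \<le> 1" using uv norm_triangle_ineq3[of u v] by (auto simp: d'_def)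
    hence "R < cmod u" "R < cmod v" using False by auto
    thus ?thesis using supp \<eta> by simp
  qed
  moreover have "d' > 0" using d(1) by (simp add: d'_def)
  ultimately show ?thesis by blast
qed

lemma esd_integral_measurable:
  fixes f :: "complex \<Rightarrow> complex"
  assumes f: "continuous_on UNIV f" and supp: "\<And>z. R < cmod z \<Longrightarrow> f z = 0" and R: "R \<ge> 0"
    and A: "\<And>\<omega>. \<omega> \<in> space M \<Longrightarrow> A \<omega> \<in> carrier_mat n n" and n: "n > 0"
    and m: "\<And>i j. i < n \<Longrightarrow> j < n \<Longrightarrow> (\<lambda>\<omega>. A \<omega> $$ (i, j)) \<in> borel_measurable M"
  shows "(\<lambda>\<omega>. \<integral>z. f z \<partial>esd (A \<omega>)) \<in> borel_measurable M"
proof -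
  define G where "G k = circle_avg_diff (\<lambda>z. f (- z)) (inverse (real (Suc k)))" for k
  define \<kappa> where "\<kappa> k = (\<integral>u. log_kernel (inverse (real (Suc k))) u \<partial>lborel)" for k
  have \<kappa>: "\<kappa> k > 0" for k unfolding \<kappa>_def by (rule log_kernel_integral_pos) simp
  define X where "X k \<omega> = (\<integral>z. G k z * of_real (log_potential n (A \<omega>) z) \<partial>lborel) / of_real (\<kappa> k)" for k \<omega>
  have g: "continuous_on UNIV (\<lambda>z. f (- z))" by (intro continuous_on_compose2[OF f] continuous_intros) auto
  have gs: "\<And>z. R < cmod z \<Longrightarrow> f (- z) = 0" using supp by simp
  obtain B where B: "\<And>z. cmod (f (- z)) \<le> B" using compact_support_bounded[OF g gs] by blast
  have [measurable]: "G k \<in> borel_measurable borel" for k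
    unfolding G_def by (rule circle_avg_diff_properties(1)[OF g gs _ B]) auto
  have lp[measurable]: "(\<lambda>x. log_potential n (A (fst x)) (snd x)) \<in> borel_measurable (M \<Otimes>\<^sub>M lborel)"
    by (rule log_potential_measurable[OF A m])
  have "(\<lambda>x. G k (snd x) * of_real (log_potential n (A (fst x)) (snd x))) \<in> borel_measurable (M \<Otimes>\<^sub>M lborel)" for k
    by measurable
  hence "(\<lambda>\<omega>. \<integral>z. G k z * of_real (log_potential n (A \<omega>) z) \<partial>lborel) \<in> borel_measurable M" for k
    by (intro lborel.borel_measurable_lebesgue_integral) (simp add: case_prod_unfold)
  hence Xm: "X k \<in> borel_measurable M" for k unfolding X_def[abs_def] by measurable
  show ?thesis
  proof (rule borel_measurable_LIMSEQ_metric[OF Xm])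
    fix \<omega> assume \<omega>: "\<omega> \<in> space M"
    show "(\<lambda>k. X k \<omega>) \<longlonglongrightarrow> (\<integral>z. f z \<partial>esd (A \<omega>))"
    proof (rule LIMSEQ_I)
      fix e :: real assume e: "0 < e"
      have "\<exists>d>0. \<forall>u v. cmod (u - v) \<le> d \<longrightarrow> cmod (f u - f v) \<le> e / 2"
        by (rule compact_support_uniform[OF f supp]) (use e in auto)
      then obtain d where d: "d > 0" "\<And>u v. cmod (u - v) \<le> d \<Longrightarrow> cmod (f u - f v) \<le> e / 2"
        by blast
      obtain k0 where k0: "inverse (real (Suc k0)) < d" using reals_Archimedean[OF d(1)] by blast
      have "cmod (X k \<omega> - (\<integral>z. f z \<partial>esd (A \<omega>))) < e" if k: "k \<ge> k0" for k
      proof -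
        have "inverse (real (Suc k)) \<le> inverse (real (Suc k0))" using k by (intro le_imp_inverse_le) auto
        hence r: "inverse (real (Suc k)) \<le> d" using k0 by linarith
        have "cmod ((\<integral>z. G k z * of_real (log_potential n (A \<omega>) z) \<partial>lborel) - of_real (\<kappa> k) * (\<integral>z. f z \<partial>esd (A \<omega>))) \<le> \<kappa> k * (e / 2)"
          unfolding G_def \<kappa>_def
          by (rule esd_integral_approx(2)[OF f supp R _ _ A[OF \<omega>] n]) (use d r in auto)
        moreover have "X k \<omega> - (\<integral>z. f z \<partial>esd (A \<omega>)) = ((\<integral>z. G k z * of_real (log_potential n (A \<omega>) z) \<partial>lborel) - of_real (\<kappa> k) * (\<integral>z. f z \<partial>esd (A \<omega>))) / of_real (\<kappa> k)"
          using \<kappa>[of k] by (simp add: X_def diff_divide_distrib)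
        ultimately have "cmod (X k \<omega> - (\<integral>z. f z \<partial>esd (A \<omega>))) \<le> (\<kappa> k * (e / 2)) / \<kappa> k"
          using \<kappa>[of k] by (simp only: norm_divide norm_of_real abs_of_pos) (rule divide_right_mono, auto)
        also have "\<dots> < e" using \<kappa>[of k] e by simp
        finally show ?thesis .
      qed
      thus "\<exists>no. \<forall>k\<ge>no. norm (X k \<omega> - (\<integral>z. f z \<partial>esd (A \<omega>))) < e" by blast
    qed
  qed
qed

lemma ennreal_tendsto_0I:
  fixes F :: "nat \<Rightarrow> ennreal"
  assumes "\<And>e::real. e > 0 \<Longrightarrow> eventually (\<lambda>n. F n \<le> ennreal e) sequentially"
  shows "F \<longlonglongrightarrow> 0"
proof (rule order_tendstoI)
  fix a :: ennreal assume "0 < a"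
  then obtain e :: real where e: "0 < e" "ennreal e < a"
    by (metis ennreal_0 ennreal_less_iff order_less_imp_le dense ennreal_enn2real less_top order_less_trans top.not_eq_extremum enn2real_positive_iff)
  show "eventually (\<lambda>n. F n < a) sequentially"
    using assms[OF e(1)] by eventually_elim (use e(2) in auto)
qed auto

lemma L1_tendsto_zero:
  fixes P :: "nat \<Rightarrow> 'w measure" and D :: "nat \<Rightarrow> 'w \<times> complex \<Rightarrow> real" and R C :: real
  assumes P: "\<And>n. prob_space (P n)"
    and Dm: "\<And>n. D n \<in> borel_measurable (P n \<Otimes>\<^sub>M lborel)"
    and bound: "eventually (\<lambda>n. (\<integral>\<^sup>+\<omega>. (\<integral>\<^sup>+z\<in>cball 0 R. ennreal ((D n (\<omega>, z))\<^sup>2) \<partial>lborel) \<partial>P n) \<le> ennreal C) sequentially"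
    and C: "C \<ge> 0"
    and conv: "AE z in lborel. \<forall>\<delta>>0. (\<lambda>n. measure (P n) {\<omega>\<in>space (P n). \<delta> \<le> \<bar>D n (\<omega>, z)\<bar>}) \<longlonglongrightarrow> 0"
  shows "(\<lambda>n. \<integral>\<^sup>+\<omega>. (\<integral>\<^sup>+z\<in>cball 0 R. ennreal \<bar>D n (\<omega>, z)\<bar> \<partial>lborel) \<partial>P n) \<longlonglongrightarrow> 0"
proof (rule ennreal_tendsto_0I)
  fix e :: real assume e: "e > 0"
  have cb[measurable]: "cball (0::complex) R \<in> sets borel" by simp
  have fin: "emeasure lborel (cball (0::complex) R) < \<infinity>" by (rule emeasure_bounded_finite) simp
  define T where "T = 2 * (C + 1) / e"
  have T: "T > 0" using C e by (simp add: T_def)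
  have pairm: "pair_sigma_finite (P n) (lborel :: complex measure)" for n
    using P[of n] by (intro pair_sigma_finite.intro lborel.sigma_finite_measure_axioms prob_space_imp_sigma_finite)
  define a where "a n z = (\<integral>\<^sup>+\<omega>. ennreal (min \<bar>D n (\<omega>, z)\<bar> T) \<partial>P n) * indicator (cball 0 R) z" for n z
  have am: "a n \<in> borel_measurable lborel" for n
  proof -
    interpret prob_space "P n" by (rule P)
    note Dm[of n, measurable]
    have "(\<lambda>x. ennreal (min \<bar>D n (snd x, fst x)\<bar> T)) \<in> borel_measurable (lborel \<Otimes>\<^sub>M P n)" by measurable
    hence "(\<lambda>z. \<integral>\<^sup>+\<omega>. ennreal (min \<bar>D n (\<omega>, z)\<bar> T) \<partial>P n) \<in> borel_measurable lborel"
      by (intro borel_measurable_nn_integral) (simp add: case_prod_unfold)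
    thus ?thesis unfolding a_def[abs_def] by (intro borel_measurable_times_ennreal) auto
  qed
  have "(\<lambda>n. \<integral>\<^sup>+z. a n z \<partial>lborel) \<longlonglongrightarrow> (\<integral>\<^sup>+z. 0 \<partial>(lborel :: complex measure))"
  proof (rule nn_integral_dominated_convergence[where w = "\<lambda>z. ennreal T * indicator (cball 0 R) z"])
    fix n
    interpret prob_space "P n" by (rule P)
    show "AE z in lborel. a n z \<le> ennreal T * indicator (cball 0 R) z"
    proof (rule AE_I2)
      fix z
      have "(\<integral>\<^sup>+\<omega>. ennreal (min \<bar>D n (\<omega>, z)\<bar> T) \<partial>P n) \<le> (\<integral>\<^sup>+\<omega>. ennreal T \<partial>P n)"
        by (intro nn_integral_mono ennreal_leI) auto
      thus "a n z \<le> ennreal T * indicator (cball 0 R) z"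
        unfolding a_def by (intro mult_right_mono) (auto simp: emeasure_space_1)
    qed
  next
    show "(\<integral>\<^sup>+z. ennreal T * indicator (cball 0 R) z \<partial>(lborel :: complex measure)) < \<infinity>"
      using fin by (simp add: nn_integral_cmult_indicator ennreal_mult_less_top)
    show "AE z in lborel. (\<lambda>n. a n z) \<longlonglongrightarrow> 0"
      using conv
    proof eventually_elim
      case (elim z)
      show ?case
      proof (rule ennreal_tendsto_0I)
        fix e' :: real assume e': "e' > 0"
        have "(\<lambda>n. measure (P n) {\<omega>\<in>space (P n). e' / 2 \<le> \<bar>D n (\<omega>, z)\<bar>}) \<longlonglongrightarrow> 0"
          by (rule elim[rule_format]) (use e' in simp)
        hence "eventually (\<lambda>n. measure (P n) {\<omega>\<in>space (P n). e' / 2 \<le> \<bar>D n (\<omega>, z)\<bar>} < e' / (2 * T)) sequentially"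
          by (rule order_tendstoD) (use e' T in auto)
        thus "eventually (\<lambda>n. a n z \<le> ennreal e') sequentially"
        proof eventually_elim
          case (elim n)
          interpret prob_space "P n" by (rule P)
          have Dz[measurable]: "(\<lambda>\<omega>. D n (\<omega>, z)) \<in> borel_measurable (P n)"
            by (rule measurable_compose[OF _ Dm]) auto
          let ?E = "{\<omega>\<in>space (P n). e' / 2 \<le> \<bar>D n (\<omega>, z)\<bar>}"
          have E: "?E \<in> sets (P n)" by measurable
          have "(\<integral>\<^sup>+\<omega>. ennreal (min \<bar>D n (\<omega>, z)\<bar> T) \<partial>P n) \<le> (\<integral>\<^sup>+\<omega>. ennreal (e' / 2) + ennreal T * indicator ?E \<omega> \<partial>P n)"
          proof (rule nn_integral_mono)
            fix \<omega> assume \<omega>: "\<omega> \<in> space (P n)"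
            show "ennreal (min \<bar>D n (\<omega>, z)\<bar> T) \<le> ennreal (e' / 2) + ennreal T * indicator ?E \<omega>"
            proof (cases "\<omega> \<in> ?E")
              case True
              have "ennreal (min \<bar>D n (\<omega>, z)\<bar> T) \<le> ennreal T" by (rule ennreal_leI) simp
              thus ?thesis using True by (simp add: add_increasing)
            next
              case False
              hence "ennreal (min \<bar>D n (\<omega>, z)\<bar> T) \<le> ennreal (e' / 2)" using \<omega> by (intro ennreal_leI) auto
              thus ?thesis using False by simp
            qed
          qed
          also have "\<dots> = ennreal (e' / 2) + ennreal T * emeasure (P n) ?E"
            using E by (subst nn_integral_add) (auto simp: nn_integral_cmult_indicator emeasure_space_1)
          also have "\<dots> = ennreal (e' / 2 + T * measure (P n) ?E)"
            using T e' by (simp add: emeasure_eq_measure ennreal_mult ennreal_plus)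
          also have "\<dots> \<le> ennreal e'"
            using elim T by (intro ennreal_leI) (simp add: field_simps)
          finally have "(\<integral>\<^sup>+\<omega>. ennreal (min \<bar>D n (\<omega>, z)\<bar> T) \<partial>P n) * indicator (cball 0 R) z \<le> ennreal e' * 1"
            by (intro mult_mono) (auto simp: indicator_def)
          thus ?case by (simp add: a_def)
        qed
      qed
    qed
  qed (use am in auto)
  hence "(\<lambda>n. \<integral>\<^sup>+z. a n z \<partial>lborel) \<longlonglongrightarrow> 0" by simp
  hence ev: "eventually (\<lambda>n. (\<integral>\<^sup>+z. a n z \<partial>lborel) < ennreal (e / 2)) sequentially"
    by (rule order_tendstoD) (use e in auto)
  show "eventually (\<lambda>n. (\<integral>\<^sup>+\<omega>. (\<integral>\<^sup>+z\<in>cball 0 R. ennreal \<bar>D n (\<omega>, z)\<bar> \<partial>lborel) \<partial>P n) \<le> ennreal e) sequentially"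
    using ev bound
  proof eventually_elim
    case (elim n)
    interpret prob_space "P n" by (rule P)
    interpret PS: pair_sigma_finite "P n" "lborel :: complex measure" by (rule pairm)
    note Dm[of n, measurable]
    let ?m = "\<lambda>\<omega> z. ennreal (min \<bar>D n (\<omega>, z)\<bar> T) * indicator (cball 0 R) z"
    let ?s = "\<lambda>\<omega> z. ennreal (1 / T) * (ennreal ((D n (\<omega>, z))\<^sup>2) * indicator (cball 0 R) z)"
    have mm: "(\<lambda>x. ?m (fst x) (snd x)) \<in> borel_measurable (P n \<Otimes>\<^sub>M lborel)" by measurable
    have sm0: "(\<lambda>x. ennreal ((D n (fst x, snd x))\<^sup>2) * indicator (cball 0 R) (snd x)) \<in> borel_measurable (P n \<Otimes>\<^sub>M lborel)" by measurable
    have sm: "(\<lambda>x. ?s (fst x) (snd x)) \<in> borel_measurable (P n \<Otimes>\<^sub>M lborel)" by measurable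
    have sect: "(\<lambda>z. f (\<omega>, z)) \<in> borel_measurable lborel" if "f \<in> borel_measurable (P n \<Otimes>\<^sub>M lborel)" "\<omega> \<in> space (P n)" for f :: "'w \<times> complex \<Rightarrow> ennreal" and \<omega>
      by (rule measurable_compose[OF _ that(1)]) (use that(2) in auto)
    have "(\<integral>\<^sup>+\<omega>. (\<integral>\<^sup>+z\<in>cball 0 R. ennreal \<bar>D n (\<omega>, z)\<bar> \<partial>lborel) \<partial>P n)
      \<le> (\<integral>\<^sup>+\<omega>. (\<integral>\<^sup>+z. ?m \<omega> z + ?s \<omega> z \<partial>lborel) \<partial>P n)"
    proof (intro nn_integral_mono)
      fix \<omega> z
      have "\<bar>x\<bar> \<le> min \<bar>x\<bar> T + x\<^sup>2 / T" for x
      proof (cases "\<bar>x\<bar> \<le> T")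
        case False
        hence "T * \<bar>x\<bar> \<le> \<bar>x\<bar> * \<bar>x\<bar>" by (intro mult_right_mono) auto
        hence "\<bar>x\<bar> \<le> x\<^sup>2 / T" using T by (simp add: field_simps power2_eq_square)
        thus ?thesis using T by (simp add: min_def)
      qed (use T in auto)
      hence "ennreal \<bar>D n (\<omega>, z)\<bar> \<le> ennreal (min \<bar>D n (\<omega>, z)\<bar> T + (D n (\<omega>, z))\<^sup>2 / T)" by (rule ennreal_leI)
      also have "\<dots> = ennreal (min \<bar>D n (\<omega>, z)\<bar> T) + ennreal (1 / T) * ennreal ((D n (\<omega>, z))\<^sup>2)"
        using T by (simp add: ennreal_plus ennreal_mult'[symmetric])
      finally show "ennreal \<bar>D n (\<omega>, z)\<bar> * indicator (cball 0 R) z \<le> ?m \<omega> z + ?s \<omega> z"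
        by (cases "z \<in> cball 0 R") auto
    qed
    also have "\<dots> = (\<integral>\<^sup>+\<omega>. (\<integral>\<^sup>+z. ?m \<omega> z \<partial>lborel) + (\<integral>\<^sup>+z. ?s \<omega> z \<partial>lborel) \<partial>P n)"
      using sect[OF mm] sect[OF sm] by (intro nn_integral_cong nn_integral_add) auto
    also have "\<dots> = (\<integral>\<^sup>+\<omega>. (\<integral>\<^sup>+z. ?m \<omega> z \<partial>lborel) \<partial>P n) + (\<integral>\<^sup>+\<omega>. (\<integral>\<^sup>+z. ?s \<omega> z \<partial>lborel) \<partial>P n)"
      by (intro nn_integral_add lborel.borel_measurable_nn_integral) (use mm sm in \<open>auto simp: case_prod_unfold\<close>)
    also have "(\<integral>\<^sup>+\<omega>. (\<integral>\<^sup>+z. ?m \<omega> z \<partial>lborel) \<partial>P n) = (\<integral>\<^sup>+z. (\<integral>\<^sup>+\<omega>. ?m \<omega> z \<partial>P n) \<partial>lborel)"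
      using PS.Fubini[OF mm] by simp
    also have "\<dots> = (\<integral>\<^sup>+z. a n z \<partial>lborel)"
      unfolding a_def
    proof (intro nn_integral_cong nn_integral_multc)
      fix z
      have "(\<lambda>\<omega>. D n (\<omega>, z)) \<in> borel_measurable (P n)"
        by (rule measurable_compose[OF _ Dm]) auto
      thus "(\<lambda>\<omega>. ennreal (min \<bar>D n (\<omega>, z)\<bar> T)) \<in> borel_measurable (P n)" by measurable
    qed
    also have "(\<integral>\<^sup>+\<omega>. (\<integral>\<^sup>+z. ?s \<omega> z \<partial>lborel) \<partial>P n) = (\<integral>\<^sup>+\<omega>. ennreal (1 / T) * (\<integral>\<^sup>+z\<in>cball 0 R. ennreal ((D n (\<omega>, z))\<^sup>2) \<partial>lborel) \<partial>P n)"
      using sect[OF sm0] by (intro nn_integral_cong nn_integral_cmult) auto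
    also have "\<dots> = ennreal (1 / T) * (\<integral>\<^sup>+\<omega>. (\<integral>\<^sup>+z\<in>cball 0 R. ennreal ((D n (\<omega>, z))\<^sup>2) \<partial>lborel) \<partial>P n)"
      by (intro nn_integral_cmult lborel.borel_measurable_nn_integral) (use sm0 in \<open>simp add: case_prod_unfold\<close>)
    also have "(\<integral>\<^sup>+z. a n z \<partial>lborel) + \<dots> \<le> ennreal (e / 2) + ennreal (1 / T) * ennreal C"
      using elim by (intro add_mono mult_left_mono) auto
    also have "\<dots> = ennreal (e / 2 + 1 / T * C)" using e T C by (subst ennreal_plus) (auto simp: ennreal_mult'[symmetric])
    also have "\<dots> \<le> ennreal e"
    proof (rule ennreal_leI)
      have "1 / T * C = (e / 2) * (C / (C + 1))" using C e by (simp add: T_def)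
      also have "\<dots> \<le> (e / 2) * 1" using C e by (intro mult_left_mono) auto
      finally show "e / 2 + 1 / T * C \<le> e" by linarith
    qed
    finally show ?case .
  qed
qed

theorem replacement_principle:
  fixes P :: "nat \<Rightarrow> 'w measure" and A B :: "nat \<Rightarrow> 'w \<Rightarrow> complex mat" and f :: "complex \<Rightarrow> complex"
  assumes P: "\<And>n. prob_space (P n)"
    and A: "\<And>n \<omega>. \<omega> \<in> space (P n) \<Longrightarrow> A n \<omega> \<in> carrier_mat n n"
    and B: "\<And>n \<omega>. \<omega> \<in> space (P n) \<Longrightarrow> B n \<omega> \<in> carrier_mat n n"
    and Am: "\<And>n i j. i < n \<Longrightarrow> j < n \<Longrightarrow> (\<lambda>\<omega>. A n \<omega> $$ (i, j)) \<in> borel_measurable (P n)"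
    and Bm: "\<And>n i j. i < n \<Longrightarrow> j < n \<Longrightarrow> (\<lambda>\<omega>. B n \<omega> $$ (i, j)) \<in> borel_measurable (P n)"
    and A2: "\<And>n. n > 0 \<Longrightarrow> (\<integral>\<^sup>+\<omega>. ennreal ((\<Sum>i<n. \<Sum>j<n. (cmod (A n \<omega> $$ (i, j)))\<^sup>2) / n) \<partial>P n) \<le> ennreal K"
    and B2: "\<And>n. n > 0 \<Longrightarrow> (\<integral>\<^sup>+\<omega>. ennreal ((\<Sum>i<n. \<Sum>j<n. (cmod (B n \<omega> $$ (i, j)))\<^sup>2) / n) \<partial>P n) \<le> ennreal K"
    and K: "K \<ge> 0"
    and conv: "AE z in lborel. \<forall>\<delta>>0. (\<lambda>n. measure (P n) {\<omega>\<in>space (P n).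
        \<delta> \<le> \<bar>log_potential n (A n \<omega>) z - log_potential n (B n \<omega>) z\<bar>}) \<longlonglongrightarrow> 0"
    and f: "continuous_on UNIV f" and cs: "compactly_supported f"
  shows "tendsto_zero_in_prob P (\<lambda>n \<omega>. (\<integral>z. f z \<partial>esd (A n \<omega>)) - (\<integral>z. f z \<partial>esd (B n \<omega>)))"
proof -
  obtain R where R: "R \<ge> 0" and supp: "\<And>z. R < cmod z \<Longrightarrow> f z = 0"
  proof -
    have "bounded {x. f x \<noteq> 0}"
      using cs unfolding compactly_supported_def by (meson bounded_subset closure_subset compact_imp_bounded)
    then obtain R0 where R0: "\<And>x. f x \<noteq> 0 \<Longrightarrow> cmod x \<le> R0" unfolding bounded_iff by auto
    show ?thesis by (rule that[of "max R0 0"]) (use R0 in \<open>fastforce+\<close>)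
  qed
  let ?X = "\<lambda>n \<omega>. (\<integral>z. f z \<partial>esd (A n \<omega>)) - (\<integral>z. f z \<partial>esd (B n \<omega>))"
  have Xm: "?X n \<in> borel_measurable (P n)" for n
  proof (cases "n = 0")
    case True
    have "A n \<omega> = B n \<omega>" if "\<omega> \<in> space (P n)" for \<omega>
      using A[OF that] B[OF that] True by (intro eq_matI) auto
    hence "?X n \<omega> = 0" if "\<omega> \<in> space (P n)" for \<omega> using that by simp
    thus ?thesis by (subst measurable_cong[where g = "\<lambda>_. 0"]) auto
  next
    case False
    thus ?thesis
      using esd_integral_measurable[OF f supp R A _ Am] esd_integral_measurable[OF f supp R B _ Bm] by simp
  qed
  define D where "D n x = log_potential n (A n (fst x)) (snd x) - log_potential n (B n (fst x)) (snd x)" for n and x :: "'w \<times> complex"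
  have Dm: "D n \<in> borel_measurable (P n \<Otimes>\<^sub>M lborel)" for n
    unfolding D_def[abs_def]
    by (intro borel_measurable_diff log_potential_measurable A B Am Bm)
  have "(\<lambda>n. measure (P n) {\<omega>\<in>space (P n). \<delta> \<le> cmod (?X n \<omega>)}) \<longlonglongrightarrow> 0" if \<delta>: "\<delta> > 0" for \<delta>
  proof -
    have "\<exists>d>0. \<forall>u v. cmod (u - v) \<le> d \<longrightarrow> cmod (f u - f v) \<le> \<delta> / 4"
      by (rule compact_support_uniform[OF f supp]) (use \<delta> in auto)
    then obtain r where r: "r > 0" "\<And>u v. cmod (u - v) \<le> r \<Longrightarrow> cmod (f u - f v) \<le> \<delta> / 4" by blast
    define G where "G = circle_avg_diff (\<lambda>z. f (- z)) r"
    define \<kappa> where "\<kappa> = (\<integral>u. log_kernel r u \<partial>lborel)"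
    have \<kappa>: "\<kappa> > 0" unfolding \<kappa>_def by (rule log_kernel_integral_pos[OF r(1)])
    have g: "continuous_on UNIV (\<lambda>z. f (- z))" by (intro continuous_on_compose2[OF f] continuous_intros) auto
    have gs: "\<And>z. R < cmod z \<Longrightarrow> f (- z) = 0" using supp by simp
    obtain Bf where Bf: "Bf \<ge> 0" "\<And>z. cmod (f (- z)) \<le> Bf" using compact_support_bounded[OF g gs] by blast
    note G = circle_avg_diff_properties[OF g gs r(1) Bf(2), folded G_def]
    define R' where "R' = R + r"
    have R': "R' \<ge> 0" using R r by (simp add: R'_def)
    obtain C where C: "C \<ge> 0" "\<And>n A. n > 0 \<Longrightarrow> A \<in> carrier_mat n n \<Longrightarrow>
      (\<integral>\<^sup>+z\<in>cball 0 R'. ennreal ((log_potential n A z)\<^sup>2) \<partial>lborel)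
        \<le> ennreal (C * (1 + (\<Sum>i<n. \<Sum>j<n. (cmod (A $$ (i, j)))\<^sup>2) / n))"
      using nn_integral_log_potential_sq[OF R'] by blast
    have cb[measurable]: "cball (0::complex) R' \<in> sets borel" by simp
    have bound: "(\<integral>\<^sup>+\<omega>. (\<integral>\<^sup>+z\<in>cball 0 R'. ennreal ((D n (\<omega>, z))\<^sup>2) \<partial>lborel) \<partial>P n) \<le> ennreal (4 * C * (1 + K))" if n: "n > 0" for n
    proof -
      interpret prob_space "P n" by (rule P)
      let ?q = "\<lambda>A. (\<Sum>i<n. \<Sum>j<n. (cmod (A $$ (i, j)))\<^sup>2) / n"
      have q0: "0 \<le> ?q A" for A :: "complex mat" by (intro divide_nonneg_nonneg sum_nonneg) auto
      have lpm: "(\<lambda>z. ennreal ((log_potential n A z)\<^sup>2) * indicator (cball 0 R') z) \<in> borel_measurable lborel" if "A \<in> carrier_mat n n" for A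
        using log_potential_measurable'[OF that] by measurable
      have qm: "(\<lambda>\<omega>. ennreal (?q (A n \<omega>))) \<in> borel_measurable (P n)" "(\<lambda>\<omega>. ennreal (?q (B n \<omega>))) \<in> borel_measurable (P n)"
        by (intro measurable_compose[OF _ measurable_ennreal] borel_measurable_divide borel_measurable_sum borel_measurable_power
            measurable_compose[OF _ borel_measurable_norm] Am Bm borel_measurable_const; auto)+
      have "(\<integral>\<^sup>+\<omega>. (\<integral>\<^sup>+z\<in>cball 0 R'. ennreal ((D n (\<omega>, z))\<^sup>2) \<partial>lborel) \<partial>P n)
        \<le> (\<integral>\<^sup>+\<omega>. ennreal (4 * C) + ennreal (2 * C) * (ennreal (?q (A n \<omega>)) + ennreal (?q (B n \<omega>))) \<partial>P n)"
      proof (rule nn_integral_mono)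
        fix \<omega> assume \<omega>: "\<omega> \<in> space (P n)"
        have "(\<integral>\<^sup>+z\<in>cball 0 R'. ennreal ((D n (\<omega>, z))\<^sup>2) \<partial>lborel)
          \<le> (\<integral>\<^sup>+z. 2 * (ennreal ((log_potential n (A n \<omega>) z)\<^sup>2) * indicator (cball 0 R') z)
              + 2 * (ennreal ((log_potential n (B n \<omega>) z)\<^sup>2) * indicator (cball 0 R') z) \<partial>lborel)"
        proof (rule nn_integral_mono)
          fix z
          have "(x - y)\<^sup>2 \<le> 2 * x\<^sup>2 + 2 * y\<^sup>2" for x y :: real
            using zero_le_power2[of "x + y"] by (simp add: power2_eq_square algebra_simps)
          hence "ennreal ((D n (\<omega>, z))\<^sup>2) \<le> ennreal (2 * (log_potential n (A n \<omega>) z)\<^sup>2 + 2 * (log_potential n (B n \<omega>) z)\<^sup>2)"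
            unfolding D_def by (intro ennreal_leI) simp
          also have "\<dots> = 2 * ennreal ((log_potential n (A n \<omega>) z)\<^sup>2) + 2 * ennreal ((log_potential n (B n \<omega>) z)\<^sup>2)"
            by (simp add: ennreal_plus ennreal_mult)
          finally show "ennreal ((D n (\<omega>, z))\<^sup>2) * indicator (cball 0 R') z
            \<le> 2 * (ennreal ((log_potential n (A n \<omega>) z)\<^sup>2) * indicator (cball 0 R') z)
              + 2 * (ennreal ((log_potential n (B n \<omega>) z)\<^sup>2) * indicator (cball 0 R') z)"
            by (cases "z \<in> cball 0 R'") auto
        qed
        also have "\<dots> = 2 * (\<integral>\<^sup>+z\<in>cball 0 R'. ennreal ((log_potential n (A n \<omega>) z)\<^sup>2) \<partial>lborel)
            + 2 * (\<integral>\<^sup>+z\<in>cball 0 R'. ennreal ((log_potential n (B n \<omega>) z)\<^sup>2) \<partial>lborel)"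
          using lpm[OF A[OF \<omega>]] lpm[OF B[OF \<omega>]] by (subst nn_integral_add) (auto simp: nn_integral_cmult)
        also have "\<dots> \<le> 2 * ennreal (C * (1 + ?q (A n \<omega>))) + 2 * ennreal (C * (1 + ?q (B n \<omega>)))"
          by (intro add_mono mult_left_mono C A[OF \<omega>] B[OF \<omega>] n) auto
        also have "\<dots> = ennreal (2 * (C * (1 + ?q (A n \<omega>))) + 2 * (C * (1 + ?q (B n \<omega>))))"
          using C q0[of "A n \<omega>"] q0[of "B n \<omega>"] by (simp add: ennreal_plus ennreal_mult)
        also have "2 * (C * (1 + ?q (A n \<omega>))) + 2 * (C * (1 + ?q (B n \<omega>))) = 4 * C + 2 * C * (?q (A n \<omega>) + ?q (B n \<omega>))"
          by (simp add: algebra_simps)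
        also have "ennreal \<dots> = ennreal (4 * C) + ennreal (2 * C) * (ennreal (?q (A n \<omega>)) + ennreal (?q (B n \<omega>)))"
          using C q0[of "A n \<omega>"] q0[of "B n \<omega>"] by (simp only: ennreal_plus ennreal_mult add_nonneg_nonneg mult_nonneg_nonneg zero_le_numeral)
        finally show "(\<integral>\<^sup>+z\<in>cball 0 R'. ennreal ((D n (\<omega>, z))\<^sup>2) \<partial>lborel)
          \<le> ennreal (4 * C) + ennreal (2 * C) * (ennreal (?q (A n \<omega>)) + ennreal (?q (B n \<omega>)))" .
      qed
      also have "\<dots> = ennreal (4 * C) + ennreal (2 * C) * ((\<integral>\<^sup>+\<omega>. ennreal (?q (A n \<omega>)) \<partial>P n) + (\<integral>\<^sup>+\<omega>. ennreal (?q (B n \<omega>)) \<partial>P n))"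
        using qm by (simp add: nn_integral_add nn_integral_cmult emeasure_space_1)
      also have "\<dots> \<le> ennreal (4 * C) + ennreal (2 * C) * (ennreal K + ennreal K)"
        by (intro add_left_mono mult_left_mono add_mono A2 B2 n) auto
      also have "\<dots> = ennreal (4 * C + 2 * C * (K + K))" using C K by (simp only: ennreal_plus ennreal_mult add_nonneg_nonneg mult_nonneg_nonneg zero_le_numeral)
      also have "4 * C + 2 * C * (K + K) = 4 * C * (1 + K)" by (simp add: algebra_simps)
      finally show ?thesis .
    qed
    let ?I = "\<lambda>n \<omega>. (\<integral>\<^sup>+z\<in>cball 0 R'. ennreal \<bar>D n (\<omega>, z)\<bar> \<partial>lborel)"
    have L1: "(\<lambda>n. \<integral>\<^sup>+\<omega>. ?I n \<omega> \<partial>P n) \<longlonglongrightarrow> 0"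
    proof (rule L1_tendsto_zero[OF P Dm])
      show "eventually (\<lambda>n. (\<integral>\<^sup>+\<omega>. (\<integral>\<^sup>+z\<in>cball 0 R'. ennreal ((D n (\<omega>, z))\<^sup>2) \<partial>lborel) \<partial>P n) \<le> ennreal (4 * C * (1 + K))) sequentially"
        using eventually_gt_at_top[of 0] by eventually_elim (rule bound)
      show "AE z in lborel. \<forall>\<delta>>0. (\<lambda>n. measure (P n) {\<omega>\<in>space (P n). \<delta> \<le> \<bar>D n (\<omega>, z)\<bar>}) \<longlonglongrightarrow> 0"
        using conv by (simp add: D_def)
    qed (use C K in auto)
    have Im: "?I n \<in> borel_measurable (P n)" for n
    proof -
      note Dm[of n, measurable]
      have "(\<lambda>x. ennreal \<bar>D n (fst x, snd x)\<bar> * indicator (cball 0 R') (snd x)) \<in> borel_measurable (P n \<Otimes>\<^sub>M lborel)" by measurable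
      thus ?thesis by (intro lborel.borel_measurable_nn_integral) (simp add: case_prod_unfold)
    qed
    define b where "b = 2 * Bf + 2"
    have b: "b > 0" "2 * Bf \<le> b" using Bf by (auto simp: b_def)
    define c where "c = \<kappa> * \<delta> / (2 * b)"
    have c: "c > 0" using \<kappa> \<delta> b by (simp add: c_def)
    have sub: "ennreal c \<le> ?I n \<omega>" if n: "n > 0" and \<omega>: "\<omega> \<in> space (P n)" and large: "\<delta> \<le> cmod (?X n \<omega>)" for n \<omega>
    proof -
      let ?Y = "\<lambda>A. (\<integral>z. G z * of_real (log_potential n A z) \<partial>lborel)"
      have iY: "integrable lborel (\<lambda>z. G z * of_real (log_potential n (A n \<omega>) z))" "integrable lborel (\<lambda>z. G z * of_real (log_potential n (B n \<omega>) z))"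
        unfolding G_def by (rule esd_integral_approx(1)[OF f supp R r _ n]; use A B \<omega> in simp)+
      have cl: "cmod (?Y (A n \<omega>) - of_real \<kappa> * (\<integral>z. f z \<partial>esd (A n \<omega>))) \<le> \<kappa> * (\<delta> / 4)"
        "cmod (?Y (B n \<omega>) - of_real \<kappa> * (\<integral>z. f z \<partial>esd (B n \<omega>))) \<le> \<kappa> * (\<delta> / 4)"
        unfolding G_def \<kappa>_def by (rule esd_integral_approx(2)[OF f supp R r _ n]; use A B \<omega> in simp)+
      have "of_real \<kappa> * ?X n \<omega> = (?Y (A n \<omega>) - ?Y (B n \<omega>)) - (?Y (A n \<omega>) - of_real \<kappa> * (\<integral>z. f z \<partial>esd (A n \<omega>)))
          + (?Y (B n \<omega>) - of_real \<kappa> * (\<integral>z. f z \<partial>esd (B n \<omega>)))"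
        by (simp add: algebra_simps)
      hence "cmod (of_real \<kappa> * ?X n \<omega>) \<le> cmod (?Y (A n \<omega>) - ?Y (B n \<omega>)) + \<kappa> * (\<delta> / 4) + \<kappa> * (\<delta> / 4)"
        using cl by (smt (verit) norm_triangle_ineq norm_triangle_ineq4)
      moreover have "\<kappa> * \<delta> \<le> cmod (of_real \<kappa> * ?X n \<omega>)" using large \<kappa> by (simp add: norm_mult)
      ultimately have low: "\<kappa> * \<delta> / 2 \<le> cmod (?Y (A n \<omega>) - ?Y (B n \<omega>))" by linarith
      have "ennreal (cmod (?Y (A n \<omega>) - ?Y (B n \<omega>))) = ennreal (cmod (\<integral>z. G z * of_real (D n (\<omega>, z)) \<partial>lborel))"
        using iY by (simp add: D_def right_diff_distrib)
      also have "\<dots> \<le> (\<integral>\<^sup>+z. ennreal (cmod (G z * of_real (D n (\<omega>, z)))) \<partial>lborel)"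
      proof (rule integral_norm_bound_ennreal)
        show "integrable lborel (\<lambda>z. G z * of_real (D n (\<omega>, z)))"
          using Bochner_Integration.integrable_diff[OF iY] by (simp add: D_def right_diff_distrib)
      qed
      also have "\<dots> \<le> (\<integral>\<^sup>+z. ennreal (2 * Bf) * (ennreal \<bar>D n (\<omega>, z)\<bar> * indicator (cball 0 R') z) \<partial>lborel)"
      proof (rule nn_integral_mono)
        fix z
        show "ennreal (cmod (G z * of_real (D n (\<omega>, z)))) \<le> ennreal (2 * Bf) * (ennreal \<bar>D n (\<omega>, z)\<bar> * indicator (cball 0 R') z)"
        proof (cases "cmod z \<le> R'")
          case True
          have "cmod (G z) * \<bar>D n (\<omega>, z)\<bar> \<le> 2 * Bf * \<bar>D n (\<omega>, z)\<bar>"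
            by (intro mult_right_mono G(3)) auto
          thus ?thesis using True Bf by (simp add: norm_mult ennreal_mult[symmetric] ennreal_leI)
        qed (use G(2)[where z = z] in \<open>simp add: R'_def\<close>)
      qed
      also have "\<dots> = ennreal (2 * Bf) * ?I n \<omega>"
      proof (rule nn_integral_cmult)
        have [measurable]: "(\<lambda>z. D n (\<omega>, z)) \<in> borel_measurable lborel"
          by (rule measurable_compose[OF _ Dm]) (use \<omega> in auto)
        show "(\<lambda>z. ennreal \<bar>D n (\<omega>, z)\<bar> * indicator (cball 0 R') z) \<in> borel_measurable lborel" by measurable
      qed
      also have "\<dots> \<le> ennreal b * ?I n \<omega>" using b by (intro mult_right_mono ennreal_leI) auto
      finally have "ennreal (\<kappa> * \<delta> / 2) \<le> ennreal b * ?I n \<omega>"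
        using low by (meson ennreal_leI order_trans)
      hence "ennreal (1 / b) * ennreal (\<kappa> * \<delta> / 2) \<le> ennreal (1 / b) * (ennreal b * ?I n \<omega>)"
        by (intro mult_left_mono) auto
      moreover have "ennreal (1 / b) * (ennreal b * ?I n \<omega>) = ?I n \<omega>"
        using b by (simp add: mult.assoc[symmetric] ennreal_mult'[symmetric])
      moreover have "ennreal (1 / b) * ennreal (\<kappa> * \<delta> / 2) = ennreal c"
        using b \<kappa> \<delta> by (simp add: ennreal_mult'[symmetric] c_def)
      ultimately show ?thesis by simp
    qed
    have markov: "ennreal (measure (P n) {\<omega>\<in>space (P n). \<delta> \<le> cmod (?X n \<omega>)}) \<le> ennreal (1 / c) * (\<integral>\<^sup>+\<omega>. ?I n \<omega> \<partial>P n)" if n: "n > 0" for n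
    proof -
      interpret prob_space "P n" by (rule P)
      have "ennreal (measure (P n) {\<omega>\<in>space (P n). \<delta> \<le> cmod (?X n \<omega>)}) = emeasure (P n) {\<omega>\<in>space (P n). \<delta> \<le> cmod (?X n \<omega>)}"
        by (simp add: emeasure_eq_measure)
      also have "\<dots> \<le> emeasure (P n) {\<omega>\<in>space (P n). 1 \<le> ennreal (1 / c) * ?I n \<omega>}"
      proof (rule emeasure_mono)
        show "{\<omega>\<in>space (P n). \<delta> \<le> cmod (?X n \<omega>)} \<subseteq> {\<omega>\<in>space (P n). 1 \<le> ennreal (1 / c) * ?I n \<omega>}"
        proof safe
          fix \<omega> assume "\<omega> \<in> space (P n)" "\<delta> \<le> cmod (?X n \<omega>)"
          from sub[OF n this] have "ennreal (1 / c) * ennreal c \<le> ennreal (1 / c) * ?I n \<omega>" by (intro mult_left_mono) auto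
          thus "1 \<le> ennreal (1 / c) * ?I n \<omega>" using c by (simp add: ennreal_mult'[symmetric])
        qed
        show "{\<omega>\<in>space (P n). 1 \<le> ennreal (1 / c) * ?I n \<omega>} \<in> sets (P n)" using Im[of n] by measurable
      qed
      also have "\<dots> \<le> ennreal (1 / c) * (\<integral>\<^sup>+\<omega>. ?I n \<omega> * indicator (space (P n)) \<omega> \<partial>P n)"
        by (rule nn_integral_Markov_inequality) (use Im[of n] in simp_all)
      also have "(\<integral>\<^sup>+\<omega>. ?I n \<omega> * indicator (space (P n)) \<omega> \<partial>P n) = (\<integral>\<^sup>+\<omega>. ?I n \<omega> \<partial>P n)"
        by (intro nn_integral_cong) auto
      finally show ?thesis .
    qed
    have "(\<lambda>n. ennreal (1 / c) * (\<integral>\<^sup>+\<omega>. ?I n \<omega> \<partial>P n)) \<longlonglongrightarrow> ennreal (1 / c) * 0"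
      by (intro ennreal_tendsto_cmult L1) auto
    hence lim: "(\<lambda>n. ennreal (1 / c) * (\<integral>\<^sup>+\<omega>. ?I n \<omega> \<partial>P n)) \<longlonglongrightarrow> 0" by simp
    have "(\<lambda>n. ennreal (measure (P n) {\<omega>\<in>space (P n). \<delta> \<le> cmod (?X n \<omega>)})) \<longlonglongrightarrow> 0"
    proof (rule tendsto_sandwich[OF _ _ tendsto_const lim])
      show "eventually (\<lambda>n. ennreal (measure (P n) {\<omega>\<in>space (P n). \<delta> \<le> cmod (?X n \<omega>)}) \<le> ennreal (1 / c) * (\<integral>\<^sup>+\<omega>. ?I n \<omega> \<partial>P n)) sequentially"
        using eventually_gt_at_top[of 0] by eventually_elim (rule markov)
    qed simp
    thus ?thesis by (simp add: ennreal_tendsto_0_iff)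
  qed
  thus ?thesis unfolding tendsto_zero_in_prob_def using Xm by blast
qed

section \<open>Anticoncentration of the entries\<close>

lemma (in prob_space) prob_gt_margin:
  fixes f :: "'a \<Rightarrow> real"
  assumes f[measurable]: "f \<in> borel_measurable M" and pos: "0 < prob {\<omega>\<in>space M. 0 < f \<omega>}"
  shows "\<exists>d>0. 0 < prob {\<omega>\<in>space M. d \<le> f \<omega>}"
proof (rule ccontr)
  assume "\<not> ?thesis"
  hence z: "prob {\<omega>\<in>space M. d \<le> f \<omega>} = 0" if "d > 0" for d
    using that by (metis linorder_neqE_linordered_idom measure_nonneg not_less)
  have "{\<omega>\<in>space M. inverse (real (Suc k)) \<le> f \<omega>} \<in> null_sets M" for k
    using z[of "inverse (real (Suc k))"] by (intro null_setsI) (auto simp: emeasure_eq_measure)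
  hence null: "(\<Union>k. {\<omega>\<in>space M. inverse (real (Suc k)) \<le> f \<omega>}) \<in> null_sets M" by (intro null_sets_UN)
  have sub: "{\<omega>\<in>space M. 0 < f \<omega>} \<subseteq> (\<Union>k. {\<omega>\<in>space M. inverse (real (Suc k)) \<le> f \<omega>})"
  proof
    fix \<omega> assume \<omega>: "\<omega> \<in> {\<omega>\<in>space M. 0 < f \<omega>}"
    then obtain k where "inverse (real (Suc k)) < f \<omega>" using reals_Archimedean[of "f \<omega>"] by auto
    thus "\<omega> \<in> (\<Union>k. {\<omega>\<in>space M. inverse (real (Suc k)) \<le> f \<omega>})" using \<omega> by (auto intro!: exI[of _ k])
  qed
  have "{\<omega>\<in>space M. 0 < f \<omega>} \<in> null_sets M" by (rule null_sets_subset[OF null _ sub]) measurable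
  thus False using pos by (simp add: null_sets_def emeasure_eq_measure)
qed

lemma (in prob_space) mean_zero_imp_both_signs:
  fixes f :: "'a \<Rightarrow> real"
  assumes int: "integrable M f" and mean: "expectation f = 0" and nz: "\<not> (AE \<omega> in M. f \<omega> = 0)"
  shows "0 < prob {\<omega>\<in>space M. 0 < f \<omega>}"
proof (rule ccontr)
  have [measurable]: "f \<in> borel_measurable M" using int by auto
  assume "\<not> ?thesis"
  hence "prob {\<omega>\<in>space M. 0 < f \<omega>} = 0" by (metis linorder_neqE_linordered_idom measure_nonneg not_less)
  hence "{\<omega>\<in>space M. 0 < f \<omega>} \<in> null_sets M" by (intro null_setsI) (auto simp: emeasure_eq_measure)
  hence "AE \<omega> in M. \<omega> \<notin> {\<omega>\<in>space M. 0 < f \<omega>}" by (rule AE_not_in)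
  hence le: "AE \<omega> in M. 0 \<le> - f \<omega>" by (rule AE_mp) (auto intro!: AE_I2)
  have "AE \<omega> in M. - f \<omega> = 0"
    using integral_nonneg_eq_0_iff_AE[OF integrable_minus[OF int] le] mean by simp
  thus False using nz by simp
qed

lemma (in prob_space) anticonc_of_real_part:
  fixes Re' :: "complex \<Rightarrow> real"
  assumes x[measurable]: "x \<in> borel_measurable M" and R[measurable]: "Re' \<in> borel_measurable borel"
    and lip: "\<And>u v. \<bar>Re' u - Re' v\<bar> \<le> cmod (u - v)"
    and int: "integrable M (\<lambda>\<omega>. Re' (x \<omega>))" and mean: "expectation (\<lambda>\<omega>. Re' (x \<omega>)) = 0"
    and nz: "\<not> (AE \<omega> in M. Re' (x \<omega>) = 0)"
  shows "\<exists>c>0. \<exists>p<1. 0 \<le> p \<and> anticonc M x c p"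
proof -
  obtain d1 where d1: "d1 > 0" "0 < prob {\<omega>\<in>space M. d1 \<le> Re' (x \<omega>)}"
    using prob_gt_margin[of "\<lambda>\<omega>. Re' (x \<omega>)"] mean_zero_imp_both_signs[OF int mean nz] by auto
  have "0 < prob {\<omega>\<in>space M. 0 < - Re' (x \<omega>)}"
    by (rule mean_zero_imp_both_signs) (use int mean nz in auto)
  then obtain d2 where d2: "d2 > 0" "0 < prob {\<omega>\<in>space M. d2 \<le> - Re' (x \<omega>)}"
    using prob_gt_margin[of "\<lambda>\<omega>. - Re' (x \<omega>)"] by auto
  define E1 where "E1 = {\<omega>\<in>space M. d1 \<le> Re' (x \<omega>)}"
  define E2 where "E2 = {\<omega>\<in>space M. d2 \<le> - Re' (x \<omega>)}"
  have E[measurable]: "E1 \<in> events" "E2 \<in> events" by (auto simp: E1_def E2_def)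
  define c where "c = (d1 + d2) / 2"
  define p where "p = max (1 - prob E1) (1 - prob E2)"
  have "prob {\<omega>\<in>space M. cmod (x \<omega> - a) < c} \<le> p" for a
  proof -
    have "(\<forall>\<omega>\<in>E1. \<not> cmod (x \<omega> - a) < c) \<or> (\<forall>\<omega>\<in>E2. \<not> cmod (x \<omega> - a) < c)"
    proof (rule ccontr)
      assume "\<not> ?thesis"
      then obtain \<omega>1 \<omega>2 where w: "\<omega>1 \<in> E1" "cmod (x \<omega>1 - a) < c" "\<omega>2 \<in> E2" "cmod (x \<omega>2 - a) < c" by blast
      have "d1 + d2 \<le> Re' (x \<omega>1) - Re' (x \<omega>2)" using w by (auto simp: E1_def E2_def)
      also have "\<dots> \<le> \<bar>Re' (x \<omega>1) - Re' a\<bar> + \<bar>Re' (x \<omega>2) - Re' a\<bar>" by linarith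
      also have "\<dots> \<le> cmod (x \<omega>1 - a) + cmod (x \<omega>2 - a)" by (intro add_mono lip)
      also have "\<dots> < d1 + d2" using w by (simp add: c_def)
      finally show False by simp
    qed
    then obtain E where Ee: "E \<in> {E1, E2}" "\<forall>\<omega>\<in>E. \<not> cmod (x \<omega> - a) < c" by blast
    have "prob {\<omega>\<in>space M. cmod (x \<omega> - a) < c} \<le> prob (space M - E)"
      by (rule finite_measure_mono) (use Ee in auto)
    also have "\<dots> = 1 - prob E" by (rule prob_compl) (use Ee(1) in auto)
    also have "\<dots> \<le> p" using Ee(1) by (auto simp: p_def)
    finally show ?thesis .
  qed
  hence "anticonc M x c p" by (simp add: anticonc_def)
  moreover have "c > 0" using d1 d2 by (simp add: c_def)
  moreover have "p < 1" using d1(2) d2(2) by (simp add: p_def E1_def E2_def)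
  moreover have "0 \<le> p" unfolding p_def using prob_le_1[of E1] by (simp add: le_max_iff_disj)
  ultimately show ?thesis by blast
qed

lemma anticonc_exists:
  assumes Q: "prob_space Q" and x: "mean_zero_variance_one Q x"
  shows "\<exists>c>0. \<exists>p<1. 1 / 2 \<le> p \<and> anticonc Q x c p"
proof -
  interpret prob_space Q by (rule Q)
  have xm[measurable]: "x \<in> borel_measurable Q" and int: "integrable Q x" and mean: "(\<integral>\<omega>. x \<omega> \<partial>Q) = 0"
    and var: "(\<integral>\<omega>. (cmod (x \<omega>))\<^sup>2 \<partial>Q) = 1"
    using x by (auto simp: mean_zero_variance_one_def)
  have "\<exists>c>0. \<exists>p<1. 0 \<le> p \<and> anticonc Q x c p"
  proof (cases "AE \<omega> in Q. Re (x \<omega>) = 0")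
    case False
    show ?thesis
    proof (rule anticonc_of_real_part[OF xm _ _ _ _ False])
      show "\<bar>Re u - Re v\<bar> \<le> cmod (u - v)" for u v using abs_Re_le_cmod[of "u - v"] by simp
      show "integrable Q (\<lambda>\<omega>. Re (x \<omega>))" using int by simp
      show "expectation (\<lambda>\<omega>. Re (x \<omega>)) = 0" using int mean by (simp add: integral_Re)
    qed simp
  next
    case True
    have False': "\<not> (AE \<omega> in Q. Im (x \<omega>) = 0)"
    proof
      assume "AE \<omega> in Q. Im (x \<omega>) = 0"
      with True have "AE \<omega> in Q. (cmod (x \<omega>))\<^sup>2 = 0"
        by eventually_elim (simp add: complex_eq_iff)
      hence "(\<integral>\<omega>. (cmod (x \<omega>))\<^sup>2 \<partial>Q) = (\<integral>\<omega>. 0 \<partial>Q)" by (intro integral_cong_AE) auto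
      thus False using var by simp
    qed
    show ?thesis
    proof (rule anticonc_of_real_part[OF xm _ _ _ _ False'])
      show "\<bar>Im u - Im v\<bar> \<le> cmod (u - v)" for u v using abs_Im_le_cmod[of "u - v"] by simp
      show "integrable Q (\<lambda>\<omega>. Im (x \<omega>))" using int by simp
      show "expectation (\<lambda>\<omega>. Im (x \<omega>)) = 0" using int mean by (simp add: integral_Im)
    qed simp
  qed
  then obtain c p where cp: "c > 0" "p < 1" "anticonc Q x c p" by blast
  have "anticonc Q x c (max p (1/2))" using cp(3) unfolding anticonc_def by (meson le_max_iff_disj)
  thus ?thesis using cp by (intro exI[of _ c] exI[of _ "max p (1/2)"] conjI) auto
qed

lemma mean_zero_variance_one_moments:
  assumes Q: "prob_space Q" and x: "mean_zero_variance_one Q x"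
  shows "(\<integral>\<^sup>+\<omega>. ennreal (cmod (x \<omega>)) \<partial>Q) \<le> 1"
    and "(\<integral>\<^sup>+\<omega>. ennreal ((cmod (x \<omega>))\<^sup>2) \<partial>Q) = 1"
proof -
  interpret prob_space Q by (rule Q)
  have xm[measurable]: "x \<in> borel_measurable Q" and int: "integrable Q x"
    and i2: "integrable Q (\<lambda>\<omega>. (cmod (x \<omega>))\<^sup>2)" and var: "(\<integral>\<omega>. (cmod (x \<omega>))\<^sup>2 \<partial>Q) = 1"
    using x by (auto simp: mean_zero_variance_one_def)
  show 2: "(\<integral>\<^sup>+\<omega>. ennreal ((cmod (x \<omega>))\<^sup>2) \<partial>Q) = 1"
    using nn_integral_eq_integral[OF i2] var by simp
  have "(\<integral>\<omega>. cmod (x \<omega>) \<partial>Q) \<le> (\<integral>\<omega>. (1 + (cmod (x \<omega>))\<^sup>2) / 2 \<partial>Q)"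
  proof (rule integral_mono)
    show "cmod (x \<omega>) \<le> (1 + (cmod (x \<omega>))\<^sup>2) / 2" for \<omega>
      using zero_le_power2[of "cmod (x \<omega>) - 1"] by (simp add: power2_eq_square algebra_simps)
  qed (use int i2 in auto)
  also have "\<dots> = 1" using i2 var by (simp add: prob_space)
  finally show "(\<integral>\<^sup>+\<omega>. ennreal (cmod (x \<omega>)) \<partial>Q) \<le> 1"
    using int by (subst nn_integral_eq_integral) auto
qed

lemma hs_norm_sq:
  assumes A: "A \<in> carrier_mat n n"
  shows "(hs_norm A)\<^sup>2 = (\<Sum>i<n. \<Sum>j<n. (cmod (A $$ (i, j)))\<^sup>2)"
proof -
  have "(mat_adjoint A * A) $$ (j, j) = of_real (\<Sum>i<n. (cmod (A $$ (i, j)))\<^sup>2)" if j: "j < n" for j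
  proof -
    have "(mat_adjoint A * A) $$ (j, j) = conjugate (col A j) \<bullet> col A j"
      using A j by (simp add: mat_adjoint_def)
    also have "\<dots> = (\<Sum>i\<in>{0..<n}. cnj (A $$ (i, j)) * A $$ (i, j))"
      using A j by (auto simp: scalar_prod_def intro!: sum.cong)
    also have "\<dots> = of_real (\<Sum>i<n. (cmod (A $$ (i, j)))\<^sup>2)"
      unfolding of_real_sum lessThan_atLeast0 by (intro sum.cong refl) (simp add: complex_norm_square[symmetric] mult.commute)
    finally show ?thesis .
  qed
  hence "Re (\<Sum>j<dim_col A. (mat_adjoint A * A) $$ (j, j)) = (\<Sum>j<n. \<Sum>i<n. (cmod (A $$ (i, j)))\<^sup>2)"
    using A by (simp add: Re_sum)
  also have "\<dots> = (\<Sum>i<n. \<Sum>j<n. (cmod (A $$ (i, j)))\<^sup>2)" by (rule sum.swap)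
  finally show ?thesis unfolding hs_norm_def by (simp add: sum_nonneg)
qed

definition sparse_level :: "real \<Rightarrow> nat \<Rightarrow> nat" where
  "sparse_level b n = nat \<lfloor>b * real n / ln (real n)\<rfloor>"

definition window_level :: "nat \<Rightarrow> nat" where
  "window_level n = nat \<lceil>real n powr (1 / 4)\<rceil>"

lemma sparse_level_bounds:
  assumes "b > 0" "n \<ge> 2"
  shows "real (sparse_level b n) \<le> b * real n / ln (real n)"
    and "b * real n / ln (real n) - 1 \<le> real (sparse_level b n)"
proof -
  have "0 \<le> b * real n / ln (real n)" using assms by simp
  thus "real (sparse_level b n) \<le> b * real n / ln (real n)"
    "b * real n / ln (real n) - 1 \<le> real (sparse_level b n)"
    unfolding sparse_level_def by linarith+
qed

text \<open>The value of \<open>b\<close> makes the size of the net, about \<open>n\<close> to the power \<open>(2 \<gamma> + 9) k\<close>, at most \<open>p\<close> to the power \<open>- n / 2\<close>.\<close>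

lemma sparse_term_tendsto:
  fixes p \<gamma> :: real
  assumes p: "1 / 2 \<le> p" "p < 1" and \<gamma>: "\<gamma> > 0"
  defines "b \<equiv> ln (1 / p) / (2 * (2 * \<gamma> + 9))"
  shows "(\<lambda>n. real (n + 1) * (real ((n * card (grid (real n powr (-\<gamma>-3)))) ^ sparse_level b n) * p ^ (n - 1))) \<longlonglongrightarrow> 0"
proof -
  define a where "a = ln (1 / p)"
  have a: "a > 0" using p by (simp add: a_def)
  have b: "b > 0" using a \<gamma> by (simp add: b_def a_def[symmetric])
  have pexp: "p = exp (- a)" using p by (simp add: a_def ln_div)
  have lim: "(\<lambda>n. (real n + 1) * exp a * exp (- (a / 2) * real n)) \<longlonglongrightarrow> 0"
    using a by real_asymp
  show ?thesis
  proof (rule tendsto_sandwich[OF _ _ tendsto_const lim])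
    show "eventually (\<lambda>n. 0 \<le> real (n + 1) * (real ((n * card (grid (real n powr (-\<gamma>-3)))) ^ sparse_level b n) * p ^ (n - 1))) sequentially"
      using p by (intro always_eventually allI mult_nonneg_nonneg) auto
    show "eventually (\<lambda>n. real (n + 1) * (real ((n * card (grid (real n powr (-\<gamma>-3)))) ^ sparse_level b n) * p ^ (n - 1))
        \<le> (real n + 1) * exp a * exp (- (a / 2) * real n)) sequentially"
      using eventually_ge_at_top[of 5]
    proof eventually_elim
      case (elim n)
      have n: "real n \<ge> 5" using elim by simp
      let ?\<tau> = "real n powr (-\<gamma>-3)"
      let ?k = "sparse_level b n"
      have \<tau>: "?\<tau> > 0" using n by simp
      have inv: "1 / ?\<tau> = real n powr (\<gamma> + 3)" using powr_minus_divide[of "real n" "-\<gamma>-3"] by (simp add: add.commute)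
      have one: "1 \<le> real n powr (\<gamma> + 3)" using n \<gamma> by (intro ge_one_powr_ge_zero) auto
      have "real (card (grid ?\<tau>)) \<le> (2 / ?\<tau> + 3)\<^sup>2" by (rule card_grid[OF \<tau>])
      also have "2 / ?\<tau> = 2 * real n powr (\<gamma> + 3)" using inv by (simp add: field_simps)
      also have "(2 * real n powr (\<gamma> + 3) + 3)\<^sup>2 \<le> (real n * real n powr (\<gamma> + 3))\<^sup>2"
      proof (rule power_mono)
        have "2 * real n powr (\<gamma> + 3) + 3 \<le> 5 * real n powr (\<gamma> + 3)" using one by simp
        also have "\<dots> \<le> real n * real n powr (\<gamma> + 3)" using n by (intro mult_right_mono) auto
        finally show "2 * real n powr (\<gamma> + 3) + 3 \<le> real n * real n powr (\<gamma> + 3)" .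
      qed simp
      also have "real n * real n powr (\<gamma> + 3) = real n powr (\<gamma> + 4)"
        using n powr_add[of "real n" 1 "\<gamma> + 3"] by (simp add: add.commute)
      also have "(real n powr (\<gamma> + 4))\<^sup>2 = real n powr (2 * \<gamma> + 8)"
        using n by (simp add: power2_eq_square powr_add[symmetric])
      finally have "real n * real (card (grid ?\<tau>)) \<le> real n * real n powr (2 * \<gamma> + 8)"
        by (intro mult_left_mono) auto
      also have "\<dots> = real n powr (2 * \<gamma> + 9)"
        using n powr_add[of "real n" 1 "2 * \<gamma> + 8"] by (simp add: add.commute)
      finally have base: "real (n * card (grid ?\<tau>)) \<le> real n powr (2 * \<gamma> + 9)" by simp
      have "real ((n * card (grid ?\<tau>)) ^ ?k) \<le> (real n powr (2 * \<gamma> + 9)) ^ ?k"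
        unfolding of_nat_power by (rule power_mono[OF base]) simp
      also have "\<dots> = exp (real ?k * ((2 * \<gamma> + 9) * ln (real n)))"
        using n by (simp add: powr_def exp_of_nat_mult)
      also have "\<dots> \<le> exp (a / 2 * real n)"
      proof -
        have "real ?k * ((2 * \<gamma> + 9) * ln (real n)) \<le> b * real n / ln (real n) * ((2 * \<gamma> + 9) * ln (real n))"
          using sparse_level_bounds(1)[OF b, of n] elim \<gamma> by (intro mult_right_mono) auto
        also have "\<dots> = b * (2 * \<gamma> + 9) * real n" using n by (simp add: field_simps)
        also have "b * (2 * \<gamma> + 9) = a / 2"
        proof -
          have "2 * \<gamma> + 9 \<noteq> 0" using \<gamma> by simp
          thus ?thesis unfolding b_def a_def[symmetric] by (simp add: divide_simps)
        qed
        finally show ?thesis by simp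
      qed
      finally have 1: "real ((n * card (grid ?\<tau>)) ^ ?k) \<le> exp (a / 2 * real n)" .
      have "p ^ (n - 1) = exp (- a * (real n - 1))"
        using elim by (simp add: pexp exp_of_nat_mult[symmetric] of_nat_diff mult.commute)
      also have "\<dots> = exp a * exp (- a * real n)" by (simp add: exp_add[symmetric] algebra_simps)
      finally have 2: "p ^ (n - 1) = exp a * exp (- a * real n)" .
      have "real ((n * card (grid ?\<tau>)) ^ ?k) * p ^ (n - 1) \<le> exp (a / 2 * real n) * (exp a * exp (- a * real n))"
        unfolding 2 using 1 by (intro mult_right_mono) auto
      also have "\<dots> = exp a * exp (- (a / 2) * real n)"
        by (simp add: exp_add[symmetric] algebra_simps)
      finally have "real (n + 1) * (real ((n * card (grid ?\<tau>)) ^ ?k) * p ^ (n - 1)) \<le> real (n + 1) * (exp a * exp (- (a / 2) * real n))"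
        by (intro mult_left_mono) auto
      thus ?case by (simp add: algebra_simps)
    qed
  qed
qed

lemma window_term_tendsto:
  fixes q b :: real
  assumes q: "0 < q" "q \<le> 1" and b: "b > 0"
  shows "(\<lambda>n. real n * (1 / real (window_level n) + 2 * real (window_level n) *
      (1 - q / (real (window_level n))\<^sup>2) ^ (sparse_level b n div 2)) / real (sparse_level b n)) \<longlonglongrightarrow> 0"
proof -
  let ?g = "\<lambda>n. 2 * ln (real n) / b * (1 / real n powr (1/4) + 2 * (real n powr (1/4) + 1) *
      exp (- q * (b * real n / (2 * ln (real n)) - 1) / (real n powr (1/4) + 1)\<^sup>2))"
  have lim: "?g \<longlonglongrightarrow> 0" using q b by real_asymp
  have big: "eventually (\<lambda>n. 2 \<le> b * real n / ln (real n)) sequentially"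
    using b by real_asymp
  show ?thesis
  proof (rule tendsto_sandwich[OF _ _ tendsto_const lim])
    have w1: "real (window_level n) \<ge> 1" if "n \<ge> 2" for n
    proof -
      have "1 \<le> real n powr (1/4)" using that by (intro ge_one_powr_ge_zero) auto
      thus ?thesis unfolding window_level_def by linarith
    qed
    have base0: "0 \<le> 1 - q / (real (window_level n))\<^sup>2" if "n \<ge> 2" for n
    proof -
      have "1 \<le> (real (window_level n))\<^sup>2" using w1[OF that] by (intro one_le_power)
      hence "q \<le> (real (window_level n))\<^sup>2" using q by linarith
      thus ?thesis using w1[OF that] by (simp add: divide_le_eq)
    qed
    show "eventually (\<lambda>n. 0 \<le> real n * (1 / real (window_level n) + 2 * real (window_level n) *
      (1 - q / (real (window_level n))\<^sup>2) ^ (sparse_level b n div 2)) / real (sparse_level b n)) sequentially"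
      using eventually_ge_at_top[of 2]
    proof eventually_elim
      case (elim n)
      show ?case using base0[OF elim]
        by (intro divide_nonneg_nonneg mult_nonneg_nonneg add_nonneg_nonneg zero_le_power) auto
    qed
    show "eventually (\<lambda>n. real n * (1 / real (window_level n) + 2 * real (window_level n) *
      (1 - q / (real (window_level n))\<^sup>2) ^ (sparse_level b n div 2)) / real (sparse_level b n) \<le> ?g n) sequentially"
      using eventually_ge_at_top[of 3] big
    proof eventually_elim
      case (elim n)
      have n2: "n \<ge> 2" using elim by simp
      have lnn: "ln (real n) > 0" using n2 by simp
      define w where "w = real (window_level n)"
      define k where "k = sparse_level b n"
      have w: "w \<ge> 1" using w1[OF n2] by (simp add: w_def)
      have "0 \<le> real n powr (1/4)" by simp
      hence wl: "real n powr (1/4) \<le> w" "w \<le> real n powr (1/4) + 1"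
        unfolding w_def window_level_def by linarith+
      have kl: "b * real n / ln (real n) - 1 \<le> real k"
        unfolding k_def by (rule sparse_level_bounds(2)[OF b n2])
      define y where "y = b * real n / ln (real n)"
      have "y / 2 \<le> real k" using kl elim(2) unfolding y_def[symmetric] by linarith
      hence kh: "real k \<ge> b * real n / (2 * ln (real n))" by (simp add: y_def mult.commute)
      have kpos: "0 < b * real n / (2 * ln (real n))" using b n2 lnn by simp
      have nk: "real n / real k \<le> 2 * ln (real n) / b"
      proof -
        have "real n / real k \<le> real n / (b * real n / (2 * ln (real n)))"
          using kh kpos by (intro divide_left_mono mult_pos_pos) auto
        also have "\<dots> = 2 * ln (real n) / b" using n2 b lnn by simp
        finally show ?thesis .
      qed
      have "real k / 2 - 1 / 2 \<le> real (k div 2)" by linarith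
      hence k2: "b * real n / (2 * ln (real n)) - 1 \<le> real (k div 2)" using kl by (simp add: field_simps)
      have k20: "0 \<le> b * real n / (2 * ln (real n)) - 1" using elim(2) by (simp add: field_simps)
      have "(1 - q / w\<^sup>2) ^ (k div 2) \<le> exp (- (q / w\<^sup>2)) ^ (k div 2)"
        using base0[OF n2] exp_ge_add_one_self[of "- (q / w\<^sup>2)"] by (intro power_mono) (auto simp: w_def)
      also have "\<dots> = exp (- (real (k div 2) * (q / w\<^sup>2)))" by (simp add: exp_of_nat_mult[symmetric])
      also have "\<dots> \<le> exp (- ((b * real n / (2 * ln (real n)) - 1) * (q / (real n powr (1/4) + 1)\<^sup>2)))"
      proof -
        have "(b * real n / (2 * ln (real n)) - 1) * (q / (real n powr (1/4) + 1)\<^sup>2) \<le> real (k div 2) * (q / w\<^sup>2)"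
          using k2 k20 wl w q by (intro mult_mono divide_left_mono power_mono mult_pos_pos) auto
        thus ?thesis by simp
      qed
      also have "\<dots> = exp (- q * (b * real n / (2 * ln (real n)) - 1) / (real n powr (1/4) + 1)\<^sup>2)"
      proof -
        have "exp (- (X * (q / Y))) = exp (- q * X / Y)" for X Y :: real by (simp add: mult.commute)
        thus ?thesis .
      qed
      finally have pw: "(1 - q / w\<^sup>2) ^ (k div 2) \<le> exp (- q * (b * real n / (2 * ln (real n)) - 1) / (real n powr (1/4) + 1)\<^sup>2)" .
      have p0: "0 \<le> (1 - q / w\<^sup>2) ^ (k div 2)" using base0[OF n2] by (simp add: w_def)
      have np: "0 < real n powr (1/4)" using n2 by simp
      have inner: "1 / w + 2 * w * (1 - q / w\<^sup>2) ^ (k div 2) \<le> 1 / real n powr (1/4) + 2 * (real n powr (1/4) + 1) *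
        exp (- q * (b * real n / (2 * ln (real n)) - 1) / (real n powr (1/4) + 1)\<^sup>2)"
        using wl w np by (intro add_mono mult_mono pw p0 divide_left_mono) auto
      have in0: "0 \<le> 1 / w + 2 * w * (1 - q / w\<^sup>2) ^ (k div 2)" using w p0 by simp
      have "real n * (1 / w + 2 * w * (1 - q / w\<^sup>2) ^ (k div 2)) / real k
        = real n / real k * (1 / w + 2 * w * (1 - q / w\<^sup>2) ^ (k div 2))" by simp
      also have "\<dots> \<le> ?g n"
        by (rule mult_mono[OF nk inner _ in0]) (use b lnn in auto)
      finally show ?case by (simp add: w_def k_def)
    qed
  qed
qed

section \<open>Concentration of the logarithmic potential\<close>

lemma iid_entries_measurable:
  assumes P: "prob_space P" and Phi: "iid_entries P n \<Phi> D" and ij: "i < n" "j < n"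
  shows "(\<lambda>\<omega>. \<Phi> \<omega> $$ (i, j)) \<in> borel_measurable P"
proof -
  interpret prob_space P by (rule P)
  show ?thesis using Phi ij by (auto simp: iid_entries_def indep_vars_def)
qed

lemma iid_entries_nn_integral:
  fixes h :: "complex \<Rightarrow> ennreal"
  assumes P: "prob_space P" and Phi: "iid_entries P n \<Phi> (distr Q borel (\<lambda>\<omega>. x \<omega> / of_real (sqrt (real n))))"
    and ij: "i < n" "j < n" and x[measurable]: "x \<in> borel_measurable Q" and h[measurable]: "h \<in> borel_measurable borel"
  shows "(\<integral>\<^sup>+\<omega>. h (\<Phi> \<omega> $$ (i, j)) \<partial>P) = (\<integral>\<^sup>+\<omega>. h (x \<omega> / of_real (sqrt (real n))) \<partial>Q)"
proof -
  note [measurable] = iid_entries_measurable[OF P Phi ij]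
  have "(\<integral>\<^sup>+\<omega>. h (\<Phi> \<omega> $$ (i, j)) \<partial>P) = (\<integral>\<^sup>+w. h w \<partial>distr P borel (\<lambda>\<omega>. \<Phi> \<omega> $$ (i, j)))"
    by (subst nn_integral_distr) auto
  also have "distr P borel (\<lambda>\<omega>. \<Phi> \<omega> $$ (i, j)) = distr Q borel (\<lambda>\<omega>. x \<omega> / of_real (sqrt (real n)))"
    using Phi ij by (simp add: iid_entries_def)
  also have "(\<integral>\<^sup>+w. h w \<partial>distr Q borel (\<lambda>\<omega>. x \<omega> / of_real (sqrt (real n)))) = (\<integral>\<^sup>+\<omega>. h (x \<omega> / of_real (sqrt (real n))) \<partial>Q)"
    by (subst nn_integral_distr) auto
  finally show ?thesis .
qed

lemma iid_entries_anticonc: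
  assumes P: "prob_space P" and Phi: "iid_entries P n \<Phi> (distr Q borel (\<lambda>\<omega>. x \<omega> / of_real (sqrt (real n))))"
    and ij: "i < n" "j < n" and x[measurable]: "x \<in> borel_measurable Q" and s: "s > 0"
    and ac: "anticonc Q x c p"
  shows "anticonc P (\<lambda>\<omega>. b + of_real s * \<Phi> \<omega> $$ (i, j)) (c * s / sqrt (real n)) p"
  unfolding anticonc_def
proof
  fix a
  note Phm[measurable] = iid_entries_measurable[OF P Phi ij]
  define r where "r = sqrt (real n)"
  have r: "r > 0" using ij by (simp add: r_def)
  define B where "B = ball ((a - b) / of_real s) (c / r)"
  have B[measurable]: "B \<in> sets borel" by (simp add: B_def)
  have iff: "cmod (b + of_real s * w - a) < c * s / r \<longleftrightarrow> w \<in> B" for w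
  proof -
    have "of_real s * ((a - b) / of_real s) = a - b" using s by simp
    hence "b + of_real s * w - a = of_real s * (w - (a - b) / of_real s)"
      by (simp only: right_diff_distrib[of "of_real s" w]) simp
    hence "cmod (b + of_real s * w - a) = s * cmod (w - (a - b) / of_real s)" using s by (simp add: norm_mult)
    moreover have "c * s / r = s * (c / r)" by simp
    ultimately show ?thesis using s by (simp add: B_def dist_norm norm_minus_commute del: times_divide_eq_right)
  qed
  have iff2: "w / of_real r \<in> B \<longleftrightarrow> cmod (w - (a - b) / of_real s * of_real r) < c" for w
  proof -
    have "w / of_real r - (a - b) / of_real s = (w - (a - b) / of_real s * of_real r) / of_real r" using r by (simp add: diff_divide_distrib)
    hence "cmod (w / of_real r - (a - b) / of_real s) = cmod (w - (a - b) / of_real s * of_real r) / r" using r by (simp add: norm_divide)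
    thus ?thesis using r by (simp add: B_def dist_norm norm_minus_commute divide_less_cancel)
  qed
  have "measure P {\<omega>\<in>space P. cmod (b + of_real s * \<Phi> \<omega> $$ (i, j) - a) < c * s / r} = measure (distr P borel (\<lambda>\<omega>. \<Phi> \<omega> $$ (i, j))) B"
    unfolding iff by (subst measure_distr) (auto intro!: arg_cong[where f = "measure P"])
  also have "distr P borel (\<lambda>\<omega>. \<Phi> \<omega> $$ (i, j)) = distr Q borel (\<lambda>\<omega>. x \<omega> / of_real r)"
    using Phi ij by (simp add: iid_entries_def r_def)
  also have "measure (distr Q borel (\<lambda>\<omega>. x \<omega> / of_real r)) B = measure Q {\<omega>\<in>space Q. x \<omega> / of_real r \<in> B}"
    by (subst measure_distr) (auto intro!: arg_cong[where f = "measure Q"])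
  also have "\<dots> \<le> p" unfolding iff2 using ac by (simp add: anticonc_def)
  finally show "measure P {\<omega>\<in>space P. cmod (b + of_real s * \<Phi> \<omega> $$ (i, j) - a) < c * s / sqrt (real n)} \<le> p"
    by (simp add: r_def)
qed

lemma iid_entries_l1:
  assumes P: "prob_space P" and Q: "prob_space Q" and x: "mean_zero_variance_one Q x"
    and Phi: "iid_entries P n \<Phi> (distr Q borel (\<lambda>\<omega>. x \<omega> / of_real (sqrt (real n))))" and n: "n > 0"
  shows "(\<integral>\<^sup>+\<omega>. ennreal (\<Sum>i<n. \<Sum>j<n. cmod (of_real (real n powr - \<gamma>) * \<Phi> \<omega> $$ (i, j))) \<partial>P) \<le> ennreal (real n powr (3 / 2 - \<gamma>))"
proof -
  have xm: "x \<in> borel_measurable Q" using x by (simp add: mean_zero_variance_one_def)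
  note Phm = iid_entries_measurable[OF P Phi]
  have one: "(\<integral>\<^sup>+\<omega>. ennreal (cmod (of_real (real n powr - \<gamma>) * \<Phi> \<omega> $$ (i, j))) \<partial>P) \<le> ennreal (real n powr (- \<gamma> - 1 / 2))"
    if ij: "i < n" "j < n" for i j
  proof -
    have "(\<integral>\<^sup>+\<omega>. ennreal (cmod (of_real (real n powr - \<gamma>) * \<Phi> \<omega> $$ (i, j))) \<partial>P)
      = (\<integral>\<^sup>+\<omega>. ennreal (cmod (of_real (real n powr - \<gamma>) * (x \<omega> / of_real (sqrt (real n))))) \<partial>Q)"
      by (rule iid_entries_nn_integral[OF P Phi ij xm, of "\<lambda>w. ennreal (cmod (of_real (real n powr - \<gamma>) * w))"]) measurable
    also have "\<dots> = (\<integral>\<^sup>+\<omega>. ennreal (real n powr - \<gamma> / sqrt (real n)) * ennreal (cmod (x \<omega>)) \<partial>Q)"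
      by (intro nn_integral_cong) (simp add: norm_mult norm_divide ennreal_mult'[symmetric])
    also have "\<dots> = ennreal (real n powr - \<gamma> / sqrt (real n)) * (\<integral>\<^sup>+\<omega>. ennreal (cmod (x \<omega>)) \<partial>Q)"
      by (rule nn_integral_cmult) (use xm in measurable)
    also have "\<dots> \<le> ennreal (real n powr - \<gamma> / sqrt (real n)) * 1"
      by (intro mult_left_mono mean_zero_variance_one_moments(1)[OF Q x]) auto
    also have "real n powr - \<gamma> / sqrt (real n) = real n powr (- \<gamma> - 1 / 2)"
      using n by (simp add: powr_diff powr_half_sqrt)
    finally show ?thesis by simp
  qed
  have m: "(\<lambda>\<omega>. ennreal (cmod (of_real (real n powr - \<gamma>) * \<Phi> \<omega> $$ (i, j)))) \<in> borel_measurable P"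
    if ij: "i < n" "j < n" for i j
  proof -
    note [measurable] = Phm[OF ij]
    show ?thesis by measurable
  qed
  have "(\<integral>\<^sup>+\<omega>. ennreal (\<Sum>i<n. \<Sum>j<n. cmod (of_real (real n powr - \<gamma>) * \<Phi> \<omega> $$ (i, j))) \<partial>P)
    = (\<integral>\<^sup>+\<omega>. (\<Sum>i<n. \<Sum>j<n. ennreal (cmod (of_real (real n powr - \<gamma>) * \<Phi> \<omega> $$ (i, j)))) \<partial>P)"
    by (intro nn_integral_cong) (simp add: sum_ennreal sum_nonneg)
  also have "\<dots> = (\<Sum>i<n. \<integral>\<^sup>+\<omega>. (\<Sum>j<n. ennreal (cmod (of_real (real n powr - \<gamma>) * \<Phi> \<omega> $$ (i, j)))) \<partial>P)"
    by (intro nn_integral_sum borel_measurable_sum m) auto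
  also have "\<dots> = (\<Sum>i<n. \<Sum>j<n. \<integral>\<^sup>+\<omega>. ennreal (cmod (of_real (real n powr - \<gamma>) * \<Phi> \<omega> $$ (i, j))) \<partial>P)"
    by (intro sum.cong refl nn_integral_sum m) auto
  also have "\<dots> \<le> (\<Sum>i<n. \<Sum>j<n. ennreal (real n powr (- \<gamma> - 1 / 2)))" by (intro sum_mono one) auto
  also have "\<dots> = ennreal (\<Sum>i<n. \<Sum>j<n. real n powr (- \<gamma> - 1 / 2))" by (simp only: sum_ennreal sum_nonneg powr_ge_zero)
  also have "(\<Sum>i<n. \<Sum>j<n. real n powr (- \<gamma> - 1 / 2)) = real n powr 2 * real n powr (- \<gamma> - 1 / 2)"
    using n by (simp add: powr_numeral power2_eq_square)
  also have "\<dots> = real n powr (3 / 2 - \<gamma>)" unfolding powr_add[symmetric] by (simp add: algebra_simps)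
  finally show ?thesis .
qed

lemma log_ratio_tendsto: "(\<lambda>n. C * ln (real n) / ln (real n) powr 1.1) \<longlonglongrightarrow> 0"
  by real_asymp

lemma log_potential_concentrates:
  fixes M N' :: "nat \<Rightarrow> complex mat" and P :: "nat \<Rightarrow> 'w measure" and \<Phi> :: "nat \<Rightarrow> 'w \<Rightarrow> complex mat"
    and \<gamma> K :: real and z :: complex and S :: "nat \<Rightarrow> nat set" and \<epsilon> :: "nat \<Rightarrow> real"
  assumes M: "\<And>n. M n \<in> carrier_mat n n"
    and M_bound: "\<And>n. n > 0 \<Longrightarrow> (\<Sum>i<n. \<Sum>j<n. (cmod (M n $$ (i, j)))\<^sup>2) \<le> K * real n"
    and x: "prob_space Q" "mean_zero_variance_one Q x"
    and P: "\<And>n. prob_space (P n)"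
    and Phi: "\<And>n. iid_entries (P n) n (\<Phi> n) (distr Q borel (\<lambda>\<omega>. x \<omega> / of_real (sqrt (real n))))"
    and \<gamma>: "\<gamma> > 3 / 2"
    and S: "\<And>n. n \<ge> 2 \<Longrightarrow> S n \<subseteq> {..<n}"
    and card: "\<And>n. n \<ge> 2 \<Longrightarrow> real (card (S n)) \<ge> real n - real n / ln (real n) powr 1.1"
    and \<epsilon>: "\<And>n. 0 < \<epsilon> n"
    and lim: "(\<lambda>n. real n powr (3 / 4 - \<gamma> / 2) * ln (real n) / \<epsilon> n) \<longlonglongrightarrow> 0"
    and N': "\<And>n. n \<ge> 2 \<Longrightarrow> N' n \<in> carrier_mat n n"
    and rows: "\<And>n i k. n \<ge> 2 \<Longrightarrow> i \<in> S n \<Longrightarrow> k < n \<Longrightarrow> N' n $$ (i, k) = (M n + z \<cdot>\<^sub>m 1\<^sub>m n) $$ (i, k)"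
    and unit: "\<And>n i. n \<ge> 2 \<Longrightarrow> i \<in> {..<n} - S n \<Longrightarrow> l2 n (\<lambda>k. N' n $$ (i, k)) = 1"
    and st: "\<And>n. n \<ge> 2 \<Longrightarrow> rows_stable n (min (\<epsilon> n) 1) (\<lambda>i k. N' n $$ (i, k)) {..<n}"
    and \<delta>: "\<delta> > 0"
  shows "(\<lambda>n. measure (P n) {\<omega>\<in>space (P n). \<delta> \<le> \<bar>log_potential n (M n + of_real (real n powr - \<gamma>) \<cdot>\<^sub>m \<Phi> n \<omega>) z
      - ln (cmod (Determinant.det (N' n))) / n\<bar>}) \<longlonglongrightarrow> 0"
proof -
  have xm: "x \<in> borel_measurable Q" using x(2) by (simp add: mean_zero_variance_one_def)
  obtain c0 p where c0: "c0 > 0" and p: "p < 1" "1 / 2 \<le> p" and ac: "anticonc Q x c0 p"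
    using anticonc_exists[OF x] by blast
  define b where "b = ln (1 / p) / (2 * (2 * \<gamma> + 9))"
  have b: "b > 0" using p \<gamma> by (simp add: b_def)
  define q where "q = (1 - p) / 2"
  have q: "0 < q" "q \<le> 1" using p by (auto simp: q_def)
  define \<epsilon>' where "\<epsilon>' n = min (\<epsilon> n) 1" for n
  have \<epsilon>': "0 < \<epsilon>' n" "\<epsilon>' n \<le> 1" for n using \<epsilon>[of n] by (auto simp: \<epsilon>'_def)
  define \<delta>1 where "\<delta>1 = min \<delta> 1"
  have \<delta>1: "0 < \<delta>1" "\<delta>1 \<le> 1" "\<delta>1 \<le> \<delta>" using \<delta> by (auto simp: \<delta>1_def)
  define a where "a n = \<epsilon>' n * \<delta>1 / 4" for n
  have a: "0 < a n" "a n \<le> \<epsilon>' n / 2" "a n \<le> 1" for n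
  proof -
    show "0 < a n" using \<epsilon>'(1)[of n] \<delta>1 by (simp add: a_def)
    have "\<epsilon>' n * \<delta>1 \<le> \<epsilon>' n * 1" using \<epsilon>'(1)[of n] \<delta>1 by (intro mult_left_mono) auto
    hence "\<epsilon>' n * \<delta>1 / 4 \<le> \<epsilon>' n / 2" "\<epsilon>' n * \<delta>1 / 4 \<le> 1" using \<epsilon>'[of n] by linarith+
    thus "a n \<le> \<epsilon>' n / 2" "a n \<le> 1" by (simp_all only: a_def)
  qed
  define u where "u n = real n powr (3 / 4 - \<gamma> / 2) * ln (real n) / \<epsilon> n" for n
  have u: "u \<longlonglongrightarrow> 0" using lim unfolding u_def[abs_def] .
  let ?t1 = "\<lambda>n. real (n + 1) * (real ((n * card (grid (real n powr (-\<gamma>-3)))) ^ sparse_level b n) * p ^ (n - 1))"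
  let ?t2 = "\<lambda>n. real n * (1 / real (window_level n) + 2 * real (window_level n) *
      (1 - q / (real (window_level n))\<^sup>2) ^ (sparse_level b n div 2)) / real (sparse_level b n)"
  have t1: "?t1 \<longlonglongrightarrow> 0" unfolding b_def by (rule sparse_term_tendsto) (use p \<gamma> in auto)
  have t2: "?t2 \<longlonglongrightarrow> 0" by (rule window_term_tendsto[OF q b])
  have f0: "(\<lambda>n. real n powr (3 / 2 - \<gamma>)) \<longlonglongrightarrow> 0" using \<gamma> by real_asymp
  have f1: "(\<lambda>n. real n powr (3 / 2 - \<gamma>) / a n) \<longlonglongrightarrow> 0"
  proof (rule tendsto_sandwich[OF _ _ tendsto_const])
    show "eventually (\<lambda>n. 0 \<le> real n powr (3 / 2 - \<gamma>) / a n) sequentially"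
      using a(1) by (intro always_eventually allI divide_nonneg_nonneg) (auto intro: less_imp_le)
    have "(\<lambda>n. real n powr (3 / 4 - \<gamma> / 2)) \<longlonglongrightarrow> 0" using \<gamma> by real_asymp
    hence "(\<lambda>n. (4 / \<delta>1) * (real n powr (3 / 2 - \<gamma>) + real n powr (3 / 4 - \<gamma> / 2) * u n)) \<longlonglongrightarrow> (4 / \<delta>1) * (0 + 0 * 0)"
      by (intro tendsto_intros f0 u)
    thus "(\<lambda>n. (4 / \<delta>1) * (real n powr (3 / 2 - \<gamma>) + real n powr (3 / 4 - \<gamma> / 2) * u n)) \<longlonglongrightarrow> 0" by simp
    show "eventually (\<lambda>n. real n powr (3 / 2 - \<gamma>) / a n \<le> (4 / \<delta>1) * (real n powr (3 / 2 - \<gamma>) + real n powr (3 / 4 - \<gamma> / 2) * u n)) sequentially"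
      using eventually_ge_at_top[of 3]
    proof eventually_elim
      case (elim n)
      have ln1: "1 \<le> ln (real n)"
        using elim exp_le by (subst ln_ge_iff) (auto intro: order_trans)
      define y where "y = real n powr (3 / 2 - \<gamma>)"
      have y: "y \<ge> 0" "y = real n powr (3 / 4 - \<gamma> / 2) * real n powr (3 / 4 - \<gamma> / 2)"
        by (auto simp: y_def powr_add[symmetric])
      have "1 / \<epsilon>' n \<le> 1 + 1 / \<epsilon> n" using \<epsilon>[of n] by (auto simp: \<epsilon>'_def min_def)
      hence "y * (1 / \<epsilon>' n) \<le> y * (1 + 1 / \<epsilon> n)" using y by (intro mult_left_mono)
      also have "\<dots> = y + real n powr (3 / 4 - \<gamma> / 2) * (real n powr (3 / 4 - \<gamma> / 2) * 1 / \<epsilon> n)"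
        unfolding y(2) by (simp add: field_simps)
      also have "\<dots> \<le> y + real n powr (3 / 4 - \<gamma> / 2) * u n"
        unfolding u_def using ln1 \<epsilon>[of n] by (intro add_left_mono mult_left_mono divide_right_mono) auto
      finally have "(4 / \<delta>1) * (y * (1 / \<epsilon>' n)) \<le> (4 / \<delta>1) * (y + real n powr (3 / 4 - \<gamma> / 2) * u n)"
        using \<delta>1 by (intro mult_left_mono) auto
      moreover have "y / a n = (4 / \<delta>1) * (y * (1 / \<epsilon>' n))" by (simp add: a_def mult.commute)
      ultimately show ?case by (simp add: y_def)
    qed
  qed
  have L: "(\<lambda>n. (4 * \<gamma> + 14) * ln (real n) / ln (real n) powr 1.1) \<longlonglongrightarrow> 0" by (rule log_ratio_tendsto)
  have total: "(\<lambda>n. real n powr (3 / 2 - \<gamma>) / a n + (real n powr (3 / 2 - \<gamma>) + ?t1 n + ?t2 n)) \<longlonglongrightarrow> 0 + (0 + 0 + 0)"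
    by (intro tendsto_add f1 f0 t1 t2)
  have ev1: "eventually (\<lambda>n. (K + 1) / 2 * real n powr (3 / 2) + real n * cmod z + 1 \<le> (real n)\<^sup>2) sequentially"
    by real_asymp
  have ev2: "eventually (\<lambda>n. 16 / c0 \<le> real n powr (1 / 2)) sequentially" using c0 by real_asymp
  have ev3: "eventually (\<lambda>n. 1 \<le> b * real n / ln (real n)) sequentially" using b by real_asymp
  have ev4: "eventually (\<lambda>n. u n < 1) sequentially" by (rule order_tendstoD(2)[OF u]) simp
  have ev5: "eventually (\<lambda>n. (4 * \<gamma> + 14) * ln (real n) / ln (real n) powr 1.1 < \<delta> / 2) sequentially"
    by (rule order_tendstoD(2)[OF L]) (use \<delta> in simp)
  have main: "eventually (\<lambda>n. measure (P n) {\<omega>\<in>space (P n). \<delta> \<le> \<bar>log_potential n (M n + of_real (real n powr - \<gamma>) \<cdot>\<^sub>m \<Phi> n \<omega>) z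
      - ln (cmod (Determinant.det (N' n))) / n\<bar>} \<le> real n powr (3 / 2 - \<gamma>) / a n + (real n powr (3 / 2 - \<gamma>) + ?t1 n + ?t2 n)) sequentially"
    using eventually_ge_at_top[of 5] ev1 ev2 ev3 ev4 ev5
  proof eventually_elim
    case (elim n)
    interpret prob_space "P n" by (rule P)
    have n5: "real n \<ge> 5" and n2: "n \<ge> 2" and n0: "n > 0" using elim(1) by auto
    define s where "s = real n powr - \<gamma>"
    have s: "s > 0" using n0 by (simp add: s_def)
    define N where "N = M n + z \<cdot>\<^sub>m 1\<^sub>m n"
    have N: "N \<in> carrier_mat n n" using M[of n] by (simp add: N_def)
    define E where "E \<omega> i k = of_real s * \<Phi> n \<omega> $$ (i, k)" for \<omega> i k
    define W where "W i k \<omega> = N $$ (i, k) + of_real s * \<Phi> n \<omega> $$ (i, k)" for i k \<omega>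
    define T where "T \<omega> = (\<Sum>i<n. \<Sum>k<n. cmod (E \<omega> i k))" for \<omega>
    note Phm = iid_entries_measurable[OF P[of n] Phi[of n]]
    have Tm[measurable]: "T \<in> borel_measurable (P n)"
      unfolding T_def[abs_def] E_def
      by (intro borel_measurable_sum measurable_compose[OF _ borel_measurable_norm] borel_measurable_times borel_measurable_const Phm) auto
    have markov: "prob {\<omega>\<in>space (P n). r < T \<omega>} \<le> real n powr (3 / 2 - \<gamma>) / r" if r: "r > 0" for r
    proof -
      have "emeasure (P n) {\<omega>\<in>space (P n). r < T \<omega>} \<le> emeasure (P n) {\<omega>\<in>space (P n). 1 \<le> ennreal (1 / r) * ennreal (T \<omega>)}"
      proof (rule emeasure_mono)
        show "{\<omega>\<in>space (P n). r < T \<omega>} \<subseteq> {\<omega>\<in>space (P n). 1 \<le> ennreal (1 / r) * ennreal (T \<omega>)}"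
        proof safe
          fix \<omega> assume "r < T \<omega>"
          hence "1 \<le> (1 / r) * T \<omega>" using r by (simp add: field_simps)
          hence "ennreal 1 \<le> ennreal ((1 / r) * T \<omega>)" by (rule ennreal_leI)
          thus "1 \<le> ennreal (1 / r) * ennreal (T \<omega>)" using r by (subst ennreal_mult'[symmetric]) auto
        qed
      qed measurable
      also have "\<dots> \<le> ennreal (1 / r) * (\<integral>\<^sup>+\<omega>. ennreal (T \<omega>) * indicator (space (P n)) \<omega> \<partial>P n)"
        by (rule nn_integral_Markov_inequality) auto
      also have "(\<integral>\<^sup>+\<omega>. ennreal (T \<omega>) * indicator (space (P n)) \<omega> \<partial>P n) = (\<integral>\<^sup>+\<omega>. ennreal (T \<omega>) \<partial>P n)"
        by (intro nn_integral_cong) auto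
      also have "ennreal (1 / r) * (\<integral>\<^sup>+\<omega>. ennreal (T \<omega>) \<partial>P n) \<le> ennreal (1 / r) * ennreal (real n powr (3 / 2 - \<gamma>))"
        unfolding T_def E_def s_def by (intro mult_left_mono iid_entries_l1[OF P x Phi n0]) auto
      also have "\<dots> = ennreal (real n powr (3 / 2 - \<gamma>) / r)" using r by (simp add: ennreal_mult'[symmetric])
      finally show ?thesis using r by (simp add: emeasure_eq_measure)
    qed
    have sumN: "(\<Sum>i<n. \<Sum>k<n. cmod (N $$ (i, k))) + 1 \<le> (real n)\<^sup>2"
    proof -
      define h where "h = sqrt (real n)"
      have h: "h > 0" "h * h = real n" using n0 by (auto simp: h_def)
      have am: "t \<le> (h * t\<^sup>2 + 1 / h) / 2" for t
      proof -
        have "0 \<le> (h * t - 1)\<^sup>2 / h" using h by simp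
        also have "(h * t - 1)\<^sup>2 / h = h * t\<^sup>2 - 2 * t + 1 / h" using h by (simp add: power2_eq_square field_simps)
        finally show ?thesis by simp
      qed
      have "(\<Sum>i<n. \<Sum>k<n. cmod (N $$ (i, k))) \<le> (\<Sum>i<n. \<Sum>k<n. cmod (M n $$ (i, k)) + (if i = k then cmod z else 0))"
      proof (intro sum_mono)
        fix i k assume "i \<in> {..<n}" "k \<in> {..<n}"
        hence "N $$ (i, k) = M n $$ (i, k) + (if i = k then z else 0)" using M[of n] by (auto simp: N_def)
        thus "cmod (N $$ (i, k)) \<le> cmod (M n $$ (i, k)) + (if i = k then cmod z else 0)"
          using norm_triangle_ineq[of "M n $$ (i, k)" "if i = k then z else 0"] by (auto split: if_splits)
      qed
      also have "\<dots> = (\<Sum>i<n. \<Sum>k<n. cmod (M n $$ (i, k))) + real n * cmod z"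
        by (simp add: sum.distrib)
      also have "(\<Sum>i<n. \<Sum>k<n. cmod (M n $$ (i, k))) \<le> (\<Sum>i<n. \<Sum>k<n. (h * (cmod (M n $$ (i, k)))\<^sup>2 + 1 / h) / 2)"
        by (intro sum_mono am)
      also have "\<dots> = (h * (\<Sum>i<n. \<Sum>k<n. (cmod (M n $$ (i, k)))\<^sup>2) + real n * real n / h) / 2"
        by (simp add: sum.distrib sum_distrib_left sum_divide_distrib[symmetric])
      also have "\<dots> \<le> (h * (K * real n) + real n * real n / h) / 2"
        using M_bound[OF n0] h by (intro divide_right_mono add_right_mono mult_left_mono) auto
      also have "real n * real n / h = h * real n" using h by (metis nonzero_mult_div_cancel_left mult.assoc less_irrefl)
      also have "(h * (K * real n) + h * real n) / 2 = (K + 1) / 2 * (h * real n)" by (simp add: algebra_simps)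
      also have "h * real n = real n powr (3 / 2)"
        using n0 powr_add[of "real n" "1/2" 1] by (simp add: h_def powr_half_sqrt)
      finally show ?thesis using elim(2) by simp
    qed
    have WNE: "cmod (W i k \<omega>) \<le> cmod (N $$ (i, k)) + cmod (E \<omega> i k)" for i k \<omega>
      unfolding W_def E_def by (rule norm_triangle_ineq)
    have sumW: "(\<Sum>i<n. \<Sum>k<n. cmod (W i k \<omega>)) \<le> (real n)\<^sup>2" if "T \<omega> \<le> 1" for \<omega>
    proof -
      have "(\<Sum>i<n. \<Sum>k<n. cmod (W i k \<omega>)) \<le> (\<Sum>i<n. \<Sum>k<n. cmod (N $$ (i, k)) + cmod (E \<omega> i k))"
        by (intro sum_mono WNE)
      also have "\<dots> = (\<Sum>i<n. \<Sum>k<n. cmod (N $$ (i, k))) + T \<omega>" by (simp add: sum.distrib T_def)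
      finally show ?thesis using sumN that by linarith
    qed
    define c where "c = c0 * s / sqrt (real n)"
    have c: "c > 0" using c0 s n0 by (simp add: c_def)
    have cpow: "c = c0 * real n powr (- \<gamma> - 1 / 2)" using n0 by (simp add: c_def s_def powr_diff powr_half_sqrt)
    have acW: "anticonc (P n) (W i k) c p" if "i < n" "k < n" for i k
      unfolding W_def[abs_def] c_def by (rule iid_entries_anticonc[OF P Phi that xm s ac])
    have indPhi: "indep_vars (\<lambda>_. borel) (\<lambda>ij \<omega>. \<Phi> n \<omega> $$ ij) ({..<n} \<times> {..<n})"
      using Phi[of n] by (simp add: iid_entries_def)
    have indW: "indep_vars (\<lambda>_. borel) (\<lambda>(i, j). W i j) ({..<n} \<times> {..<n})"
    proof -
      have "indep_vars (\<lambda>_. borel) (\<lambda>ij \<omega>. N $$ ij + of_real s * \<Phi> n \<omega> $$ ij) ({..<n} \<times> {..<n})"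
        by (rule indep_vars_compose2[OF indPhi, of "\<lambda>ij w. N $$ ij + of_real s * w"]) measurable
      thus ?thesis by (rule indep_vars_cong[THEN iffD1, rotated 3]) (auto simp: W_def)
    qed
    define \<tau> m t0 t where "\<tau> = real n powr (-\<gamma>-3)" and "m = real n powr (-3*\<gamma>-11)" and "t0 = real n powr (-3*\<gamma>-9)" and "t = real n powr (-3*\<gamma>-8)"
    note defs = \<tau>_def m_def t0_def t_def
    have nmul: "real n powr e * real n = real n powr (e + 1)" for e
      using n0 by (simp add: powr_add)
    have nmul2: "real n powr e * (real n)\<^sup>2 = real n powr (e + 2)" for e
      using n0 by (simp add: powr_add powr_numeral)
    have pm: "real n powr e \<le> real n powr e'" if "e \<le> e'" for e e'
      using that n5 by (intro powr_mono) auto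
    have half: "real n powr e * real n powr (1 / 2) = real n powr (e + 1 / 2)" for e
      by (simp add: powr_add)
    have shift1: "- \<gamma> - 3 + 2 = - \<gamma> - 1" and shift2: "- 3 * \<gamma> - 8 + 1 = - 3 * \<gamma> - 7" by simp_all
    have \<tau>14: "\<tau> \<le> 1 / 4"
    proof -
      have "\<tau> \<le> real n powr (-1)" unfolding \<tau>_def using \<gamma> by (intro pm) auto
      also have "\<dots> = 1 / real n" using n0 by (simp add: powr_minus_divide)
      also have "\<dots> \<le> 1 / 4" using n5 by (intro divide_left_mono) auto
      finally show ?thesis .
    qed
    have m4: "4 * m \<le> \<tau>"
    proof -
      have "4 * m \<le> real n * m" using n5 by (intro mult_right_mono) (auto simp: m_def)
      also have "\<dots> = real n powr (-3*\<gamma>-10)" using nmul[of "-3*\<gamma>-11"] by (simp add: m_def algebra_simps)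
      also have "\<dots> \<le> \<tau>" unfolding \<tau>_def using \<gamma> by (intro pm) auto
      finally show ?thesis .
    qed
    have c1: "t0 + 2 * \<tau> * (real n)\<^sup>2 < 1 / 2 * c"
    proof -
      have "t0 \<le> real n powr (-\<gamma>-1)" unfolding t0_def using \<gamma> by (intro pm) auto
      moreover have "2 * \<tau> * (real n)\<^sup>2 = 2 * real n powr (-\<gamma>-1)" unfolding \<tau>_def mult.assoc nmul2 by (simp add: shift1)
      ultimately have "t0 + 2 * \<tau> * (real n)\<^sup>2 \<le> 3 * real n powr (-\<gamma>-1)" by simp
      also have "\<dots> < 8 * real n powr (-\<gamma>-1)" using n0 by simp
      also have "\<dots> = (16 / c0) * (c0 / 2 * real n powr (-\<gamma>-1))" using c0 by simp
      also have "\<dots> \<le> real n powr (1 / 2) * (c0 / 2 * real n powr (-\<gamma>-1))"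
        using elim(3) c0 by (intro mult_right_mono) auto
      also have "\<dots> = c0 / 2 * (real n powr (-\<gamma>-1) * real n powr (1 / 2))" by simp
      also have "\<dots> = 1 / 2 * c" unfolding half cpow by (simp add: algebra_simps)
      finally show ?thesis .
    qed
    have c2: "t0 + 2 * m * (real n)\<^sup>2 < t"
    proof -
      have "t0 + 2 * m * (real n)\<^sup>2 = 3 * t0" using nmul2[of "-3*\<gamma>-11"] by (simp add: m_def t0_def algebra_simps)
      also have "\<dots> < real n * t0" using n5 n0 by (intro mult_strict_right_mono) (auto simp: t0_def)
      also have "\<dots> = t" using nmul[of "-3*\<gamma>-9"] by (simp add: t_def t0_def algebra_simps)
      finally show ?thesis .
    qed
    have c3: "16 * real n * t \<le> \<tau>\<^sup>2 * c"
    proof -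
      have "16 * real n * t = 16 * real n powr (-3*\<gamma>-7)" unfolding t_def mult.assoc mult.commute[of "real n" "_ powr _"] nmul shift2 by (rule refl)
      also have "\<dots> = (16 / c0) * (c0 * real n powr (-3*\<gamma>-7))" using c0 by simp
      also have "\<dots> \<le> real n powr (1 / 2) * (c0 * real n powr (-3*\<gamma>-7))"
        using elim(3) c0 by (intro mult_right_mono) auto
      also have "\<dots> = c0 * (real n powr (-3*\<gamma>-7) * real n powr (1 / 2))" by simp
      also have "\<dots> = \<tau>\<^sup>2 * c"
        unfolding half cpow \<tau>_def power2_eq_square by (simp add: powr_add[symmetric] algebra_simps)
      finally show ?thesis .
    qed
    have k0: "sparse_level b n > 0" using elim(4) unfolding sparse_level_def by linarith
    have R0: "window_level n > 0"
    proof -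
      have "0 < real n powr (1/4)" using n0 by simp
      thus ?thesis unfolding window_level_def by linarith
    qed
    have "\<exists>Bad\<in>events. prob Bad \<le> prob {\<omega>\<in>space (P n). (real n)\<^sup>2 < (\<Sum>i<n. \<Sum>j<n. cmod (W i j \<omega>))}
       + real (n + 1) * (real ((n * card (grid \<tau>)) ^ sparse_level b n) * p ^ (n - 1))
       + real n * (1 / real (window_level n) + 2 * real (window_level n) * (1 - (1 - p) / 2 / (real (window_level n))\<^sup>2) ^ (sparse_level b n div 2)) / real (sparse_level b n) \<and>
     (\<forall>\<omega>\<in>space (P n) - Bad. \<forall>v. (\<forall>i<n. cmod (v i) \<le> 1) \<longrightarrow> (\<exists>i<n. cmod (v i) = 1) \<longrightarrow>
        (\<exists>i<n. t0 < cmod (\<Sum>j<n. v j * W i j \<omega>)))"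
      by (rule smallest_singular_value[OF indW acW c _ _ n0 _ _ \<tau>14 _ m4 _ k0 R0 c1 c2 c3])
        (use p n0 in \<open>auto simp: defs\<close>)
    then obtain Bad where Bad: "Bad \<in> events"
      "prob Bad \<le> prob {\<omega>\<in>space (P n). (real n)\<^sup>2 < (\<Sum>i<n. \<Sum>j<n. cmod (W i j \<omega>))} + ?t1 n + ?t2 n"
      "\<And>\<omega> v. \<omega> \<in> space (P n) \<Longrightarrow> \<omega> \<notin> Bad \<Longrightarrow> \<forall>i<n. cmod (v i) \<le> 1 \<Longrightarrow> \<exists>i<n. cmod (v i) = 1 \<Longrightarrow>
        \<exists>i<n. t0 < cmod (\<Sum>j<n. v j * W i j \<omega>)"
      unfolding \<tau>_def q_def by blast
    have "prob {\<omega>\<in>space (P n). (real n)\<^sup>2 < (\<Sum>i<n. \<Sum>j<n. cmod (W i j \<omega>))} \<le> prob {\<omega>\<in>space (P n). 1 < T \<omega>}"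
    proof (rule finite_measure_mono)
      show "{\<omega>\<in>space (P n). (real n)\<^sup>2 < (\<Sum>i<n. \<Sum>j<n. cmod (W i j \<omega>))} \<subseteq> {\<omega>\<in>space (P n). 1 < T \<omega>}"
        using sumW by (force simp: not_le[symmetric])
    qed measurable
    also have "\<dots> \<le> real n powr (3 / 2 - \<gamma>)" using markov[of 1] by simp
    finally have pBad: "prob Bad \<le> real n powr (3 / 2 - \<gamma>) + ?t1 n + ?t2 n" using Bad(2) by linarith
    let ?A = "\<lambda>\<omega>. M n + of_real (real n powr - \<gamma>) \<cdot>\<^sub>m \<Phi> n \<omega>"
    have good: "\<bar>log_potential n (?A \<omega>) z - ln (cmod (Determinant.det (N' n))) / n\<bar> < \<delta>"
      if \<omega>: "\<omega> \<in> space (P n)" "T \<omega> \<le> a n" "\<omega> \<notin> Bad" for \<omega>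
    proof -
      have Phc: "\<Phi> n \<omega> \<in> carrier_mat n n" using Phi[of n] \<omega>(1) by (auto simp: iid_entries_def)
      let ?W = "?A \<omega> + z \<cdot>\<^sub>m 1\<^sub>m n"
      have Wc: "?W \<in> carrier_mat n n" using M[of n] Phc by auto
      have Wij: "?W $$ (i, k) = W i k \<omega>" if "i < n" "k < n" for i k
        using that M[of n] Phc by (auto simp: W_def N_def s_def)
      have T1: "T \<omega> \<le> 1" using \<omega>(2) a(3)[of n] by linarith
      define \<kappa> where "\<kappa> = t0 / real n"
      have t0p: "0 < t0" using n0 by (simp add: t0_def)
      have t01: "t0 \<le> 1" unfolding t0_def using \<gamma> pm[of "-3*\<gamma>-9" 0] n0 by simp
      have \<kappa>: "0 < \<kappa>" "\<kappa> \<le> 1" using t0p t01 n5 by (auto simp: \<kappa>_def divide_le_eq)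
      have stW: "rows_stable n \<kappa> (\<lambda>i k. ?W $$ (i, k)) {..<n}"
        unfolding \<kappa>_def
      proof (rule rows_stable_of_kernel_bound[OF Wc n0 t0p])
        fix v :: "nat \<Rightarrow> complex"
        assume v: "\<forall>i<n. cmod (v i) \<le> 1" "\<exists>i<n. cmod (v i) = 1"
        obtain i where i: "i < n" "t0 < cmod (\<Sum>j<n. v j * W i j \<omega>)" using Bad(3)[OF \<omega>(1,3) v] by blast
        have "(\<Sum>j<n. v j * W i j \<omega>) = (\<Sum>j<n. v j * ?W $$ (i, j))" using Wij[OF i(1)] by (intro sum.cong) auto
        thus "\<exists>i<n. t0 < cmod (\<Sum>j<n. v j * ?W $$ (i, j))" using i by auto
      qed
      have rowH: "l2 n (\<lambda>k. ?W $$ (i, k)) \<le> (real n)\<^sup>2" if i: "i < n" for i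
      proof -
        have "l2 n (\<lambda>k. ?W $$ (i, k)) = l2 n (\<lambda>k. W i k \<omega>)" using Wij[OF i] by (intro L2_set_cong) auto
        also have "\<dots> \<le> (\<Sum>k<n. cmod (W i k \<omega>))" by (rule l2_le_sum)
        also have "\<dots> \<le> (\<Sum>i<n. \<Sum>k<n. cmod (W i k \<omega>))"
          by (rule member_le_sum[of i _ "\<lambda>i. \<Sum>k<n. cmod (W i k \<omega>)"]) (use i in \<open>auto intro: sum_nonneg\<close>)
        finally show ?thesis using sumW[OF T1] by linarith
      qed
      have near: "?W $$ (i, k) - N' n $$ (i, k) = E \<omega> i k" if "i \<in> S n" "k < n" for i k
      proof -
        have i: "i < n" using that(1) S[OF n2] by auto
        show ?thesis unfolding rows[OF n2 that] Wij[OF i that(2)] by (simp add: W_def E_def N_def)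
      qed
      note cmp = log_det_compare[OF N'[OF n2] Wc S[OF n2] n0 near unit[OF n2] st[OF n2, folded \<epsilon>'_def] \<epsilon>'(1,2) stW \<kappa> \<omega>(2)[unfolded T_def] a(2) rowH]
      have H1: "1 \<le> (real n)\<^sup>2" using n5 by (intro one_le_power) auto
      let ?d = "ln (cmod (Determinant.det ?W)) - ln (cmod (Determinant.det (N' n)))"
      have D: "\<bar>?d\<bar> \<le> 2 * real n * a n / \<epsilon>' n + real (n - card (S n)) * (ln (real n * (real n)\<^sup>2 / \<epsilon>' n) + ln (real n / \<kappa>))"
        by (rule cmp(2)) (use H1 in auto)
      have \<epsilon>low: "real n powr (- \<gamma>) \<le> \<epsilon>' n"
      proof -
        have ln1: "1 \<le> ln (real n)" using n5 exp_le by (subst ln_ge_iff) (auto intro: order_trans)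
        have "real n powr (- \<gamma>) \<le> real n powr (3 / 4 - \<gamma> / 2) * 1" using \<gamma> pm[of "-\<gamma>" "3/4 - \<gamma>/2"] by simp
        also have "\<dots> \<le> real n powr (3 / 4 - \<gamma> / 2) * ln (real n)" using ln1 by (intro mult_left_mono) auto
        also have "\<dots> \<le> \<epsilon> n" using elim(5) \<epsilon>[of n] by (simp add: u_def divide_less_eq)
        finally have "real n powr (- \<gamma>) \<le> \<epsilon> n" .
        moreover have "real n powr (- \<gamma>) \<le> 1" using pm[of "-\<gamma>" 0] \<gamma> n0 by simp
        ultimately show ?thesis by (simp add: \<epsilon>'_def)
      qed
      have l1: "ln (real n * (real n)\<^sup>2 / \<epsilon>' n) \<le> (3 + \<gamma>) * ln (real n)"
      proof -
        have "- \<gamma> * ln (real n) \<le> ln (\<epsilon>' n)"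
        proof -
          have "ln (real n powr (- \<gamma>)) \<le> ln (\<epsilon>' n)" using \<epsilon>low n0 by (intro ln_mono) auto
          thus ?thesis using n0 by (simp add: ln_powr)
        qed
        moreover have "ln (real n * (real n)\<^sup>2 / \<epsilon>' n) = 3 * ln (real n) - ln (\<epsilon>' n)"
          using n0 \<epsilon>'(1)[of n] by (simp add: ln_div ln_mult ln_realpow)
        ultimately show ?thesis by (simp add: algebra_simps)
      qed
      have l2: "ln (real n / \<kappa>) = (3 * \<gamma> + 11) * ln (real n)"
      proof -
        have "real n / \<kappa> = real n * real n / t0" by (simp add: \<kappa>_def)
        hence "ln (real n / \<kappa>) = 2 * ln (real n) - ln t0" using n0 t0p by (simp add: ln_div ln_mult)
        also have "ln t0 = (-3*\<gamma>-9) * ln (real n)" using n0 by (simp add: t0_def ln_powr)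
        finally show ?thesis by (simp add: algebra_simps)
      qed
      have lnn: "0 \<le> ln (real n)" using n5 by simp
      have "card (S n) \<le> n" using card_mono[OF _ S[OF n2]] by simp
      hence cardS: "real (n - card (S n)) \<le> real n / ln (real n) powr 1.1"
        using card[OF n2] by (simp add: of_nat_diff)
      have "real (n - card (S n)) * (ln (real n * (real n)\<^sup>2 / \<epsilon>' n) + ln (real n / \<kappa>))
        \<le> real (n - card (S n)) * ((4 * \<gamma> + 14) * ln (real n))"
      proof (rule mult_left_mono)
        show "ln (real n * (real n)\<^sup>2 / \<epsilon>' n) + ln (real n / \<kappa>) \<le> (4 * \<gamma> + 14) * ln (real n)"
          using l1 l2 by (simp add: algebra_simps)
      qed simp
      also have "\<dots> \<le> (real n / ln (real n) powr 1.1) * ((4 * \<gamma> + 14) * ln (real n))"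
        using cardS \<gamma> lnn by (intro mult_right_mono) auto
      also have "\<dots> = real n * ((4 * \<gamma> + 14) * ln (real n) / ln (real n) powr 1.1)" by simp
      also have "\<dots> < real n * (\<delta> / 2)" using elim(6) n0 by (intro mult_strict_left_mono) auto
      finally have part2: "real (n - card (S n)) * (ln (real n * (real n)\<^sup>2 / \<epsilon>' n) + ln (real n / \<kappa>)) < real n * (\<delta> / 2)" .
      have "2 * real n * a n / \<epsilon>' n = real n * (\<delta>1 / 2)" using \<epsilon>'(1)[of n] by (simp add: a_def)
      also have "\<dots> \<le> real n * (\<delta> / 2)" using \<delta>1 by (intro mult_left_mono) auto
      finally have part1: "2 * real n * a n / \<epsilon>' n \<le> real n * (\<delta> / 2)" .
      have "\<bar>?d\<bar> < real n * (\<delta> / 2) + real n * (\<delta> / 2)" using D part1 part2 by linarith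
      hence "\<bar>?d\<bar> < real n * \<delta>" by (simp add: mult.commute[of \<delta>])
      hence "\<bar>?d\<bar> / real n < \<delta>" using n0 by (simp add: pos_divide_less_eq mult.commute[of \<delta>])
      moreover have "log_potential n (?A \<omega>) z - ln (cmod (Determinant.det (N' n))) / n = ?d / real n"
        by (simp add: log_potential_def diff_divide_distrib)
      ultimately show ?thesis by (simp add: abs_divide)
    qed
    have "prob {\<omega>\<in>space (P n). \<delta> \<le> \<bar>log_potential n (?A \<omega>) z - ln (cmod (Determinant.det (N' n))) / n\<bar>}
      \<le> prob ({\<omega>\<in>space (P n). a n < T \<omega>} \<union> Bad)"
    proof (rule finite_measure_mono)
      show "{\<omega>\<in>space (P n). \<delta> \<le> \<bar>log_potential n (?A \<omega>) z - ln (cmod (Determinant.det (N' n))) / n\<bar>} \<subseteq> {\<omega>\<in>space (P n). a n < T \<omega>} \<union> Bad"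
        using good by (force simp: not_le[symmetric])
    qed (use Bad(1) in measurable)
    also have "\<dots> \<le> prob {\<omega>\<in>space (P n). a n < T \<omega>} + prob Bad" by (rule measure_Un_le) (use Bad(1) in measurable)
    also have "\<dots> \<le> real n powr (3 / 2 - \<gamma>) / a n + (real n powr (3 / 2 - \<gamma>) + ?t1 n + ?t2 n)"
      by (intro add_mono markov a(1) pBad)
    finally show ?case .
  qed
  show ?thesis
    by (rule tendsto_sandwich[OF _ main tendsto_const]) (use total in auto)
qed

lemma perturbed_entries_measurable:
  assumes P: "prob_space P" and Phi: "iid_entries P n \<Phi> D" and M: "M \<in> carrier_mat n n" and ij: "i < n" "j < n"
  shows "(\<lambda>\<omega>. (M + s \<cdot>\<^sub>m \<Phi> \<omega>) $$ (i, j)) \<in> borel_measurable P"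
proof -
  note [measurable] = iid_entries_measurable[OF P Phi ij]
  have "(\<lambda>\<omega>. M $$ (i, j) + s * \<Phi> \<omega> $$ (i, j)) \<in> borel_measurable P" by measurable
  thus ?thesis
    by (rule measurable_cong[THEN iffD1, rotated]) (use Phi M ij in \<open>auto simp: iid_entries_def\<close>)
qed

lemma perturbed_second_moment:
  assumes P: "prob_space P" and Q: "prob_space Q" and x: "mean_zero_variance_one Q x"
    and Phi: "iid_entries P n \<Phi> (distr Q borel (\<lambda>\<omega>. x \<omega> / of_real (sqrt (real n))))" and n: "n > 0"
    and M: "M \<in> carrier_mat n n" and MK: "(\<Sum>i<n. \<Sum>j<n. (cmod (M $$ (i, j)))\<^sup>2) \<le> K * real n" and K: "K \<ge> 0"
    and s: "cmod s \<le> 1"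
  shows "(\<integral>\<^sup>+\<omega>. ennreal ((\<Sum>i<n. \<Sum>j<n. (cmod ((M + s \<cdot>\<^sub>m \<Phi> \<omega>) $$ (i, j)))\<^sup>2) / n) \<partial>P) \<le> ennreal (2 * K + 2)"
proof -
  interpret prob_space P by (rule P)
  have xm: "x \<in> borel_measurable Q" using x by (simp add: mean_zero_variance_one_def)
  have m: "(\<lambda>\<omega>. ennreal ((cmod (\<Phi> \<omega> $$ (i, j)))\<^sup>2)) \<in> borel_measurable P" if ij: "i < n" "j < n" for i j
  proof -
    note [measurable] = iid_entries_measurable[OF P Phi ij]
    show ?thesis by measurable
  qed
  have mS: "(\<lambda>\<omega>. \<Sum>i<n. \<Sum>j<n. ennreal ((cmod (\<Phi> \<omega> $$ (i, j)))\<^sup>2)) \<in> borel_measurable P"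
    by (intro borel_measurable_sum m) (simp_all only: lessThan_iff)
  have one: "(\<integral>\<^sup>+\<omega>. ennreal ((cmod (\<Phi> \<omega> $$ (i, j)))\<^sup>2) \<partial>P) = ennreal (1 / n)" if ij: "i < n" "j < n" for i j
  proof -
    have "(\<integral>\<^sup>+\<omega>. ennreal ((cmod (\<Phi> \<omega> $$ (i, j)))\<^sup>2) \<partial>P) = (\<integral>\<^sup>+\<omega>. ennreal ((cmod (x \<omega> / of_real (sqrt (real n))))\<^sup>2) \<partial>Q)"
      by (rule iid_entries_nn_integral[OF P Phi ij xm, of "\<lambda>w. ennreal ((cmod w)\<^sup>2)"]) measurable
    also have "\<dots> = (\<integral>\<^sup>+\<omega>. ennreal (1 / n) * ennreal ((cmod (x \<omega>))\<^sup>2) \<partial>Q)"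
      by (intro nn_integral_cong) (simp add: norm_divide power_divide ennreal_mult'[symmetric])
    also have "\<dots> = ennreal (1 / n) * (\<integral>\<^sup>+\<omega>. ennreal ((cmod (x \<omega>))\<^sup>2) \<partial>Q)"
      using xm by (intro nn_integral_cmult) measurable
    also have "\<dots> = ennreal (1 / n)" by (simp only: mean_zero_variance_one_moments(2)[OF Q x] mult_1_right)
    finally show ?thesis .
  qed
  have S: "(\<integral>\<^sup>+\<omega>. (\<Sum>i<n. \<Sum>j<n. ennreal ((cmod (\<Phi> \<omega> $$ (i, j)))\<^sup>2)) \<partial>P) = ennreal n"
  proof -
    have "(\<integral>\<^sup>+\<omega>. (\<Sum>i<n. \<Sum>j<n. ennreal ((cmod (\<Phi> \<omega> $$ (i, j)))\<^sup>2)) \<partial>P)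
      = (\<Sum>i<n. \<integral>\<^sup>+\<omega>. (\<Sum>j<n. ennreal ((cmod (\<Phi> \<omega> $$ (i, j)))\<^sup>2)) \<partial>P)"
      by (intro nn_integral_sum borel_measurable_sum m) auto
    also have "\<dots> = (\<Sum>i<n. \<Sum>j<n. \<integral>\<^sup>+\<omega>. ennreal ((cmod (\<Phi> \<omega> $$ (i, j)))\<^sup>2) \<partial>P)"
      by (intro sum.cong refl nn_integral_sum m) auto
    also have "\<dots> = (\<Sum>i<n. \<Sum>j<n. ennreal (1 / n))" by (intro sum.cong refl one) auto
    also have "\<dots> = ennreal (\<Sum>i<n. \<Sum>j<n. 1 / n)" by (simp only: sum_ennreal sum_nonneg divide_nonneg_nonneg of_nat_0_le_iff zero_le_one)
    also have "(\<Sum>i<n. \<Sum>j<n. 1 / real n) = real n" using n by simp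
    finally show ?thesis .
  qed
  have pt: "(\<Sum>i<n. \<Sum>j<n. (cmod ((M + s \<cdot>\<^sub>m \<Phi> \<omega>) $$ (i, j)))\<^sup>2) / n
      \<le> 2 * K + 2 / n * (\<Sum>i<n. \<Sum>j<n. (cmod (\<Phi> \<omega> $$ (i, j)))\<^sup>2)" if "\<omega> \<in> space P" for \<omega>
  proof -
    have ph: "\<Phi> \<omega> \<in> carrier_mat n n" using Phi that by (simp add: iid_entries_def)
    have e: "(cmod ((M + s \<cdot>\<^sub>m \<Phi> \<omega>) $$ (i, j)))\<^sup>2 \<le> 2 * (cmod (M $$ (i, j)))\<^sup>2 + 2 * (cmod (\<Phi> \<omega> $$ (i, j)))\<^sup>2"
      if ij: "i < n" "j < n" for i j
    proof -
      let ?a = "cmod (M $$ (i, j))" and ?b = "cmod (\<Phi> \<omega> $$ (i, j))"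
      have "cmod ((M + s \<cdot>\<^sub>m \<Phi> \<omega>) $$ (i, j)) = cmod (M $$ (i, j) + s * \<Phi> \<omega> $$ (i, j))" using ij ph M by simp
      also have "\<dots> \<le> ?a + cmod (s * \<Phi> \<omega> $$ (i, j))" by (rule norm_triangle_ineq)
      also have "cmod (s * \<Phi> \<omega> $$ (i, j)) \<le> 1 * ?b" unfolding norm_mult using s by (intro mult_right_mono) auto
      finally have "cmod ((M + s \<cdot>\<^sub>m \<Phi> \<omega>) $$ (i, j)) \<le> ?a + ?b" by simp
      hence "(cmod ((M + s \<cdot>\<^sub>m \<Phi> \<omega>) $$ (i, j)))\<^sup>2 \<le> (?a + ?b)\<^sup>2" by (rule power_mono) simp
      also have "\<dots> \<le> 2 * ?a\<^sup>2 + 2 * ?b\<^sup>2" using zero_le_power2[of "?a - ?b"] by (simp add: power2_eq_square algebra_simps)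
      finally show ?thesis .
    qed
    have "(\<Sum>i<n. \<Sum>j<n. (cmod ((M + s \<cdot>\<^sub>m \<Phi> \<omega>) $$ (i, j)))\<^sup>2)
        \<le> (\<Sum>i<n. \<Sum>j<n. 2 * (cmod (M $$ (i, j)))\<^sup>2 + 2 * (cmod (\<Phi> \<omega> $$ (i, j)))\<^sup>2)"
      by (intro sum_mono e) auto
    also have "\<dots> = 2 * (\<Sum>i<n. \<Sum>j<n. (cmod (M $$ (i, j)))\<^sup>2) + 2 * (\<Sum>i<n. \<Sum>j<n. (cmod (\<Phi> \<omega> $$ (i, j)))\<^sup>2)"
      by (simp only: sum.distrib sum_distrib_left)
    also have "\<dots> \<le> 2 * (K * real n) + 2 * (\<Sum>i<n. \<Sum>j<n. (cmod (\<Phi> \<omega> $$ (i, j)))\<^sup>2)" using MK by simp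
    finally have "(\<Sum>i<n. \<Sum>j<n. (cmod ((M + s \<cdot>\<^sub>m \<Phi> \<omega>) $$ (i, j)))\<^sup>2) / n
      \<le> (2 * (K * real n) + 2 * (\<Sum>i<n. \<Sum>j<n. (cmod (\<Phi> \<omega> $$ (i, j)))\<^sup>2)) / n" by (rule divide_right_mono) simp
    also have "\<dots> = 2 * K + 2 / n * (\<Sum>i<n. \<Sum>j<n. (cmod (\<Phi> \<omega> $$ (i, j)))\<^sup>2)" using n by (simp add: add_divide_distrib)
    finally show ?thesis .
  qed
  have "(\<integral>\<^sup>+\<omega>. ennreal ((\<Sum>i<n. \<Sum>j<n. (cmod ((M + s \<cdot>\<^sub>m \<Phi> \<omega>) $$ (i, j)))\<^sup>2) / n) \<partial>P)
    \<le> (\<integral>\<^sup>+\<omega>. ennreal (2 * K) + ennreal (2 / n) * (\<Sum>i<n. \<Sum>j<n. ennreal ((cmod (\<Phi> \<omega> $$ (i, j)))\<^sup>2)) \<partial>P)"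
  proof (rule nn_integral_mono)
    fix \<omega> assume w: "\<omega> \<in> space P"
    have "(\<Sum>i<n. \<Sum>j<n. ennreal ((cmod (\<Phi> \<omega> $$ (i, j)))\<^sup>2)) = ennreal (\<Sum>i<n. \<Sum>j<n. (cmod (\<Phi> \<omega> $$ (i, j)))\<^sup>2)"
      by (simp only: sum_ennreal sum_nonneg zero_le_power2)
    hence "ennreal (2 * K) + ennreal (2 / n) * (\<Sum>i<n. \<Sum>j<n. ennreal ((cmod (\<Phi> \<omega> $$ (i, j)))\<^sup>2))
      = ennreal (2 * K + 2 / n * (\<Sum>i<n. \<Sum>j<n. (cmod (\<Phi> \<omega> $$ (i, j)))\<^sup>2))"
      using K by (simp only: ennreal_mult'[symmetric] ennreal_plus[symmetric] mult_nonneg_nonneg sum_nonneg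
          zero_le_power2 divide_nonneg_nonneg of_nat_0_le_iff zero_le_numeral)
    thus "ennreal ((\<Sum>i<n. \<Sum>j<n. (cmod ((M + s \<cdot>\<^sub>m \<Phi> \<omega>) $$ (i, j)))\<^sup>2) / n)
      \<le> ennreal (2 * K) + ennreal (2 / n) * (\<Sum>i<n. \<Sum>j<n. ennreal ((cmod (\<Phi> \<omega> $$ (i, j)))\<^sup>2))"
      using pt[OF w] by (simp only: ennreal_leI)
  qed
  also have "\<dots> = (\<integral>\<^sup>+\<omega>. ennreal (2 * K) \<partial>P) + (\<integral>\<^sup>+\<omega>. ennreal (2 / n) * (\<Sum>i<n. \<Sum>j<n. ennreal ((cmod (\<Phi> \<omega> $$ (i, j)))\<^sup>2)) \<partial>P)"
    by (intro nn_integral_add borel_measurable_const borel_measurable_times_ennreal mS)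
  also have "(\<integral>\<^sup>+\<omega>. ennreal (2 / n) * (\<Sum>i<n. \<Sum>j<n. ennreal ((cmod (\<Phi> \<omega> $$ (i, j)))\<^sup>2)) \<partial>P) = ennreal (2 / n) * ennreal n"
    unfolding S[symmetric] by (rule nn_integral_cmult[OF mS])
  also have "\<dots> = ennreal 2" using n by (simp add: ennreal_mult'[symmetric] del: ennreal_numeral)
  also have "(\<integral>\<^sup>+\<omega>. ennreal (2 * K) \<partial>P) = ennreal (2 * K)" by (simp add: emeasure_space_1)
  also have "ennreal (2 * K) + ennreal 2 = ennreal (2 * K + 2)" using K by (simp add: ennreal_plus del: ennreal_numeral)
  finally show ?thesis .
qed

lemma measure_diff_tendsto_0:
  fixes X Y :: "nat \<Rightarrow> 'w \<Rightarrow> real" and c :: "nat \<Rightarrow> real"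
  assumes P: "\<And>n. prob_space (P n)" and X: "\<And>n. X n \<in> borel_measurable (P n)" and Y: "\<And>n. Y n \<in> borel_measurable (P n)"
    and Xc: "\<And>\<delta>. \<delta> > 0 \<Longrightarrow> (\<lambda>n. measure (P n) {\<omega>\<in>space (P n). \<delta> \<le> \<bar>X n \<omega> - c n\<bar>}) \<longlonglongrightarrow> 0"
    and Yc: "\<And>\<delta>. \<delta> > 0 \<Longrightarrow> (\<lambda>n. measure (P n) {\<omega>\<in>space (P n). \<delta> \<le> \<bar>Y n \<omega> - c n\<bar>}) \<longlonglongrightarrow> 0"
    and \<delta>: "\<delta> > 0"
  shows "(\<lambda>n. measure (P n) {\<omega>\<in>space (P n). \<delta> \<le> \<bar>X n \<omega> - Y n \<omega>\<bar>}) \<longlonglongrightarrow> 0"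
proof (rule tendsto_sandwich[OF _ _ tendsto_const])
  let ?X = "\<lambda>n. {\<omega>\<in>space (P n). \<delta> / 2 \<le> \<bar>X n \<omega> - c n\<bar>}" and ?Y = "\<lambda>n. {\<omega>\<in>space (P n). \<delta> / 2 \<le> \<bar>Y n \<omega> - c n\<bar>}"
  show "(\<lambda>n. measure (P n) (?X n) + measure (P n) (?Y n)) \<longlonglongrightarrow> 0"
    using tendsto_add[OF Xc[of "\<delta> / 2"] Yc[of "\<delta> / 2"]] \<delta> by simp
  have "measure (P n) {\<omega>\<in>space (P n). \<delta> \<le> \<bar>X n \<omega> - Y n \<omega>\<bar>} \<le> measure (P n) (?X n) + measure (P n) (?Y n)" for n
  proof -
    interpret prob_space "P n" by (rule P)
    note [measurable] = X[of n] Y[of n]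
    have [measurable]: "?X n \<in> sets (P n)" "?Y n \<in> sets (P n)" by measurable
    have "measure (P n) {\<omega>\<in>space (P n). \<delta> \<le> \<bar>X n \<omega> - Y n \<omega>\<bar>} \<le> measure (P n) (?X n \<union> ?Y n)"
    proof (rule finite_measure_mono)
      have "\<delta> / 2 \<le> \<bar>u - w\<bar> \<or> \<delta> / 2 \<le> \<bar>v - w\<bar>" if "\<delta> \<le> \<bar>u - v\<bar>" for u v w :: real
        using that abs_triangle_ineq4[of "u - w" "v - w"] by auto
      thus "{\<omega>\<in>space (P n). \<delta> \<le> \<bar>X n \<omega> - Y n \<omega>\<bar>} \<subseteq> ?X n \<union> ?Y n" by blast
    qed measurable
    also have "\<dots> \<le> measure (P n) (?X n) + measure (P n) (?Y n)" by (rule measure_Un_le) measurable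
    finally show ?thesis .
  qed
  thus "eventually (\<lambda>n. measure (P n) {\<omega>\<in>space (P n). \<delta> \<le> \<bar>X n \<omega> - Y n \<omega>\<bar>} \<le> measure (P n) (?X n) + measure (P n) (?Y n)) sequentially"
    by simp
qed simp

lemma perturbed_log_potential_measurable:
  assumes P: "prob_space P" and Phi: "iid_entries P n \<Phi> D" and M: "M \<in> carrier_mat n n"
  shows "(\<lambda>\<omega>. log_potential n (M + s \<cdot>\<^sub>m \<Phi> \<omega>) z) \<in> borel_measurable P"
proof -
  have "(\<lambda>x. log_potential n (M + s \<cdot>\<^sub>m \<Phi> (fst x)) (snd x)) \<in> borel_measurable (P \<Otimes>\<^sub>M lborel)"
    by (rule log_potential_measurable[where A = "\<lambda>\<omega>. M + s \<cdot>\<^sub>m \<Phi> \<omega>"])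
      (use M Phi perturbed_entries_measurable[OF P Phi M] in \<open>auto simp: iid_entries_def\<close>)
  hence "(\<lambda>x. log_potential n (M + s \<cdot>\<^sub>m \<Phi> (fst x)) (snd x)) \<circ> (\<lambda>\<omega>. (\<omega>, z)) \<in> borel_measurable P"
    by (rule measurable_comp[rotated]) simp
  thus ?thesis by (simp add: comp_def)
qed

theorem theorem2:
  fixes M :: "nat \<Rightarrow> complex mat"
    and Qx :: "'a measure" and x :: "'a \<Rightarrow> complex"
    and Qy :: "'b measure" and y :: "'b \<Rightarrow> complex"
    and P :: "nat \<Rightarrow> 'w measure"
    and \<Phi> \<Psi> :: "nat \<Rightarrow> 'w \<Rightarrow> complex mat"
    and \<gamma> :: real
  assumes M: "\<And>n. M n \<in> carrier_mat n n"
    and M_bound: "bdd_above ((\<lambda>n. (hs_norm (M n))\<^sup>2 / real n) ` {1..})"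
    and x: "prob_space Qx" "mean_zero_variance_one Qx x"
    and y: "prob_space Qy" "mean_zero_variance_one Qy y"
    and P: "\<And>n. prob_space (P n)"
    and Phi: "\<And>n. iid_entries (P n) n (\<Phi> n) (distr Qx borel (\<lambda>\<omega>. x \<omega> / of_real (sqrt (real n))))"
    and Psi: "\<And>n. iid_entries (P n) n (\<Psi> n) (distr Qy borel (\<lambda>\<omega>. y \<omega> / of_real (sqrt (real n))))"
    and \<gamma>: "\<gamma> > 3 / 2"
    and stability: "AE z in lebesgue. \<exists>\<epsilon> :: nat \<Rightarrow> real.
          (\<forall>n. 0 < \<epsilon> n) \<and>
          (\<forall>n\<ge>2. \<exists>S\<subseteq>{..<n}.
             real (card S) \<ge> real n - real n / ln (real n) powr 1.1 \<and>
             eps_stable n (\<epsilon> n) (\<lambda>i. Matrix.row (M n + z \<cdot>\<^sub>m 1\<^sub>m n) i) S) \<and>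
          (\<lambda>n. real n powr (3 / 4 - \<gamma> / 2) * ln (real n) / \<epsilon> n) \<longlonglongrightarrow> 0"
  shows "measure_diff_tendsto_zero_in_prob P
           (\<lambda>n \<omega>. esd (M n + of_real (real n powr - \<gamma>) \<cdot>\<^sub>m \<Phi> n \<omega>))
           (\<lambda>n \<omega>. esd (M n + of_real (real n powr - \<gamma>) \<cdot>\<^sub>m \<Psi> n \<omega>))"
proof -
  define A where "A n \<omega> = M n + of_real (real n powr - \<gamma>) \<cdot>\<^sub>m \<Phi> n \<omega>" for n \<omega>
  define B where "B n \<omega> = M n + of_real (real n powr - \<gamma>) \<cdot>\<^sub>m \<Psi> n \<omega>" for n \<omega>
  obtain K0 where K0: "\<And>n. n \<ge> 1 \<Longrightarrow> (hs_norm (M n))\<^sup>2 / real n \<le> K0"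
    using M_bound by (auto simp: bdd_above_def)
  define K where "K = max K0 0"
  have K: "K \<ge> 0" by (simp add: K_def)
  have MK: "(\<Sum>i<n. \<Sum>j<n. (cmod (M n $$ (i, j)))\<^sup>2) \<le> K * real n" if n: "n > 0" for n
  proof -
    have "(hs_norm (M n))\<^sup>2 / real n \<le> K" using K0[of n] n by (simp add: K_def)
    hence "(hs_norm (M n))\<^sup>2 \<le> K * real n" using n by (simp add: pos_divide_le_eq)
    thus ?thesis by (simp only: hs_norm_sq[OF M])
  qed
  have s1: "cmod (of_real (real n powr - \<gamma>)) \<le> 1" if n: "n > 0" for n
  proof -
    have "real n powr - \<gamma> \<le> real n powr 0" using \<gamma> n by (intro powr_mono) auto
    thus ?thesis using n by simp
  qed
  have AE: "AE z in lborel. \<exists>\<epsilon> :: nat \<Rightarrow> real.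
          (\<forall>n. 0 < \<epsilon> n) \<and>
          (\<forall>n\<ge>2. \<exists>S\<subseteq>{..<n}.
             real (card S) \<ge> real n - real n / ln (real n) powr 1.1 \<and>
             eps_stable n (\<epsilon> n) (\<lambda>i. Matrix.row (M n + z \<cdot>\<^sub>m 1\<^sub>m n) i) S) \<and>
          (\<lambda>n. real n powr (3 / 4 - \<gamma> / 2) * ln (real n) / \<epsilon> n) \<longlonglongrightarrow> 0"
    using stability by (simp only: AE_completion_iff)
  have conv: "AE z in lborel. \<forall>\<delta>>0. (\<lambda>n. measure (P n) {\<omega>\<in>space (P n).
        \<delta> \<le> \<bar>log_potential n (A n \<omega>) z - log_potential n (B n \<omega>) z\<bar>}) \<longlonglongrightarrow> 0"
    using AE
  proof eventually_elim
    case (elim z)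
    then obtain \<epsilon> :: "nat \<Rightarrow> real" where e: "(\<forall>n. 0 < \<epsilon> n) \<and>
          (\<forall>n\<ge>2. \<exists>S\<subseteq>{..<n}.
             real (card S) \<ge> real n - real n / ln (real n) powr 1.1 \<and>
             eps_stable n (\<epsilon> n) (\<lambda>i. Matrix.row (M n + z \<cdot>\<^sub>m 1\<^sub>m n) i) S) \<and>
          (\<lambda>n. real n powr (3 / 4 - \<gamma> / 2) * ln (real n) / \<epsilon> n) \<longlonglongrightarrow> 0" by (rule exE)
    note \<epsilon> = e[THEN conjunct1, rule_format] and ex = e[THEN conjunct2, THEN conjunct1, rule_format]
      and lim = e[THEN conjunct2, THEN conjunct2]
    define good where "good n S N' \<longleftrightarrow> S \<subseteq> {..<n} \<and> real (card S) \<ge> real n - real n / ln (real n) powr 1.1 \<and> N' \<in> carrier_mat n n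
      \<and> (\<forall>i\<in>S. \<forall>k<n. N' $$ (i, k) = (M n + z \<cdot>\<^sub>m 1\<^sub>m n) $$ (i, k)) \<and> (\<forall>i\<in>{..<n} - S. l2 n (\<lambda>k. N' $$ (i, k)) = 1)
      \<and> rows_stable n (min (\<epsilon> n) 1) (\<lambda>i k. N' $$ (i, k)) {..<n}" for n S N'
    have "\<exists>S N'. good n S N'" if n: "n \<ge> 2" for n
    proof -
      obtain S where S: "S \<subseteq> {..<n}" and card: "real (card S) \<ge> real n - real n / ln (real n) powr 1.1"
        and st: "eps_stable n (\<epsilon> n) (\<lambda>i. Matrix.row (M n + z \<cdot>\<^sub>m 1\<^sub>m n) i) S"
        using ex[OF n] by (elim exE conjE)
      have N: "M n + z \<cdot>\<^sub>m 1\<^sub>m n \<in> carrier_mat n n" using M[of n] by simp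
      have "rows_stable n (\<epsilon> n) (\<lambda>i k. (M n + z \<cdot>\<^sub>m 1\<^sub>m n) $$ (i, k)) S"
        by (rule eps_stable_rows_stable[OF N S \<epsilon> st])
      from stable_completion[OF S this less_imp_le[OF \<epsilon>]] obtain r'
        where r': "\<forall>i\<in>S. r' i = (\<lambda>k. (M n + z \<cdot>\<^sub>m 1\<^sub>m n) $$ (i, k))" "\<forall>i\<in>{..<n}-S. l2 n (r' i) = 1"
          "rows_stable n (min (\<epsilon> n) 1) r' {..<n}" by metis
      define N' where "N' = Matrix.mat n n (\<lambda>(i, k). r' i k)"
      have N'e: "N' $$ (i, k) = r' i k" if "i < n" "k < n" for i k using that by (simp add: N'_def)
      have l2': "l2 n (\<lambda>k. N' $$ (i, k)) = l2 n (r' i)" if "i < n" for i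
        by (rule L2_set_cong) (use that N'e in auto)
      have "rows_stable n (min (\<epsilon> n) 1) (\<lambda>i k. N' $$ (i, k)) {..<n}"
      proof -
        have "l2 n (\<lambda>k. \<Sum>i<n. c i * N' $$ (i, k)) = l2 n (\<lambda>k. \<Sum>i<n. c i * r' i k)" for c
          by (rule L2_set_cong) (use N'e in auto)
        thus ?thesis using r'(3) by (simp add: rows_stable_def)
      qed
      moreover have "N' \<in> carrier_mat n n" by (simp add: N'_def)
      moreover have "\<forall>i\<in>S. \<forall>k<n. N' $$ (i, k) = (M n + z \<cdot>\<^sub>m 1\<^sub>m n) $$ (i, k)"
      proof (intro ballI allI impI)
        fix i k assume ik: "i \<in> S" "k < n"
        hence "i < n" using S by auto
        thus "N' $$ (i, k) = (M n + z \<cdot>\<^sub>m 1\<^sub>m n) $$ (i, k)" using ik r'(1) N'e by simp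
      qed
      moreover have "\<forall>i\<in>{..<n} - S. l2 n (\<lambda>k. N' $$ (i, k)) = 1" using l2' r'(2) by simp
      ultimately have "good n S N'" unfolding good_def using S card by (intro conjI)
      thus ?thesis by (intro exI)
    qed
    hence "\<forall>n. \<exists>S N'. n \<ge> 2 \<longrightarrow> good n S N'" by blast
    then obtain S N' where "\<And>n. n \<ge> 2 \<Longrightarrow> good n (S n) (N' n)" by metis
    note SN = this[unfolded good_def]
    show ?case
    proof (intro allI impI)
      fix \<delta> :: real assume \<delta>: "\<delta> > 0"
      show "(\<lambda>n. measure (P n) {\<omega>\<in>space (P n). \<delta> \<le> \<bar>log_potential n (A n \<omega>) z - log_potential n (B n \<omega>) z\<bar>}) \<longlonglongrightarrow> 0"
      proof (rule measure_diff_tendsto_0[OF P _ _ _ _ \<delta>])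
        show "(\<lambda>\<omega>. log_potential n (A n \<omega>) z) \<in> borel_measurable (P n)" for n
          unfolding A_def by (rule perturbed_log_potential_measurable[OF P Phi M])
        show "(\<lambda>\<omega>. log_potential n (B n \<omega>) z) \<in> borel_measurable (P n)" for n
          unfolding B_def by (rule perturbed_log_potential_measurable[OF P Psi M])
        show "(\<lambda>n. measure (P n) {\<omega>\<in>space (P n). \<eta> \<le> \<bar>log_potential n (A n \<omega>) z - ln (cmod (Determinant.det (N' n))) / n\<bar>}) \<longlonglongrightarrow> 0"
          if \<eta>: "\<eta> > 0" for \<eta>
          unfolding A_def
          by (rule log_potential_concentrates[OF M MK x P Phi \<gamma> _ _ \<epsilon> lim _ _ _ _ \<eta>, where S = S]) (use SN in blast)+
        show "(\<lambda>n. measure (P n) {\<omega>\<in>space (P n). \<eta> \<le> \<bar>log_potential n (B n \<omega>) z - ln (cmod (Determinant.det (N' n))) / n\<bar>}) \<longlonglongrightarrow> 0"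
          if \<eta>: "\<eta> > 0" for \<eta>
          unfolding B_def
          by (rule log_potential_concentrates[OF M MK y P Psi \<gamma> _ _ \<epsilon> lim _ _ _ _ \<eta>, where S = S]) (use SN in blast)+
      qed
    qed
  qed
  show ?thesis
    unfolding measure_diff_tendsto_zero_in_prob_def
  proof (intro allI impI)
    fix g :: "complex \<Rightarrow> complex" assume g: "smooth g \<and> compactly_supported g"
    hence "differentiable_upto 0 g" unfolding smooth_def by blast
    hence cont: "continuous_on UNIV g" by simp
    have "tendsto_zero_in_prob P (\<lambda>n \<omega>. (\<integral>z. g z \<partial>esd (A n \<omega>)) - (\<integral>z. g z \<partial>esd (B n \<omega>)))"
    proof (rule replacement_principle[OF P _ _ _ _ _ _ _ conv cont, where K = "2 * K + 2"])
      show "A n \<omega> \<in> carrier_mat n n" if "\<omega> \<in> space (P n)" for n \<omega>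
        using M[of n] Phi[of n] that by (simp add: A_def iid_entries_def)
      show "B n \<omega> \<in> carrier_mat n n" if "\<omega> \<in> space (P n)" for n \<omega>
        using M[of n] Psi[of n] that by (simp add: B_def iid_entries_def)
      show "(\<lambda>\<omega>. A n \<omega> $$ (i, j)) \<in> borel_measurable (P n)" if "i < n" "j < n" for n i j
        unfolding A_def by (rule perturbed_entries_measurable[OF P Phi M that])
      show "(\<lambda>\<omega>. B n \<omega> $$ (i, j)) \<in> borel_measurable (P n)" if "i < n" "j < n" for n i j
        unfolding B_def by (rule perturbed_entries_measurable[OF P Psi M that])
      show "(\<integral>\<^sup>+\<omega>. ennreal ((\<Sum>i<n. \<Sum>j<n. (cmod (A n \<omega> $$ (i, j)))\<^sup>2) / n) \<partial>P n) \<le> ennreal (2 * K + 2)" if "n > 0" for n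
        unfolding A_def by (rule perturbed_second_moment[OF P x Phi that M MK[OF that] K s1[OF that]])
      show "(\<integral>\<^sup>+\<omega>. ennreal ((\<Sum>i<n. \<Sum>j<n. (cmod (B n \<omega> $$ (i, j)))\<^sup>2) / n) \<partial>P n) \<le> ennreal (2 * K + 2)" if "n > 0" for n
        unfolding B_def by (rule perturbed_second_moment[OF P y Psi that M MK[OF that] K s1[OF that]])
    qed (use K g in auto)
    thus "tendsto_zero_in_prob P (\<lambda>n \<omega>. (\<integral>z. g z \<partial>esd (M n + of_real (real n powr - \<gamma>) \<cdot>\<^sub>m \<Phi> n \<omega>))
        - (\<integral>z. g z \<partial>esd (M n + of_real (real n powr - \<gamma>) \<cdot>\<^sub>m \<Psi> n \<omega>)))"
      by (simp only: A_def B_def)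
  qed
qed

end
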